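(* For every real $\gamma$ with $1<\gamma\leq 2$ there exists a constant $C_\gamma>0$ such that for all real $x\geq 2$ $$\sum_{n\geq 1:\ s_{n+1}\leq x} (s_{n+1}-s_n)^\gamma \leq C_\gamma\, x(\ln x)^{\frac{3}{2}(\gamma-1)}\,\delta(x,\gamma),$$ where $\delta(x,\gamma)=1$ if $\gamma<2$ and $\delta(x,\gamma)=\ln x$ if $\gamma=2$.
   Context: $s_1<s_2<s_3<\ldots$ is the increasing enumeration of the set $\mathcal S=\{1,2,4,5,8,\ldots\}$ of all positive integers that can be written as $a^2+b^2$ with $a,b\in\mathbb Z$ (zero is allowed as a value of $a$ or $b$). *)

theory Defs
  imports "HOL-Analysis.Analysis" "HOL-Library.Infinite_Set"
begin

definition two_squares :: "nat set" where
  "two_squares = {m. m > 0 \<and> (\<exists>a b :: int. int m = a\<^sup>2 + b\<^sup>2)}"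

(* The enumeration is 1-based, whereas enumerate is 0-based. The value at 0 is a dummy. *)
definition s_seq :: "nat \<Rightarrow> nat" where
  "s_seq n = enumerate two_squares (n - 1)"

(* Only used for 1 < g \<le> 2, so the else branch is the case g = 2. *)
definition log_factor :: "real \<Rightarrow> real \<Rightarrow> real" where
  "log_factor x g = (if g < 2 then 1 else ln x)"

lemma infinite_two_squares: "infinite two_squares"
proof -
  have "range (\<lambda>k::nat. (Suc k)\<^sup>2) \<subseteq> two_squares"
  proof
    fix m assume "m \<in> range (\<lambda>k::nat. (Suc k)\<^sup>2)"
    then obtain k where k: "m = (Suc k)\<^sup>2" by auto
    then have "int m = (int (Suc k))\<^sup>2 + 0\<^sup>2" by simp
    with k show "m \<in> two_squares" unfolding two_squares_def by fastforce
  qed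
  moreover have "inj (\<lambda>k::nat. (Suc k)\<^sup>2)"
    by (rule injI) (simp add: power2_eq_iff_nonneg)
  ultimately show ?thesis
    using infinite_super range_inj_infinite by blast
qed

lemma s_seq_range: "s_seq ` {1..} = two_squares"
proof -
  have "{1..} = range Suc"
    by (auto simp: image_iff Suc_le_eq gr0_conv_Suc)
  then have "s_seq ` {1..} = s_seq ` range Suc"
    by simp
  also have "\<dots> = range (enumerate two_squares)"
    by (simp add: image_image s_seq_def)
  finally show ?thesis
    using range_enumerate[OF infinite_two_squares] by simp
qed

lemma s_seq_strict_mono: "strict_mono_on {1..} s_seq"
  by (rule strict_mono_onI) (auto simp: s_seq_def infinite_two_squares)

(* The range of summation is finite, so the sum over it is not a default value. *)
lemma finite_s_seq_le: "finite {n. 1 \<le> n \<and> real (s_seq (n + 1)) \<le> x}"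
proof (rule finite_subset)
  show "{n. 1 \<le> n \<and> real (s_seq (n + 1)) \<le> x} \<subseteq> {..nat \<lfloor>x\<rfloor>}"
  proof
    fix n assume "n \<in> {n. 1 \<le> n \<and> real (s_seq (n + 1)) \<le> x}"
    moreover have "n \<le> s_seq (n + 1)"
      using le_enumerate[OF infinite_two_squares, of n] by (simp add: s_seq_def)
    ultimately have "real n \<le> x" by (auto intro: order_trans)
    then show "n \<in> {..nat \<lfloor>x\<rfloor>}" by (simp add: le_nat_floor)
  qed
qed simp

end

theory Submission
  imports Defs
    "HOL-Probability.Probability"
    "HOL-Complex_Analysis.Complex_Analysis"
    "HOL-Library.Discrete_Functions"
begin

text \<open>
Let \<open>r(n)\<close> be the number of representations of \<open>n\<close> as a sum of two squares. If no sum of two squares lies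
in \<open>[m, m + h)\<close>, then the sum of \<open>(r(n) - \<pi>) e\<^sup>-\<^sup>n\<^sup>/\<^sup>x\<close> over this block has modulus at least \<open>h\<close> (for \<open>m + h \<le> x\<close>).
By Bessel's inequality, up to a constant factor, the sum over \<open>m\<close> of the squares of the block sums is at most the integral over \<open>|y| \<le> \<pi>\<close> of
\<open>|\<theta>(s)\<^sup>2 - \<pi>/(1 - e\<^sup>-\<^sup>s)|\<^sup>2 min(h\<^sup>2, 1/y\<^sup>2)\<close> on the line \<open>s = 1/x + iy\<close>, where \<open>\<theta>(s)\<close> is the sum of \<open>exp(-k\<^sup>2 s)\<close> over the integers \<open>k\<close>.
The transformation formula \<open>\<theta>(s)\<^sup>2 = (\<pi>/s) \<theta>(\<pi>\<^sup>2/s)\<^sup>2\<close> removes the pole at \<open>s = 0\<close>: up to a bounded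
error one integrates \<open>|\<pi>/s|\<^sup>2 |\<Sum>\<^sub>n r(n) e\<^sup>-\<^sup>n\<^sup>w|\<^sup>2\<close> over \<open>n \<ge> 1\<close>, where \<open>w = \<pi>\<^sup>2/s\<close>. The diagonal terms are
controlled by the second moment \<open>\<Sum>\<^sub>n\<^sub>\<le>\<^sub>N r(n)\<^sup>2 = O(N log N)\<close>; the off-diagonal ones oscillate in \<open>y\<close> and
one integration by parts saves a factor \<open>|n - m|\<close>. The outcome is \<open>O(x h log x + x log\<^sup>3 x)\<close>, so the gaps
of length at least \<open>h \<ge> (log x)\<^sup>3\<^sup>/\<^sup>2\<close> have total length \<open>O(x (log x)\<^sup>3\<^sup>/\<^sup>2 / h)\<close>. Summing
over dyadic \<open>h\<close>, with the trivial bound \<open>x\<close> for smaller \<open>h\<close>, gives the moment bound.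
\<close>

section \<open>The theta transformation\<close>

text \<open>The number \<pi> is the mean of r(n), and \<pi>/s is the pole of theta squared at 0. The
  weight e^(-n/x) makes all series converge but stays above 1/3 for n \<le> x; as \<pi>/3 > 1, a
  window of length h inside a gap still has a block sum of modulus at least h. The off-diagonal
  terms can be integrated by parts because their phase has no stationary point: a + iy and a - iy
  have equal modulus, so the derivative of the exponent has size at least of order |n - m|/(a^2 +
  y^2). The three logarithms in x log^3 x come from the second moment of r, from the sum of 1/|n -
  m|, and from the integral of 1/sqrt(h^(-2) + y^2). The exponent 3/2 is a balance: after division
  by h^2 the mean square gives x log x/h + x log^3 x/h^2 for the total length of the long gaps. The
  second term passes the trivial bound x at h = (log x)^(3/2), and from there on both are O(x (log
  x)^(3/2)/h). For \<gamma> = 2 all dyadic scales contribute equally, and their number is the extra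
  factor log x.\<close>

text \<open>Weierstrass approximation in the variable \<open>cos t\<close>, which runs monotonically through \<open>[-1, 1]\<close>.\<close>

lemma cos_orthogonal_imp_zero:
  fixes f :: "real \<Rightarrow> real"
  assumes f: "continuous_on {0..pi} f"
    and orth: "\<And>m::nat. integral {0..pi} (\<lambda>t. f t * cos (real m * t)) = 0"
    and t: "t \<in> {0..pi}"
  shows "f t = 0"
proof -
  \<comment> \<open>\<open>m\<close> stays free in the induction: a factor \<open>cos t\<close> is
    traded for the neighbouring frequencies m - 1 and m + 1.\<close>
  have pow: "integral {0..pi} (\<lambda>t. f t * cos (real m * t) * cos t ^ n) = 0" for m n :: nat
  proof (induction n arbitrary: m)
    case 0
    then show ?case using orth by simp
  next
    case (Suc n)
    have int: "(\<lambda>t. f t * cos (real m * t) * cos t ^ n) integrable_on {0..pi}" for m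
      by (intro integrable_continuous_real continuous_intros f)
    show ?case
    proof (cases m)
      case 0
      then show ?thesis using Suc.IH[of 1] by (simp add: mult_ac)
    next
      case m: (Suc k)
      have "f t * cos (real m * t) * cos t ^ Suc n =
        (1/2) * (f t * cos (real k * t) * cos t ^ n) + (1/2) * (f t * cos (real (Suc m) * t) * cos t ^ n)" for t
      proof -
        have "cos (real m * t) * cos t = (cos (real k * t) + cos (real (Suc m) * t)) / 2"
          unfolding cos_times_cos m by (simp add: algebra_simps)
        then have "f t * (cos (real m * t) * cos t) * cos t ^ n =
          f t * ((cos (real k * t) + cos (real (Suc m) * t)) / 2) * cos t ^ n" by (simp only:)
        then show ?thesis by (simp add: field_simps del: of_nat_Suc)
      qed
      then show ?thesis
        using Suc.IH[of k] Suc.IH[of "Suc m"] int[of k] int[of "Suc m"]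
        by (simp add: integral_add integral_mult_right integrable_on_mult_right)
    qed
  qed
  have poly: "integral {0..pi} (\<lambda>t. f t * p (cos t)) = 0" if p: "real_polynomial_function p" for p
  proof -
    obtain a n where a: "p = (\<lambda>x. \<Sum>i\<le>n. a i * x ^ i)"
      using p real_polynomial_function_iff_sum by blast
    have int: "(\<lambda>t. f t * cos t ^ i) integrable_on {0..pi}" for i
      by (intro integrable_continuous_real continuous_intros f)
    have "integral {0..pi} (\<lambda>t. f t * p (cos t)) = integral {0..pi} (\<lambda>t. \<Sum>i\<le>n. a i * (f t * cos t ^ i))"
      by (simp add: a sum_distrib_left mult_ac)
    also have "\<dots> = (\<Sum>i\<le>n. a i * integral {0..pi} (\<lambda>t. f t * cos t ^ i))"
      by (subst integral_sum) (auto intro!: integrable_on_mult_right int)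
    also have "\<dots> = 0" using pow[of 0] by simp
    finally show ?thesis .
  qed
  have cf2: "continuous_on {0..pi} (\<lambda>t. (f t)\<^sup>2)" by (intro continuous_intros f)
  \<comment> \<open>With p(cos t) uniformly within e of f, the square of f may be replaced by f (f -
    p(cos t)), as the polynomial part integrates to 0.\<close>
  have small: "integral {0..pi} (\<lambda>t. (f t)\<^sup>2) \<le> e * integral {0..pi} (\<lambda>t. \<bar>f t\<bar>)" if e: "e > 0" for e
  proof -
    have "continuous_on {-1..1} (\<lambda>x. f (arccos x))"
      by (rule continuous_on_compose2[OF f]) (auto intro!: continuous_intros simp: arccos_lbound arccos_ubound)
    then obtain p where p: "real_polynomial_function p"
      "\<And>x. x \<in> {-1..1} \<Longrightarrow> \<bar>f (arccos x) - p x\<bar> < e"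
      using Stone_Weierstrass_real_polynomial_function[of "{-1..1::real}" "\<lambda>x. f (arccos x)" e] e by blast
    have cp: "continuous_on {0..pi} (\<lambda>t. p (cos t))"
    proof (rule continuous_on_compose2[of UNIV p])
      show "continuous_on UNIV p"
        using p(1) by (simp add: real_polynomial_function_eq continuous_on_polymonial_function)
    qed (auto intro!: continuous_intros)
    have close: "\<bar>f t - p (cos t)\<bar> < e" if "t \<in> {0..pi}" for t
      using p(2)[of "cos t"] that by (simp add: arccos_cos)
    have "integral {0..pi} (\<lambda>t. (f t)\<^sup>2) =
      integral {0..pi} (\<lambda>t. (f t)\<^sup>2 - f t * p (cos t))"
      by (subst integral_diff) (auto intro!: integrable_continuous_real continuous_intros f cp simp: poly p(1))
    also have "\<dots> \<le> integral {0..pi} (\<lambda>t. e * \<bar>f t\<bar>)"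
    proof (rule integral_le)
      fix t assume t: "t \<in> {0..pi}"
      have "(f t)\<^sup>2 - f t * p (cos t) = f t * (f t - p (cos t))" by (simp add: power2_eq_square algebra_simps)
      also have "\<dots> \<le> \<bar>f t\<bar> * \<bar>f t - p (cos t)\<bar>" by (metis abs_ge_self abs_mult)
      also have "\<dots> \<le> \<bar>f t\<bar> * e" using close[OF t] by (intro mult_left_mono) auto
      finally show "(f t)\<^sup>2 - f t * p (cos t) \<le> e * \<bar>f t\<bar>" by (simp add: mult_ac)
    qed (auto intro!: integrable_continuous_real continuous_intros f cp)
    finally show ?thesis by simp
  qed
  have "integral {0..pi} (\<lambda>t. (f t)\<^sup>2) \<le> 0"
  proof (rule field_le_epsilon)
    fix e :: real assume e: "e > 0"
    define I where "I = integral {0..pi} (\<lambda>t. \<bar>f t\<bar>)"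
    have I: "I \<ge> 0" unfolding I_def by (rule integral_nonneg) (auto intro!: integrable_continuous_real continuous_intros f)
    have "integral {0..pi} (\<lambda>t. (f t)\<^sup>2) \<le> e / (I + 1) * I" unfolding I_def
      by (rule small) (use e I in \<open>auto simp: I_def\<close>)
    also have "\<dots> \<le> e" using e I by (simp add: field_simps)
    finally show "integral {0..pi} (\<lambda>t. (f t)\<^sup>2) \<le> 0 + e" by simp
  qed
  moreover have "integral {0..pi} (\<lambda>t. (f t)\<^sup>2) \<ge> 0"
    by (rule integral_nonneg) (auto intro!: integrable_continuous_real cf2)
  ultimately have "integral (cbox 0 pi) (\<lambda>t. (f t)\<^sup>2) = 0" by simp
  then have "((\<lambda>t. (f t)\<^sup>2) has_integral 0) (cbox 0 pi)"
    using integrable_continuous_real[OF cf2] by (simp add: has_integral_integrable_integral)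
  then have "(f t)\<^sup>2 = 0"
    using has_integral_0_cbox_imp_0[of 0 pi "\<lambda>t. (f t)\<^sup>2" t] cf2 t pi_gt_zero by auto
  then show ?thesis by simp
qed

section \<open>Cosine integrals of Gaussians over the half line\<close>

lemma std_normal_cos_integral:
  "(\<integral>x. std_normal_density x * cos (t * x) \<partial>lborel) = exp (- t\<^sup>2 / 2)"
proof -
  have "char std_normal_distribution t = (\<integral>x. std_normal_density x *\<^sub>R iexp (t * x) \<partial>lborel)"
    unfolding char_def by (subst integral_density) (auto simp: normal_density_nonneg)
  then have "exp (- t\<^sup>2 / 2) = Re (\<integral>x. std_normal_density x *\<^sub>R iexp (t * x) \<partial>lborel)"
    unfolding char_std_normal_distribution by (metis Re_complex_of_real)
  also have "\<dots> = (\<integral>x. Re (std_normal_density x *\<^sub>R iexp (t * x)) \<partial>lborel)"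
  proof (rule integral_Re[symmetric])
    show "integrable lborel (\<lambda>x. std_normal_density x *\<^sub>R iexp (t * x))"
      by (rule Bochner_Integration.integrable_bound[of _ "std_normal_density"]) (auto simp: norm_exp_i_times normal_density_nonneg integrable_normal_density)
  qed
  finally show ?thesis by (simp add: Re_exp)
qed

text \<open>Substituting u = sqrt(2s) x reduces this to the characteristic function of the standard
  normal law. The factor 2 is kept apart because only half of the line is used later.\<close>

lemma gaussian_cos_integral:
  fixes s m :: real
  assumes s: "s > 0"
  shows "integrable lborel (\<lambda>u. exp (-u\<^sup>2 / (4 * s)) * cos (m * u))"
    and "(\<integral>u. exp (-u\<^sup>2 / (4 * s)) * cos (m * u) \<partial>lborel) = 2 * (sqrt (pi * s) * exp (- m\<^sup>2 * s))"
proof -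
  have eq: "exp (-(sqrt (2 * s) * x)\<^sup>2 / (4 * s)) = sqrt (2 * pi) * std_normal_density x" for x
    using s by (simp add: std_normal_density_def power_mult_distrib)
  have int: "integrable lborel (\<lambda>u. exp (-u\<^sup>2 / (4 * s)))"
  proof -
    have "integrable lborel (\<lambda>x. exp (-(0 + sqrt (2 * s) * x)\<^sup>2 / (4 * s)))"
      using eq integrable_normal_density[of 1 0] by simp
    then show ?thesis using s by (subst (asm) lborel_integrable_real_affine_iff) auto
  qed
  show "integrable lborel (\<lambda>u. exp (-u\<^sup>2 / (4 * s)) * cos (m * u))"
    by (rule Bochner_Integration.integrable_bound[OF int]) (auto simp: abs_mult mult_left_le)
  have "(\<integral>u. exp (-u\<^sup>2 / (4 * s)) * cos (m * u) \<partial>lborel)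
    = sqrt (2 * s) * (\<integral>x. exp (-(sqrt (2 * s) * x)\<^sup>2 / (4 * s)) * cos (m * (sqrt (2 * s) * x)) \<partial>lborel)"
    using s by (subst lborel_integral_real_affine[where c = "sqrt (2 * s)" and t = 0]) auto
  also have "\<dots> = sqrt (2 * s) * (\<integral>x. sqrt (2 * pi) * (std_normal_density x * cos ((m * sqrt (2 * s)) * x)) \<partial>lborel)"
    unfolding eq by (simp only: mult.assoc)
  also have "\<dots> = sqrt (2 * s) * (sqrt (2 * pi) * exp (- (m * sqrt (2 * s))\<^sup>2 / 2))"
    by (subst Bochner_Integration.integral_mult_right_zero) (simp only: std_normal_cos_integral)
  also have "\<dots> = 2 * (sqrt (pi * s) * exp (- m\<^sup>2 * s))"
    using s by (simp add: real_sqrt_mult power_mult_distrib)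
  finally show "(\<integral>u. exp (-u\<^sup>2 / (4 * s)) * cos (m * u) \<partial>lborel) = 2 * (sqrt (pi * s) * exp (- m\<^sup>2 * s))" .
qed

text \<open>Passes from the Lebesgue integral over the line to gauge integrals over [0, N], the form
  in which a folded sum exhausts the half line.\<close>

lemma even_integral_limit:
  fixes f :: "real \<Rightarrow> real"
  assumes f: "integrable lborel f" and even: "\<And>x. f (- x) = f x"
  shows "((\<lambda>N. integral {0..N} f) \<longlongrightarrow> (\<integral>x. f x \<partial>lborel) / 2) at_top"
proof -
  have int: "integrable lborel (\<lambda>x. indicator {0..} x *\<^sub>R f x)" "integrable lborel (\<lambda>x. indicator {..0} x *\<^sub>R f x)"
    using f by (auto intro!: integrable_mult_indicator simp del: real_scaleR_def)
  have "(\<integral>x. indicator {0..} x *\<^sub>R f x \<partial>lborel) = (\<integral>x. indicator {..0} x *\<^sub>R f x \<partial>lborel)"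
    by (subst lborel_integral_real_affine[where c = "-1" and t = 0])
      (auto simp: even indicator_def intro!: Bochner_Integration.integral_cong)
  \<comment> \<open>The two half lines overlap in the point 0, so the integrands agree only almost
    everywhere.\<close>
  moreover have "(\<integral>x. f x \<partial>lborel) = (\<integral>x. indicator {0..} x *\<^sub>R f x + indicator {..0} x *\<^sub>R f x \<partial>lborel)"
    using AE_lborel_singleton[of "0::real"]
    by (intro integral_cong_AE) (use f in \<open>auto simp: indicator_def elim!: eventually_mono\<close>)
  ultimately have half: "(\<integral>x. indicator {0..} x *\<^sub>R f x \<partial>lborel) = (\<integral>x. f x \<partial>lborel) / 2"
    using int by simp
  have "((\<lambda>N. \<integral>x. indicator {..N} x *\<^sub>R (indicator {0..} x *\<^sub>R f x) \<partial>lborel) \<longlongrightarrow> (\<integral>x. f x \<partial>lborel) / 2) at_top"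
    unfolding half[symmetric] by (rule tendsto_integral_at_top) (use int in auto)
  moreover have "(\<integral>x. indicator {..N} x *\<^sub>R (indicator {0..} x *\<^sub>R f x) \<partial>lborel) = integral {0..N} f" for N
  proof -
    have "(\<integral>x. indicator {..N} x *\<^sub>R (indicator {0..} x *\<^sub>R f x) \<partial>lborel) = set_lebesgue_integral lborel {0..N} f"
      unfolding set_lebesgue_integral_def by (intro Bochner_Integration.integral_cong) (auto simp: indicator_def)
    also have "\<dots> = integral {0..N} f"
      by (rule set_borel_integral_eq_integral) (use f in \<open>auto simp: set_integrable_def intro!: integrable_mult_indicator simp del: real_scaleR_def\<close>)
    finally show ?thesis .
  qed
  ultimately show ?thesis by simp
qed

lemma gaussian_cos_integral_limit:
  fixes s m :: real
  assumes s: "s > 0"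
  shows "((\<lambda>N. integral {0..N} (\<lambda>u. exp (-u\<^sup>2 / (4 * s)) * cos (m * u))) \<longlongrightarrow> sqrt (pi * s) * exp (- m\<^sup>2 * s)) at_top"
  using even_integral_limit[OF gaussian_cos_integral(1)[OF s, of m]] gaussian_cos_integral(2)[OF s, of m] by simp

lemma integral_uniform_limit:
  fixes f :: "nat \<Rightarrow> real \<Rightarrow> 'a::banach"
  assumes "uniform_limit {a..b} f g sequentially" "\<And>n. continuous_on {a..b} (f n)"
  shows "(\<lambda>n. integral {a..b} (f n)) \<longlonglongrightarrow> integral {a..b} g"
  using uniform_limit_integral[OF assms sequentially_bot] by (metis integral_unique ext)

text \<open>The number of integers with absolute value \<open>k\<close>.\<close>

definition line_weight :: "nat \<Rightarrow> real" where
  "line_weight k = (if k = 0 then 1 else 2)"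

lemma summable_exp_square:
  fixes s :: real assumes "s > 0" shows "summable (\<lambda>k::nat. exp (- s * (real k)\<^sup>2))"
proof (rule summable_comparison_test_ev)
  show "eventually (\<lambda>k::nat. norm (exp (- s * (real k)\<^sup>2)) \<le> exp (- s) ^ k) sequentially"
  proof (rule always_eventually, rule allI)
    fix k :: nat
    have "real k \<le> (real k)\<^sup>2" by (cases "k = 0") (auto simp: power2_eq_square)
    then show "norm (exp (- s * (real k)\<^sup>2)) \<le> exp (- s) ^ k"
      using assms by (simp add: exp_of_nat_mult[symmetric] mult.commute)
  qed
  show "summable (\<lambda>k. exp (- s) ^ k)" using assms by (intro summable_geometric) auto
qed

section \<open>Cosine coefficients of the theta series and of the periodised Gaussian\<close>

lemma cos_int_integral:
  fixes j :: int
  shows "((\<lambda>t. cos (of_int j * t)) has_integral (if j = 0 then pi else 0)) {0..pi}"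
proof (cases "j = 0")
  case True
  then show ?thesis using has_integral_const_real[of "1::real" 0 pi] by simp
next
  case False
  have "((\<lambda>t. cos (of_int j * t)) has_integral (sin (of_int j * pi) / of_int j - sin (of_int j * 0) / of_int j)) {0..pi}"
    by (rule fundamental_theorem_of_calculus)
      (use False in \<open>auto intro!: derivative_eq_intros simp: has_real_derivative_iff_has_vector_derivative[symmetric]\<close>)
  then show ?thesis using False by (simp add: sin_int_times_real mult.commute)
qed

lemma cos_cos_integral:
  "((\<lambda>t. cos (real k * t) * cos (real m * t)) has_integral
     (if k = m then (if m = 0 then pi else pi / 2) else 0)) {0..pi}"
proof -
  have "((\<lambda>t. (cos (of_int (int k - int m) * t) + cos (of_int (int k + int m) * t)) / 2) has_integral
     ((if int k - int m = 0 then pi else 0) + (if int k + int m = 0 then pi else 0)) / 2) {0..pi}"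
    by (intro has_integral_divide has_integral_add cos_int_integral)
  moreover have "(\<lambda>t. (cos (of_int (int k - int m) * t) + cos (of_int (int k + int m) * t)) / 2) =
      (\<lambda>t. cos (real k * t) * cos (real m * t))"
    by (simp add: cos_times_cos left_diff_distrib distrib_right)
  ultimately have "((\<lambda>t. cos (real k * t) * cos (real m * t)) has_integral
     ((if int k - int m = 0 then pi else 0) + (if int k + int m = 0 then pi else 0)) / 2) {0..pi}"
    by (simp only:)
  then show ?thesis by (rule has_integral_eq_rhs) auto
qed

text \<open>The weight 2 for k > 0 compensates the square norm \<pi>/2 of cos(kt), against \<pi> for
  k = 0, so that all coefficients have one form. Uniform convergence allows integration term by
  term.\<close>

lemma theta_cos_series_coeff:
  fixes s :: real
  assumes s: "s > 0"
  defines "Q \<equiv> \<lambda>t. \<Sum>k. line_weight k * exp (- s * (real k)\<^sup>2) * cos (real k * t)"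
  shows "continuous_on {0..pi} Q" "integral {0..pi} (\<lambda>t. Q t * cos (real m * t)) = pi * exp (- s * (real m)\<^sup>2)"
proof -
  define q where "q k t = line_weight k * exp (- s * (real k)\<^sup>2) * cos (real k * t)" for k and t :: real
  have ul: "uniform_limit {0..pi} (\<lambda>n t. \<Sum>k<n. q k t) Q sequentially"
    unfolding Q_def q_def
  proof (rule Weierstrass_m_test)
    show "summable (\<lambda>k. 2 * exp (- s * (real k)\<^sup>2))"
      by (intro summable_mult summable_exp_square s)
  qed (auto simp: line_weight_def abs_mult mult_left_le)
  have cont: "continuous_on {0..pi} (\<lambda>t. \<Sum>k<n. q k t)" for n
    unfolding q_def by (intro continuous_intros)
  show Q: "continuous_on {0..pi} Q"
    by (rule uniform_limit_theorem[OF _ ul]) (use cont in auto)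
  have ul2: "uniform_limit {0..pi} (\<lambda>n t. (\<Sum>k<n. q k t) * cos (real m * t)) (\<lambda>t. Q t * cos (real m * t)) sequentially"
    by (rule uniform_lim_mult[OF ul uniform_limit_const])
      (auto intro!: compact_imp_bounded compact_continuous_image continuous_intros Q)
  have orth: "integral {0..pi} (\<lambda>t. q k t * cos (real m * t)) = (if k = m then pi * exp (- s * (real m)\<^sup>2) else 0)" for k
  proof -
    have "((\<lambda>t. cos (real k * t) * cos (real m * t)) has_integral (if k = m then pi / line_weight m else 0)) {0..pi}"
      by (rule has_integral_eq_rhs[OF cos_cos_integral]) (simp add: line_weight_def)
    from has_integral_mult_right[OF this, of "line_weight k * exp (- s * (real k)\<^sup>2)"]
    show ?thesis by (intro integral_unique) (auto simp: q_def mult_ac line_weight_def split: if_splits)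
  qed
  have "(\<lambda>n. integral {0..pi} (\<lambda>t. (\<Sum>k<n. q k t) * cos (real m * t))) \<longlonglongrightarrow> integral {0..pi} (\<lambda>t. Q t * cos (real m * t))"
    by (rule integral_uniform_limit[OF ul2]) (intro continuous_intros cont)
  moreover have "integral {0..pi} (\<lambda>t. (\<Sum>k<n. q k t) * cos (real m * t)) = (\<Sum>k<n. if k = m then pi * exp (- s * (real m)\<^sup>2) else 0)" for n
    unfolding sum_distrib_right orth[symmetric]
    by (rule integral_sum) (auto simp: q_def intro!: integrable_continuous_real continuous_intros)
  ultimately have "(\<lambda>n. if m < n then pi * exp (- s * (real m)\<^sup>2) else 0) \<longlonglongrightarrow> integral {0..pi} (\<lambda>t. Q t * cos (real m * t))"
    by (simp add: sum.delta)
  moreover have "(\<lambda>n. if m < n then pi * exp (- s * (real m)\<^sup>2) else 0) \<longlonglongrightarrow> pi * exp (- s * (real m)\<^sup>2)"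
    by (rule tendsto_eventually) (use eventually_gt_at_top[of m] in eventually_elim, auto)
  ultimately show "integral {0..pi} (\<lambda>t. Q t * cos (real m * t)) = pi * exp (- s * (real m)\<^sup>2)"
    using LIMSEQ_unique by blast
qed

text \<open>For \<open>0 \<le> t \<le> \<pi>\<close> the points \<open>t + 2\<pi>k\<close> and \<open>2\<pi>(k + 1) - t\<close> sweep the half line, so that the periodised
Gaussian has the Gaussian cosine integrals over the half line as its Fourier coefficients.\<close>

lemma folded_gaussian_coeff:
  fixes s :: real
  assumes s: "s > 0"
  defines "g \<equiv> \<lambda>u::real. exp (-u\<^sup>2 / (4 * s))"
  defines "P \<equiv> \<lambda>t. \<Sum>k. g (t + 2 * pi * real k) + g (2 * pi * real (Suc k) - t)"
  shows "continuous_on {0..pi} P" "integral {0..pi} (\<lambda>t. P t * cos (real m * t)) = sqrt (pi * s) * exp (- s * (real m)\<^sup>2)"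
    "\<And>t. t \<in> {0..pi} \<Longrightarrow> summable (\<lambda>k. g (t + 2 * pi * real k) + g (2 * pi * real (Suc k) - t))"
proof -
  define p where "p k t = g (t + 2 * pi * real k) + g (2 * pi * real (Suc k) - t)" for k and t :: real
  have g_mono: "g u \<le> g v" if "0 \<le> v" "v \<le> u" for u v
    using that s by (auto simp: g_def divide_right_mono power_mono)
  \<comment> \<open>For 0 \<le> t \<le> \<pi> both sample points are at least 2\<pi>k, which gives a
    majorant free of t.\<close>
  have bound: "norm (p k t) \<le> 2 * exp (- (pi\<^sup>2 / s) * (real k)\<^sup>2)" if "t \<in> {0..pi}" for k t
  proof -
    have "g (t + 2 * pi * real k) \<le> g (2 * pi * real k)" "g (2 * pi * real (Suc k) - t) \<le> g (2 * pi * real k)"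
      using that by (auto intro!: g_mono simp: algebra_simps)
    moreover have "g (2 * pi * real k) = exp (- (pi\<^sup>2 / s) * (real k)\<^sup>2)"
      using s by (simp add: g_def power_mult_distrib field_simps)
    moreover have "g u \<ge> 0" for u by (simp add: g_def)
    ultimately show ?thesis unfolding p_def real_norm_def
      by (smt (verit, best))
  qed
  have summ: "summable (\<lambda>k. 2 * exp (- (pi\<^sup>2 / s) * (real k)\<^sup>2))"
    by (intro summable_mult summable_exp_square) (use s in auto)
  show "summable (\<lambda>k. g (t + 2 * pi * real k) + g (2 * pi * real (Suc k) - t))" if "t \<in> {0..pi}" for t
    using bound[OF that] by (intro summable_comparison_test'[OF summ]) (auto simp: p_def)
  have ul: "uniform_limit {0..pi} (\<lambda>n t. \<Sum>k<n. p k t) P sequentially"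
    unfolding P_def p_def[symmetric] by (rule Weierstrass_m_test[OF bound summ])
  have gc: "continuous_on A (\<lambda>x. g (f x))" if "continuous_on A f" for A and f :: "real \<Rightarrow> real"
    unfolding g_def using s by (intro continuous_intros that) auto
  have cont: "continuous_on {0..pi} (\<lambda>t. \<Sum>k<n. p k t)" for n
    unfolding p_def by (intro continuous_intros gc)
  show P: "continuous_on {0..pi} P"
    by (rule uniform_limit_theorem[OF _ ul]) (use cont in auto)
  have ul2: "uniform_limit {0..pi} (\<lambda>n t. (\<Sum>k<n. p k t) * cos (real m * t)) (\<lambda>t. P t * cos (real m * t)) sequentially"
    by (rule uniform_lim_mult[OF ul uniform_limit_const])
      (auto intro!: compact_imp_bounded compact_continuous_image continuous_intros P)
  define f where "f u = g u * cos (real m * u)" for u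
  have fint: "f integrable_on {a..b}" for a b
    unfolding f_def by (intro integrable_continuous_real continuous_intros gc)
  have block: "((\<lambda>t. p k t * cos (real m * t)) has_integral (integral {2 * pi * real k .. 2 * pi * real (Suc k)} f)) {0..pi}" for k
  proof -
    have cosper: "cos (real m * (t + 2 * pi * real k)) = cos (real m * t)" for t k
    proof -
      have "cos (real m * (t + 2 * pi * real k)) = cos (real m * t + 2 * real (m * k) * pi)"
        by (simp add: algebra_simps)
      also have "\<dots> = cos (real m * t)"
        unfolding cos_add cos_2npi sin_2npi by simp
      finally show ?thesis .
    qed
    have shift: "((\<lambda>t. f (t + c)) has_integral integral {a + c..b + c} f) {a..b}" for a b c
      using has_integral_shift_cbox[of f "integral {a + c..b + c} f" "a + c" "b + c" c] fint
      by (simp add: integrable_integral)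
    let ?a = "2 * pi * real k" and ?b = "2 * pi * real (Suc k)"
    have 1: "((\<lambda>t. f (t + ?a)) has_integral integral {?a .. ?a + pi} f) {0..pi}"
      using shift[of ?a 0 pi] by (simp only: add_0 add.commute)
    have ab: "- pi + ?b = ?a + pi" by (simp add: algebra_simps)
    \<comment> \<open>The second half of the period is reached by reflecting t to -t, which does not
      change the cosine.\<close>
    have "((\<lambda>t. f (t + ?b)) has_integral integral {?a + pi .. ?b} f) {-pi..-0}"
      using shift[of ?b "- pi" 0] by (simp only: ab add_0 minus_zero)
    from has_integral_reflect_lemma_real[OF this]
    have 2: "((\<lambda>t. f (?b - t)) has_integral integral {?a + pi .. ?b} f) {0..pi}"
      by (simp only: uminus_add_conv_diff minus_zero minus_minus)
    have "f (t + ?a) + f (?b - t) = p k t * cos (real m * t)" for t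
    proof -
      have "f (t + ?a) = g (t + ?a) * cos (real m * t)" unfolding f_def cosper ..
      moreover have "f (?b - t) = g (?b - t) * cos (real m * t)"
        using cosper[of "- t" "Suc k"] by (simp only: f_def uminus_add_conv_diff mult_minus_right cos_minus)
      ultimately show ?thesis unfolding p_def by (simp only: distrib_right)
    qed
    moreover have "integral {?a .. ?a + pi} f + integral {?a + pi .. ?b} f = integral {?a .. ?b} f"
      by (rule Henstock_Kurzweil_Integration.integral_combine) (auto simp: algebra_simps fint)
    ultimately show ?thesis using has_integral_add[OF 1 2] by (simp only:)
  qed
  have "(\<lambda>n. integral {0..pi} (\<lambda>t. (\<Sum>k<n. p k t) * cos (real m * t))) \<longlonglongrightarrow> integral {0..pi} (\<lambda>t. P t * cos (real m * t))"
    by (rule integral_uniform_limit[OF ul2]) (intro continuous_intros cont)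
  moreover have "integral {0..pi} (\<lambda>t. (\<Sum>k<n. p k t) * cos (real m * t)) = integral {0..2 * pi * real n} f" for n
  proof -
    have "((\<lambda>t. (\<Sum>k<n. p k t) * cos (real m * t)) has_integral (\<Sum>k<n. integral {2 * pi * real k .. 2 * pi * real (Suc k)} f)) {0..pi}"
      unfolding sum_distrib_right by (intro has_integral_sum block) auto
    moreover have "(\<Sum>k<n. integral {2 * pi * real k .. 2 * pi * real (Suc k)} f) = integral {0..2 * pi * real n} f"
    proof (induction n)
      case (Suc n)
      then show ?case
        by (simp del: of_nat_Suc) (rule Henstock_Kurzweil_Integration.integral_combine, auto simp: fint)
    qed simp
    ultimately show ?thesis by (simp add: integral_unique)
  qed
  moreover have "(\<lambda>n. integral {0..2 * pi * real n} f) \<longlonglongrightarrow> sqrt (pi * s) * exp (- (real m)\<^sup>2 * s)"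
    unfolding f_def g_def
    by (rule filterlim_compose[OF gaussian_cos_integral_limit[OF s]])
      (auto intro!: filterlim_tendsto_pos_mult_at_top[OF tendsto_const] filterlim_real_sequentially)
  ultimately show "integral {0..pi} (\<lambda>t. P t * cos (real m * t)) = sqrt (pi * s) * exp (- s * (real m)\<^sup>2)"
    using LIMSEQ_unique by (fastforce simp: mult.commute)
qed

text \<open>Poisson summation without inversion of Fourier series: the periodised Gaussian and the
  cosine series have proportional coefficients, so by completeness of the cosines they are
  proportional as continuous functions, and t = 0 gives the formula.\<close>

lemma theta_transformation_line:
  fixes s :: real
  assumes s: "s > 0"
  shows "(\<Sum>k. line_weight k * exp (- (pi\<^sup>2 / s) * (real k)\<^sup>2)) = sqrt (s / pi) * (\<Sum>k. line_weight k * exp (- s * (real k)\<^sup>2))"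
proof -
  define g where "g u = exp (-u\<^sup>2 / (4 * s))" for u :: real
  define P where "P t = (\<Sum>k. g (t + 2 * pi * real k) + g (2 * pi * real (Suc k) - t))" for t
  define Q where "Q t = (\<Sum>k. line_weight k * exp (- s * (real k)\<^sup>2) * cos (real k * t))" for t
  have P: "continuous_on {0..pi} P" "\<And>m. integral {0..pi} (\<lambda>t. P t * cos (real m * t)) = sqrt (pi * s) * exp (- s * (real m)\<^sup>2)"
    using folded_gaussian_coeff(1,2)[OF s] unfolding P_def g_def by blast+
  have Q: "continuous_on {0..pi} Q" "\<And>m. integral {0..pi} (\<lambda>t. Q t * cos (real m * t)) = pi * exp (- s * (real m)\<^sup>2)"
    using theta_cos_series_coeff[OF s] unfolding Q_def by blast+
  have "P 0 - sqrt (s / pi) * Q 0 = 0"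
  proof (rule cos_orthogonal_imp_zero[where f = "\<lambda>t. P t - sqrt (s / pi) * Q t"])
    fix m :: nat
    have "integral {0..pi} (\<lambda>t. (P t - sqrt (s / pi) * Q t) * cos (real m * t)) =
      integral {0..pi} (\<lambda>t. P t * cos (real m * t) - sqrt (s / pi) * (Q t * cos (real m * t)))"
      by (simp add: algebra_simps)
    also have "\<dots> = integral {0..pi} (\<lambda>t. P t * cos (real m * t)) - sqrt (s / pi) * integral {0..pi} (\<lambda>t. Q t * cos (real m * t))"
      by (subst integral_diff) (auto intro!: integrable_continuous_real continuous_intros P Q)
    also have "\<dots> = 0" unfolding P Q using s by (simp add: real_sqrt_mult real_sqrt_divide field_simps)
    finally show "integral {0..pi} (\<lambda>t. (P t - sqrt (s / pi) * Q t) * cos (real m * t)) = 0" .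
  qed (auto intro!: continuous_intros P Q)
  \<comment> \<open>At t = 0 the folded points are 0, 2\<pi>, 2\<pi>, 4\<pi>, 4\<pi>, ...: the
    origin once and all others twice, which is \<open>line_weight\<close>.\<close>
  moreover have "P 0 = (\<Sum>k. line_weight k * exp (- (pi\<^sup>2 / s) * (real k)\<^sup>2))"
  proof -
    define e where "e k = exp (- (pi\<^sup>2 / s) * (real k)\<^sup>2)" for k
    have se: "summable e" unfolding e_def by (rule summable_exp_square) (use s in auto)
    have ge: "g (2 * pi * real k) = e k" for k
      using s by (simp add: g_def e_def power_mult_distrib field_simps)
    have "P 0 = (\<Sum>k. e k + e (Suc k))" by (simp only: P_def add_0 diff_zero ge)
    also have "\<dots> = suminf e + (\<Sum>k. e (Suc k))"
      using se by (intro suminf_add[symmetric]) (auto simp: summable_Suc_iff)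
    also have "\<dots> = e 0 + (\<Sum>k. e (Suc k)) + (\<Sum>k. e (Suc k))"
      using suminf_split_head[OF se] by simp
    also have "\<dots> = line_weight 0 * e 0 + (\<Sum>k. line_weight (Suc k) * e (Suc k))"
      using se by (simp add: line_weight_def suminf_mult summable_Suc_iff)
    also have "\<dots> = (\<Sum>k. line_weight k * e k)"
    proof -
      have "summable (\<lambda>k. line_weight k * e k)"
        by (rule summable_comparison_test'[where g = "\<lambda>k. 2 * e k"])
          (use summable_mult[OF se] in \<open>auto simp: line_weight_def e_def\<close>)
      from suminf_split_head[OF this] show ?thesis by simp
    qed
    finally show ?thesis by (simp add: e_def)
  qed
  ultimately show ?thesis by (simp add: Q_def)
qed

text \<open>The number of integers with square \<open>n\<close>.\<close>

definition square_weight :: "nat \<Rightarrow> real" where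
  "square_weight n = (if n = 0 then 1 else if (\<exists>k. n = k\<^sup>2) then 2 else 0)"

text \<open>A power series in e^(-s) over all n rather than a sum over squares: holomorphy is then
  that of a power series, and the Cauchy square has the coefficients
  \<open>rep_count\<close>.\<close>

definition theta :: "complex \<Rightarrow> complex" where
  "theta s = (\<Sum>n. of_real (square_weight n) * exp (- s) ^ n)"

section \<open>Analytic continuation to the right half plane\<close>

lemma square_weight_bounds: "0 \<le> square_weight n" "square_weight n \<le> 2"
  by (auto simp: square_weight_def)

lemma summable_theta:
  assumes "Re s > 0"
  shows "summable (\<lambda>n. norm (of_real (square_weight n) * exp (- s) ^ n))"
proof (rule summable_comparison_test')
  show "summable (\<lambda>n. 2 * exp (- Re s) ^ n)" using assms by (intro summable_mult summable_geometric) auto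
qed (use square_weight_bounds in \<open>auto simp: norm_mult norm_power intro!: mult_right_mono\<close>)

lemma holomorphic_theta: "theta holomorphic_on {s. Re s > 0}"
proof -
  have "(\<lambda>z. \<Sum>n. of_real (square_weight n) * z ^ n) holomorphic_on ball 0 1"
  proof (rule power_series_holomorphic[where a = "\<lambda>n. of_real (square_weight n)"])
    fix w :: complex assume w: "w \<in> ball 0 1"
    have "summable (\<lambda>n. of_real (square_weight n) * w ^ n)"
    proof (rule summable_norm_cancel, rule summable_comparison_test')
      show "summable (\<lambda>n. 2 * norm w ^ n)" using w by (intro summable_mult summable_geometric) auto
    qed (use square_weight_bounds in \<open>auto simp: norm_mult norm_power intro!: mult_right_mono\<close>)
    then show "(\<lambda>n. of_real (square_weight n) * (w - 0) ^ n) sums (\<Sum>n. of_real (square_weight n) * w ^ n)"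
      by (simp add: summable_sums)
  qed
  then have "(\<lambda>z. \<Sum>n. of_real (square_weight n) * z ^ n) \<circ> (\<lambda>s. exp (- s)) holomorphic_on {s. Re s > 0}"
    by (rule holomorphic_on_compose_gen[rotated]) (auto intro!: holomorphic_intros)
  then show ?thesis by (simp add: o_def theta_def[abs_def])
qed

lemma theta_of_real:
  assumes "s > 0"
  shows "theta (of_real s) = of_real (\<Sum>k. line_weight k * exp (- s * (real k)\<^sup>2))"
proof -
  have "summable (\<lambda>k. line_weight k * exp (- s * (real k)\<^sup>2))"
    by (rule summable_comparison_test'[where g = "\<lambda>k. 2 * exp (- s * (real k)\<^sup>2)"])
      (use summable_mult[OF summable_exp_square[OF assms]] in \<open>auto simp: line_weight_def\<close>)
  then have "(\<lambda>k. line_weight k * exp (- s * (real k)\<^sup>2)) sums (\<Sum>k. line_weight k * exp (- s * (real k)\<^sup>2))"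
    by (rule summable_sums)
  moreover have "line_weight k * exp (- s * (real k)\<^sup>2) = square_weight (k\<^sup>2) * exp (- s) ^ (k\<^sup>2)" for k
    by (simp add: line_weight_def square_weight_def exp_of_nat_mult[symmetric] mult.commute)
  ultimately have "(\<lambda>n. square_weight n * exp (- s) ^ n) sums (\<Sum>k. line_weight k * exp (- s * (real k)\<^sup>2))"
    by (subst sums_mono_reindex[where g = "\<lambda>k::nat. k\<^sup>2", symmetric])
      (auto simp: strict_mono_def power_strict_mono square_weight_def)
  then have "(\<lambda>n. of_real (square_weight n * exp (- s) ^ n)) sums (of_real (\<Sum>k. line_weight k * exp (- s * (real k)\<^sup>2)) :: complex)"
    by (rule sums_of_real)
  then show ?thesis
    unfolding theta_def by (simp add: sums_iff exp_of_real[symmetric] del: exp_of_real)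
qed

text \<open>In the squared formula no branch of the square root of s occurs. Both sides are
  holomorphic on the half plane and agree on the positive reals, which accumulate at 1.\<close>

theorem theta_transformation:
  assumes "Re s > 0"
  shows "(theta s)\<^sup>2 = of_real pi / s * (theta (of_real pi ^ 2 / s))\<^sup>2"
proof -
  let ?H = "{s. Re s > 0}"
  let ?f = "\<lambda>s. (theta s)\<^sup>2 - of_real pi / s * (theta (of_real pi ^ 2 / s))\<^sup>2"
  have sub: "Re (of_real pi ^ 2 / s) > 0" if "Re s > 0" for s
    using that by (auto simp: Re_divide power2_eq_square intro!: divide_pos_pos add_pos_nonneg)
  have comp: "(\<lambda>s. theta (of_real pi ^ 2 / s)) holomorphic_on ?H"
    using holomorphic_on_compose_gen[OF _ holomorphic_theta, of "\<lambda>s. of_real pi ^ 2 / s" ?H] sub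
    by (fastforce simp: o_def intro!: holomorphic_intros)
  have hol: "?f holomorphic_on ?H"
    by (intro holomorphic_intros holomorphic_theta comp) auto
  have zero: "?f z = 0" if z: "z \<in> of_real ` {0<..}" for z
  proof -
    obtain t where t: "t > 0" "z = of_real t" using z by auto
    have "theta (of_real (pi\<^sup>2 / t)) = of_real (sqrt (t / pi)) * theta (of_real t)"
    proof -
      have "pi\<^sup>2 / t > 0" using t(1) by simp
      show ?thesis
        unfolding theta_of_real[OF t(1)] theta_of_real[OF \<open>pi\<^sup>2 / t > 0\<close>]
          theta_transformation_line[OF t(1)] of_real_mult ..
    qed
    then show ?thesis using t by (simp add: power_mult_distrib flip: of_real_power)
  qed
  have "?f s = 0"
  proof (rule analytic_continuation[OF hol, where U = "of_real ` {0<..}" and \<xi> = 1])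
    show "open ?H" by (rule open_halfspace_Re_gt)
    show "connected ?H" by (intro convex_connected convex_halfspace_Re_gt)
    show "(1::complex) islimpt of_real ` {0<..}"
      unfolding islimpt_sequential
    proof (rule exI, intro conjI allI)
      show "of_real (1 + 1 / real (Suc n)) \<in> of_real ` {0<..} - {1::complex}" for n
      proof -
        have "1 + 1 / real (Suc n) \<in> {0<..}" by (simp add: add_pos_nonneg del: of_nat_Suc)
        moreover have "of_real (1 + 1 / real (Suc n)) \<noteq> (1::complex)"
          unfolding of_real_eq_1_iff by (simp del: of_nat_Suc)
        ultimately show ?thesis by (intro DiffI imageI) auto
      qed
      have "(\<lambda>n. of_real (1 + 1 / real (Suc n)) :: complex) \<longlonglongrightarrow> of_real (1 + 0)"
        by (intro tendsto_intros LIMSEQ_Suc[OF lim_1_over_n])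
      then show "(\<lambda>n. of_real (1 + 1 / real (Suc n)) :: complex) \<longlonglongrightarrow> 1" by simp
    qed
  qed (use assms zero in auto)
  then show ?thesis by simp
qed

section \<open>The second moment of the number of representations\<close>

lemma mult_eq_parametrization:
  fixes u v w z :: nat
  assumes "u * v = w * z" "u > 0" "w > 0"
  shows "\<exists>g a b k. u = g * a \<and> w = g * b \<and> z = a * k \<and> v = b * k"
proof -
  define g where "g = gcd u w"
  obtain a b where ab: "u = g * a" "w = g * b" "coprime a b"
    using assms by (metis g_def gcd_coprime_exists mult.commute gcd_pos_nat less_numeral_extra(3))
  have "g > 0" using assms by (simp add: g_def)
  then have "a * v = b * z" using assms(1) by (simp add: ab mult.assoc)
  moreover from this have "a dvd z" using ab(3) by (metis coprime_dvd_mult_right_iff dvd_triv_left)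
  then obtain k where "z = a * k" by (elim dvdE)
  moreover have "a > 0" using ab assms by (intro Nat.gr0I) auto
  ultimately have "v = b * k" by simp
  then show ?thesis using ab \<open>z = a * k\<close> by blast
qed

definition product_quadruples :: "nat \<Rightarrow> (nat \<times> nat \<times> nat \<times> nat) set" where
  "product_quadruples K = {(u, v, w, z). {u, v, w, z} \<subseteq> {1..K} \<and> u * v = w * z}"

lemma finite_quads: "finite (product_quadruples K)"
  by (rule finite_subset[of _ "{1..K} \<times> {1..K} \<times> {1..K} \<times> {1..K}"]) (auto simp: product_quadruples_def)

text \<open>In the parametrization u = ga, w = gb, z = ak, v = bk, the pair (a, b) leaves at most
  K/max(a, b) choices for each of g and k.\<close>

lemma card_quads_le: "real (card (product_quadruples K)) \<le> 2 * (real K)\<^sup>2 * harm K"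
proof -
  define B where "B = Sigma {1..K} (\<lambda>a. Sigma {1..K} (\<lambda>b. {1..K div max a b} \<times> {1..K div max a b}))"
  have sub: "product_quadruples K \<subseteq> (\<lambda>(a, b, g, k). (g * a, b * k, g * b, a * k)) ` B"
  proof clarify
    fix u v w z assume q: "(u, v, w, z) \<in> product_quadruples K"
    then obtain g a b k where e: "u = g * a" "w = g * b" "z = a * k" "v = b * k"
      using mult_eq_parametrization[of u v w z] by (auto simp: product_quadruples_def)
    have pos: "g \<ge> 1" "a \<ge> 1" "b \<ge> 1" "k \<ge> 1" using q by (auto simp: product_quadruples_def e)
    have "g * max a b \<le> K" "k * max a b \<le> K" using q by (auto simp: product_quadruples_def e max_def mult.commute)
    then have gk: "g \<le> K div max a b" "k \<le> K div max a b" using pos by (auto simp: less_eq_div_iff_mult_less_eq)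
    moreover have "a \<le> g * a" "b \<le> g * b" using pos by simp_all
    moreover have "g * a \<le> K" "g * b \<le> K" using q by (auto simp: product_quadruples_def e)
    ultimately have "g \<le> K div max a b" "k \<le> K div max a b" "a \<le> K" "b \<le> K" by linarith+
    then have "(a, b, g, k) \<in> B" using pos by (simp add: B_def)
    then show "(u, v, w, z) \<in> (\<lambda>(a, b, g, k). (g * a, b * k, g * b, a * k)) ` B"
      by (force simp: e)
  qed
  have fin: "finite B" by (auto simp: B_def)
  have "card (product_quadruples K) \<le> card B"
    using card_mono[OF finite_imageI[OF fin] sub] card_image_le[OF fin] order_trans by blast
  also have "card B = (\<Sum>a\<in>{1..K}. \<Sum>b\<in>{1..K}. (K div max a b)\<^sup>2)"
    by (simp add: B_def power2_eq_square)
  finally have "real (card (product_quadruples K)) \<le> (\<Sum>a\<in>{1..K}. \<Sum>b\<in>{1..K}. (real (K div max a b))\<^sup>2)"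
    by (metis (mono_tags, lifting) of_nat_le_iff of_nat_sum of_nat_power sum.cong)
  also have "\<dots> \<le> (\<Sum>a\<in>{1..K}. \<Sum>b\<in>{1..K}. (if b \<le> a then (real K / real a)\<^sup>2 else 0) + (if a \<le> b then (real K / real b)\<^sup>2 else 0))"
  proof (intro sum_mono)
    fix a b assume ab: "a \<in> {1..K}" "b \<in> {1..K}"
    have "(real (K div max a b))\<^sup>2 \<le> (real K / real (max a b))\<^sup>2"
      by (intro power_mono of_nat_div_le_of_nat) auto
    also have "\<dots> \<le> (if b \<le> a then (real K / real a)\<^sup>2 else 0) + (if a \<le> b then (real K / real b)\<^sup>2 else 0)"
      by (auto simp: max_def)
    finally show "(real (K div max a b))\<^sup>2 \<le> (if b \<le> a then (real K / real a)\<^sup>2 else 0) + (if a \<le> b then (real K / real b)\<^sup>2 else 0)" .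
  qed
  also have "\<dots> = (\<Sum>a\<in>{1..K}. \<Sum>b\<in>{1..K}. (if b \<le> a then (real K / real a)\<^sup>2 else 0)) +
     (\<Sum>b\<in>{1..K}. \<Sum>a\<in>{1..K}. (if a \<le> b then (real K / real b)\<^sup>2 else 0))"
    by (simp add: sum.distrib) (rule sum.swap)
  also have "\<dots> = 2 * (\<Sum>a\<in>{1..K}. \<Sum>b\<in>{1..K}. (if b \<le> a then (real K / real a)\<^sup>2 else 0))"
    by simp
  \<comment> \<open>A given a is the maximum for only a values of b, which lowers K^2/a^2 to K^2/a
    and leaves a harmonic sum.\<close>
  also have "(\<Sum>a\<in>{1..K}. \<Sum>b\<in>{1..K}. (if b \<le> a then (real K / real a)\<^sup>2 else 0)) = (\<Sum>a\<in>{1..K}. (real K)\<^sup>2 * inverse (real a))"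
  proof (rule sum.cong[OF refl])
    fix a assume a: "a \<in> {1..K}"
    have "(\<Sum>b\<in>{1..K}. (if b \<le> a then (real K / real a)\<^sup>2 else 0)) = (\<Sum>b\<in>{1..a}. (real K / real a)\<^sup>2)"
      by (rule sum.mono_neutral_cong_right) (use a in auto)
    also have "\<dots> = (real K)\<^sup>2 * inverse (real a)"
      using a by (simp add: field_simps power2_eq_square)
    finally show "(\<Sum>b\<in>{1..K}. (if b \<le> a then (real K / real a)\<^sup>2 else 0)) = (real K)\<^sup>2 * inverse (real a)" .
  qed
  also have "\<dots> = (real K)\<^sup>2 * harm K" by (simp add: harm_def sum_distrib_left)
  finally show ?thesis by simp
qed

definition equal_norm :: "nat \<Rightarrow> (nat \<times> nat \<times> nat \<times> nat) set" where
  "equal_norm M = {(a, b, c, d). {a, b, c, d} \<subseteq> {0..M} \<and> a\<^sup>2 + b\<^sup>2 = c\<^sup>2 + d\<^sup>2}"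

lemma power2_diff_eq: "(x - y) * (x + y) = x\<^sup>2 - y\<^sup>2" for x y :: nat
  by (cases "y \<le> x") (auto simp: power2_eq_square algebra_simps diff_mult_distrib2 mult_mono dest!: le_Suc_ex)

text \<open>An equality a^2 + b^2 = c^2 + d^2 with c < a is the product equality (a - c)(a + c) = (d
  - b)(d + b) with factors up to 2M. The case a < c is its mirror image, and a = c forces b =
  d.\<close>

lemma card_equal_norm_le: "card (equal_norm M) \<le> (M + 1)\<^sup>2 + 2 * card (product_quadruples (2 * M))"
proof -
  define E1 where "E1 = {(a, b, c, d). (a, b, c, d) \<in> equal_norm M \<and> c < a}"
  define E2 where "E2 = {(a, b, c, d). (a, b, c, d) \<in> equal_norm M \<and> a < c}"
  define E0 where "E0 = (\<lambda>(a, b). (a, b, a, b)) ` ({0..M} \<times> {0..M})"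
  have fin: "finite (equal_norm M)"
    by (rule finite_subset[of _ "{0..M} \<times> {0..M} \<times> {0..M} \<times> {0..M}"]) (auto simp: equal_norm_def)
  have fin0: "finite E0" by (simp add: E0_def)
  have fin1: "finite E1" by (rule finite_subset[OF _ fin]) (auto simp: E1_def)
  have fin2: "finite E2" by (rule finite_subset[OF _ fin]) (auto simp: E2_def)
  have "equal_norm M \<subseteq> E0 \<union> E1 \<union> E2"
  proof clarify
    fix a b c d assume e: "(a, b, c, d) \<in> equal_norm M" "(a, b, c, d) \<notin> E2" "(a, b, c, d) \<notin> E1"
    then have "a = c" by (auto simp: E1_def E2_def)
    moreover from this have "b = d" using e by (auto simp: equal_norm_def)
    ultimately show "(a, b, c, d) \<in> E0" using e by (auto simp: E0_def equal_norm_def)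
  qed
  then have "card (equal_norm M) \<le> card (E0 \<union> E1 \<union> E2)" by (rule card_mono[rotated]) (simp add: fin0 fin1 fin2)
  also have "\<dots> \<le> card (E0 \<union> E1) + card E2" by (rule card_Un_le)
  also have "\<dots> \<le> card E0 + card E1 + card E2" by (simp add: card_Un_le)
  finally have "card (equal_norm M) \<le> card E0 + card E1 + card E2" .
  moreover have "card E0 \<le> (M + 1)\<^sup>2"
    unfolding E0_def by (rule order_trans[OF card_image_le]) (auto simp: power2_eq_square)
  moreover have "card E1 \<le> card (product_quadruples (2 * M))"
  proof (rule card_inj_on_le[OF _ _ finite_quads])
    \<comment> \<open>The differences are truncated subtractions, so both strict inequalities are
      required before the factors are positive and the map can be inverted.\<close>
    have E1: "b < d \<and> c < a \<and> (a - c) * (a + c) = (d - b) * (d + b) \<and> a \<le> M \<and> d \<le> M" if "(a, b, c, d) \<in> E1" for a b c d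
    proof -
      have e: "a\<^sup>2 + b\<^sup>2 = c\<^sup>2 + d\<^sup>2" "c < a" "a \<le> M" "d \<le> M" using that by (auto simp: E1_def equal_norm_def)
      have "c\<^sup>2 < a\<^sup>2" using e by (simp add: power_strict_mono)
      then have "b\<^sup>2 < d\<^sup>2" using e by simp
      then have "b < d" by (simp add: power2_less_imp_less)
      moreover have "(a - c) * (a + c) = a\<^sup>2 - c\<^sup>2" "(d - b) * (d + b) = d\<^sup>2 - b\<^sup>2"
        using power2_diff_eq by simp_all
      ultimately show ?thesis using e by linarith
    qed
    show "inj_on (\<lambda>(a, b, c, d). (a - c, a + c, d - b, d + b)) E1"
    proof (rule inj_on_inverseI[where g = "\<lambda>(u, v, w, z). ((u + v) div 2, (z - w) div 2, (v - u) div 2, (w + z) div 2)"])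
      fix x assume x: "x \<in> E1"
      obtain a b c d where [simp]: "x = (a, b, c, d)" by (cases x)
      show "(\<lambda>(u, v, w, z). ((u + v) div 2, (z - w) div 2, (v - u) div 2, (w + z) div 2))
          ((\<lambda>(a, b, c, d). (a - c, a + c, d - b, d + b)) x) = x"
        using E1[of a b c d] x by auto
    qed
    show "(\<lambda>(a, b, c, d). (a - c, a + c, d - b, d + b)) ` E1 \<subseteq> product_quadruples (2 * M)"
    proof clarify
      fix a b c d assume "(a, b, c, d) \<in> E1"
      from E1[OF this] show "(a - c, a + c, d - b, d + b) \<in> product_quadruples (2 * M)"
        by (simp add: product_quadruples_def) linarith
    qed
  qed
  moreover have "card E2 \<le> card E1"
  proof (rule card_inj_on_le[OF _ _ fin1])
    show "inj_on (\<lambda>(a, b, c, d). (c, d, a, b)) E2" by (auto simp: inj_on_def)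
    show "(\<lambda>(a, b, c, d). (c, d, a, b)) ` E2 \<subseteq> E1"
    proof clarify
      fix a b c d assume "(a, b, c, d) \<in> E2"
      then show "(c, d, a, b) \<in> E1" unfolding E1_def E2_def equal_norm_def by simp
    qed
  qed
  ultimately show ?thesis by linarith
qed

text \<open>The number of pairs of integers \<open>(a, b)\<close> with \<open>a\<^sup>2 + b\<^sup>2 = n\<close>.\<close>

definition rep_count :: "nat \<Rightarrow> real" where
  "rep_count n = (\<Sum>i\<le>n. square_weight i * square_weight (n - i))"

definition circle_points :: "nat \<Rightarrow> (nat \<times> nat) set" where
  "circle_points n = {(a, b). a\<^sup>2 + b\<^sup>2 = n}"

lemma circle_points_subset: "circle_points n \<subseteq> {0..floor_sqrt n} \<times> {0..floor_sqrt n}"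
proof clarify
  fix a b assume "(a, b) \<in> circle_points n"
  then have "a\<^sup>2 \<le> n" "b\<^sup>2 \<le> n" by (auto simp: circle_points_def)
  then show "a \<in> {0..floor_sqrt n} \<and> b \<in> {0..floor_sqrt n}"
    by (simp add: le_floor_sqrt_iff)
qed

lemma finite_points: "finite (circle_points n)"
  by (rule finite_subset[OF circle_points_subset]) auto

lemma rep_nonneg: "rep_count n \<ge> 0"
  unfolding rep_count_def by (intro sum_nonneg mult_nonneg_nonneg square_weight_bounds)

text \<open>A nonzero term is at most 2 * 2, for the signs, and its index is the square of the first
  coordinate of a point with nonnegative coordinates.\<close>

lemma rep_le: "rep_count n \<le> 4 * real (card (circle_points n))"
proof -
  define I where "I = {i. i \<le> n \<and> square_weight i \<noteq> 0 \<and> square_weight (n - i) \<noteq> 0}"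
  have finI: "finite I" by (rule finite_subset[of _ "{..n}"]) (auto simp: I_def)
  have "rep_count n = (\<Sum>i\<in>I. square_weight i * square_weight (n - i))"
    unfolding rep_count_def by (rule sum.mono_neutral_right) (auto simp: I_def)
  also have "\<dots> \<le> (\<Sum>i\<in>I. 2 * 2)"
    by (intro sum_mono mult_mono square_weight_bounds) auto
  also have "\<dots> = 4 * real (card I)" by simp
  also have "card I \<le> card ((\<lambda>(a, b). a\<^sup>2) ` circle_points n)"
  proof (rule card_mono)
    show "I \<subseteq> (\<lambda>(a, b). a\<^sup>2) ` circle_points n"
    proof
      fix i assume i: "i \<in> I"
      have sq: "\<exists>k. j = k\<^sup>2" if "square_weight j \<noteq> 0" for j
        using that by (cases "j = 0") (auto simp: square_weight_def split: if_splits intro: exI[of _ 0])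
      obtain a b where "i = a\<^sup>2" "n - i = b\<^sup>2" using sq[of i] sq[of "n - i"] i unfolding I_def by blast
      then have "(a, b) \<in> circle_points n" using i by (auto simp: circle_points_def I_def)
      then show "i \<in> (\<lambda>(a, b). a\<^sup>2) ` circle_points n" using \<open>i = a\<^sup>2\<close> by force
    qed
  qed (simp add: finite_points)
  also have "\<dots> \<le> card (circle_points n)" by (rule card_image_le[OF finite_points])
  finally show ?thesis by simp
qed

text \<open>A squared cardinality counts ordered pairs of points on the same circle.\<close>

lemma sum_card_points_le: "(\<Sum>n\<in>{1..N}. (card (circle_points n))\<^sup>2) \<le> card (equal_norm (floor_sqrt N))"
proof -
  define P where "P = Sigma {1..N} (\<lambda>n. circle_points n \<times> circle_points n)"
  have "(\<Sum>n\<in>{1..N}. (card (circle_points n))\<^sup>2) = card P"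
    unfolding P_def by (subst card_SigmaI) (auto simp: finite_points card_cartesian_product power2_eq_square)
  also have "\<dots> \<le> card (equal_norm (floor_sqrt N))"
  proof (rule card_inj_on_le)
    show "inj_on (\<lambda>(n, (a, b), (c, d)). (a, b, c, d)) P"
      by (auto simp: inj_on_def P_def circle_points_def)
    show "(\<lambda>(n, (a, b), (c, d)). (a, b, c, d)) ` P \<subseteq> equal_norm (floor_sqrt N)"
    proof clarify
      fix n a b c d assume "(n, (a, b), (c, d)) \<in> P"
      then have *: "n \<le> N" "(a, b) \<in> circle_points n" "(c, d) \<in> circle_points n" by (auto simp: P_def)
      have "floor_sqrt n \<le> floor_sqrt N" using * by (simp add: mono_floor_sqrt')
      then have "a \<le> floor_sqrt N \<and> b \<le> floor_sqrt N \<and> c \<le> floor_sqrt N \<and> d \<le> floor_sqrt N"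
        using circle_points_subset[of n] * by fastforce
      then show "(a, b, c, d) \<in> equal_norm (floor_sqrt N)"
        using * by (simp add: equal_norm_def circle_points_def)
    qed
    show "finite (equal_norm (floor_sqrt N))"
      by (rule finite_subset[of _ "{0..floor_sqrt N} \<times> {0..floor_sqrt N} \<times> {0..floor_sqrt N} \<times> {0..floor_sqrt N}"])
        (auto simp: equal_norm_def)
  qed
  finally show ?thesis .
qed

lemma sum_rep_squared_le:
  assumes "N \<ge> 1"
  shows "(\<Sum>n\<in>{1..N}. (rep_count n)\<^sup>2) \<le> 600 * (real N * (1 + ln (real N)))"
proof -
  define M where "M = floor_sqrt N"
  have M: "M \<ge> 1" "M\<^sup>2 \<le> N" using assms by (simp_all add: M_def le_floor_sqrt_iff)
  then have MN: "(real M)\<^sup>2 \<le> real N" by (metis of_nat_le_iff of_nat_power)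
  have lnN: "ln (real N) \<ge> 0" using assms by simp
  have "(\<Sum>n\<in>{1..N}. (rep_count n)\<^sup>2) \<le> (\<Sum>n\<in>{1..N}. (4 * real (card (circle_points n)))\<^sup>2)"
    by (intro sum_mono power_mono rep_le rep_nonneg)
  also have "\<dots> = 16 * real (\<Sum>n\<in>{1..N}. (card (circle_points n))\<^sup>2)"
    by (simp add: sum_distrib_left power_mult_distrib)
  also have "\<dots> \<le> 16 * real (card (equal_norm M))"
    using sum_card_points_le[of N] unfolding M_def by (simp only: of_nat_le_iff mult_le_cancel_left_pos zero_less_numeral)
  also have "real (card (equal_norm M)) \<le> real ((M + 1)\<^sup>2 + 2 * card (product_quadruples (2 * M)))"
    using card_equal_norm_le of_nat_le_iff by blast
  also have "\<dots> = (real M + 1)\<^sup>2 + 2 * real (card (product_quadruples (2 * M)))" by simp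
  also have "(real M + 1)\<^sup>2 \<le> (2 * real M)\<^sup>2" using M by (intro power_mono) auto
  also have "(2 * real M)\<^sup>2 \<le> 4 * real N" using MN by (simp add: power_mult_distrib)
  also have "real (card (product_quadruples (2 * M))) \<le> 2 * (real (2 * M))\<^sup>2 * harm (2 * M)"
    by (rule card_quads_le)
  also have "\<dots> \<le> 2 * (4 * real N) * (2 + ln (real N))"
  proof (intro mult_mono)
    \<comment> \<open>The sequence harm n - ln n decreases from its value 1 at n = 1.\<close>
    have "harm (2 * M) - ln (real (2 * M)) \<le> harm 1 - ln (real 1)"
      by (rule euler_mascheroni_sequence_decreasing) (use M in auto)
    then have "harm (2 * M) \<le> 1 + ln (real (2 * M))" by (simp add: harm_expand)
    also have "ln (real (2 * M)) = ln 2 + ln (real M)" using M by (simp add: ln_mult)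
    also have "ln (real M) \<le> ln (real N)"
    proof -
      have "M \<le> N" using M by (metis le_square power2_eq_square order_trans)
      then show ?thesis using M by simp
    qed
    also have "ln 2 \<le> (1::real)" using ln_2_less_1 by simp
    finally show "harm (2 * M) \<le> 2 + ln (real N)" by simp
    show "(real (2 * M))\<^sup>2 \<le> 4 * real N" using MN by (simp add: power_mult_distrib)
  qed (auto simp: harm_nonneg)
  also have "16 * (4 * real N + 2 * (2 * (4 * real N) * (2 + ln (real N)))) = 576 * real N + 256 * (real N * ln (real N))"
    by (simp add: algebra_simps)
  also have "\<dots> \<le> 600 * real N + 600 * (real N * ln (real N))"
    using lnN by (intro add_mono mult_right_mono) auto
  finally show ?thesis by (simp add: algebra_simps)
qed

section \<open>Exponentially weighted sums\<close>

text \<open>Summation by parts against a decreasing weight. The induction carries the sharper bound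
  \<open>z ^ N * D N\<close>, which is nonpositive like every partial sum
  \<open>D N\<close>.\<close>

lemma abel_sum_mono:
  fixes a b :: "nat \<Rightarrow> real"
  assumes z: "0 \<le> z" "z \<le> 1" and le: "\<And>k. (\<Sum>n\<in>{1..k}. a n) \<le> (\<Sum>n\<in>{1..k}. b n)"
  shows "(\<Sum>n\<in>{1..N}. a n * z ^ n) \<le> (\<Sum>n\<in>{1..N}. b n * z ^ n)"
proof -
  define D where "D k = (\<Sum>n\<in>{1..k}. a n - b n)" for k
  have D: "D k \<le> 0" for k using le[of k] by (simp add: D_def sum_subtractf)
  have "(\<Sum>n\<in>{1..N}. (a n - b n) * z ^ n) \<le> z ^ N * D N"
  proof (induction N)
    case (Suc N)
    have "z ^ N * D N \<le> z ^ Suc N * D N"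
      by (rule mult_right_mono_neg) (use z D in \<open>auto intro: mult_left_le_one_le\<close>)
    then show ?case using Suc by (simp add: D_def algebra_simps)
  qed (simp add: D_def)
  also have "\<dots> \<le> 0" using D z by (simp add: mult_nonneg_nonpos)
  finally show ?thesis by (simp add: left_diff_distrib sum_subtractf)
qed

text \<open>A substitute for log(1/t) that is at least 1 and antitone on all t > 0, so that large t
  needs no separate case.\<close>

definition log_plus :: "real \<Rightarrow> real" where "log_plus t = 1 + ln (1 + 1 / t)"

lemma log_plus_ge_1: "t > 0 \<Longrightarrow> log_plus t \<ge> 1" by (simp add: log_plus_def)

lemma sum_exp_le:
  fixes t :: real assumes t: "t > 0"
  shows "(\<Sum>n\<in>{1..N}. exp (- t) ^ n) \<le> 1 / t"
    "(\<Sum>n\<in>{1..N}. real n * exp (- t) ^ n) \<le> 4 / t\<^sup>2"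
proof -
  have z: "norm (exp (- t)) < 1" "exp (- t) < 1" using t by auto
  have key: "1 / (1 - exp (- t)) \<le> (1 + t) / t"
  proof -
    have "exp t \<ge> 1 + t" by simp
    then have "exp (- t) \<le> 1 / (1 + t)" using t by (simp add: exp_minus field_simps)
    then have "t / (1 + t) \<le> 1 - exp (- t)" using t by (simp add: field_simps)
    then show ?thesis using t z by (simp add: field_simps)
  qed
  have "(\<Sum>n\<in>{1..N}. exp (- t) ^ n) = (\<Sum>n<N. exp (- t) * exp (- t) ^ n)"
    by (rule sum.reindex_bij_witness[of _ Suc "\<lambda>n. n - 1"]) (auto simp flip: power_Suc)
  also have "\<dots> \<le> (\<Sum>n. exp (- t) * exp (- t) ^ n)"
    by (rule sum_le_suminf) (use z in \<open>auto intro!: summable_mult summable_geometric\<close>)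
  also have "\<dots> = exp (- t) / (1 - exp (- t))"
    using z by (subst suminf_mult) (auto simp: suminf_geometric intro!: summable_geometric)
  also have "\<dots> \<le> 1 / t"
  proof -
    have "exp t - 1 \<ge> t" using exp_ge_add_one_self[of t] by linarith
    moreover have "exp (- t) / (1 - exp (- t)) = 1 / (exp t - 1)"
      using t by (simp add: exp_minus field_simps)
    ultimately show ?thesis using t by (simp add: frac_le)
  qed
  finally show "(\<Sum>n\<in>{1..N}. exp (- t) ^ n) \<le> 1 / t" .
  have s: "(\<lambda>n. exp (- t) ^ n * real n) sums (exp (- t) / (1 - exp (- t))\<^sup>2)"
    using geometric_sums_times_n[OF z(1)] by simp
  have "(\<Sum>n\<in>{1..N}. real n * exp (- t) ^ n) = (\<Sum>n\<in>{1..N}. exp (- t) ^ n * real n)"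
    by (simp add: mult.commute)
  also have "\<dots> \<le> exp (- t) / (1 - exp (- t))\<^sup>2"
    unfolding sums_unique[OF s] by (rule sum_le_suminf) (use s in \<open>auto simp: sums_iff\<close>)
  also have "\<dots> = exp (- t) * (1 / (1 - exp (- t)))\<^sup>2" by (simp add: power_divide)
  also have "\<dots> \<le> exp (- t) * ((1 + t) / t)\<^sup>2"
    using key z t by (intro mult_left_mono power_mono) auto
  also have "\<dots> = (exp (- (t / 2)) * (1 + t))\<^sup>2 / t\<^sup>2"
    by (simp add: power_divide power_mult_distrib exp_double[symmetric])
  also have "\<dots> \<le> 2\<^sup>2 / t\<^sup>2"
  proof (intro divide_right_mono power_mono)
    have "1 + t \<le> 2 * exp (t / 2)" using exp_ge_add_one_self[of "t / 2"] by linarith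
    then show "exp (- (t / 2)) * (1 + t) \<le> 2" by (simp add: exp_minus field_simps)
  qed (use t in auto)
  finally show "(\<Sum>n\<in>{1..N}. real n * exp (- t) ^ n) \<le> 4 / t\<^sup>2" by simp
qed

text \<open>Comparison with a linear function of n: ln k = ln(1/t) + ln(tk) \<le> ln(1 + 1/t) + tk,
  hence the second moment up to k is dominated by the partial sums of
  \<open>600 * log_plus t + 1200 * t * real n\<close>. The slope is doubled because the n up to k
  add up to k(k + 1)/2.\<close>

lemma sum_rep_squared_exp_le:
  assumes t: "t > 0"
  shows "(\<Sum>n\<in>{1..N}. (rep_count n)\<^sup>2 * exp (- t * real n)) \<le> 5400 * log_plus t / t"
proof -
  have "(\<Sum>n\<in>{1..N}. (rep_count n)\<^sup>2 * exp (- t) ^ n) \<le> (\<Sum>n\<in>{1..N}. (600 * log_plus t + 1200 * t * real n) * exp (- t) ^ n)"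
  proof (rule abel_sum_mono)
    fix k :: nat
    show "(\<Sum>n\<in>{1..k}. (rep_count n)\<^sup>2) \<le> (\<Sum>n\<in>{1..k}. 600 * log_plus t + 1200 * t * real n)"
    proof (cases "k = 0")
      case False
      then have k: "k \<ge> 1" by simp
      have "ln (real k) = ln (1 / t) + ln (t * real k)" using k t by (simp add: ln_mult ln_div)
      also have "ln (1 / t) \<le> ln (1 + 1 / t)" using t by (intro ln_mono) auto
      also have "ln (t * real k) \<le> t * real k" using k t ln_le_minus_one[of "t * real k"] by simp
      finally have l: "1 + ln (real k) \<le> log_plus t + t * real k" by (simp add: log_plus_def)
      have "(\<Sum>n\<in>{1..k}. (rep_count n)\<^sup>2) \<le> 600 * (real k * (1 + ln (real k)))"
        by (rule sum_rep_squared_le[OF k])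
      also have "\<dots> \<le> 600 * (real k * (log_plus t + t * real k))"
        using l by (intro mult_left_mono) auto
      also have "\<dots> \<le> 600 * log_plus t * real k + 600 * t * (real k * (real k + 1))"
        using t by (simp add: algebra_simps)
      also have "\<dots> = (\<Sum>n\<in>{1..k}. 600 * log_plus t + 1200 * t * real n)"
      proof -
        have "(\<Sum>n\<in>{1..k}. real n) = real k * (real k + 1) / 2"
          by (induction k) (auto simp: field_simps)
        then show ?thesis by (simp add: sum.distrib sum_distrib_left[symmetric])
      qed
      finally show ?thesis .
    qed simp
  qed (use t in auto)
  also have "\<dots> = 600 * log_plus t * (\<Sum>n\<in>{1..N}. exp (- t) ^ n) + 1200 * t * (\<Sum>n\<in>{1..N}. real n * exp (- t) ^ n)"
    unfolding sum_distrib_left by (simp only: distrib_right sum.distrib mult.assoc)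
  also have "\<dots> \<le> 600 * log_plus t * (1 / t) + 1200 * t * (4 / t\<^sup>2)"
    using t log_plus_ge_1[OF t] by (intro add_mono mult_left_mono sum_exp_le) auto
  also have "\<dots> = (600 * log_plus t + 4800) / t" using t by (simp add: field_simps power2_eq_square)
  also have "\<dots> \<le> 5400 * log_plus t / t" using t log_plus_ge_1[OF t] by (intro divide_right_mono) auto
  finally show ?thesis by (simp add: exp_of_nat_mult[symmetric] mult.commute)
qed

text \<open>The series of -ln(1 - z) at z = e^(-t), with 1 - e^(-t) \<ge> t/(1 + t).\<close>

lemma sum_exp_divide_le:
  fixes t :: real assumes t: "t > 0"
  shows "(\<Sum>k\<in>{1..N}. exp (- t * real k) / real k) \<le> ln (1 + 1 / t)"
proof -
  have z: "exp (- t) < 1" using t by simp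
  have "(\<lambda>n. - ((- (- exp (- t))) ^ n) / real n) sums ln (1 + (- exp (- t)))"
    by (rule ln_series') (use z in auto)
  then have s: "(\<lambda>n. exp (- t) ^ n / real n) sums (- ln (1 - exp (- t)))"
    using sums_minus by fastforce
  have "(\<Sum>k\<in>{1..N}. exp (- t * real k) / real k) = (\<Sum>k\<in>{1..N}. exp (- t) ^ k / real k)"
    by (simp add: exp_of_nat_mult[symmetric] mult.commute)
  also have "\<dots> \<le> - ln (1 - exp (- t))"
    unfolding sums_unique[OF s] by (rule sum_le_suminf) (use s in \<open>auto simp: sums_iff\<close>)
  also have "\<dots> = ln (1 / (1 - exp (- t)))" using z by (simp add: ln_div)
  also have "\<dots> \<le> ln (1 + 1 / t)"
  proof (rule ln_mono)
    have "exp t \<ge> 1 + t" by simp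
    then have "exp (- t) \<le> 1 / (1 + t)" using t by (simp add: exp_minus field_simps)
    then have "t / (1 + t) \<le> 1 - exp (- t)" using t by (simp add: field_simps)
    then show "1 / (1 - exp (- t)) \<le> 1 + 1 / t" using t z by (simp add: field_simps)
  qed (use z in auto)
  finally show ?thesis .
qed

text \<open>The inequality 2uv \<le> u^2 + v^2 and the symmetry in n and m reduce the double sum to
  r(n)^2 times a sum over the difference k = |n - m|. The second moment and the sum of 1/k
  contribute one logarithm each.\<close>

lemma sum_rep_off_diagonal_le:
  assumes t: "t > 0"
  shows "(\<Sum>n\<in>{1..N}. \<Sum>m\<in>{1..N} - {n}. rep_count n * rep_count m * exp (- t * real (n + m)) / \<bar>real n - real m\<bar>)
     \<le> 21600 * (log_plus (t / 2))\<^sup>2 / t"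
proof -
  define w where "w n m = exp (- t * real (n + m)) / \<bar>real n - real m\<bar>" for n m
  have w: "w n m \<ge> 0" "w n m = w m n" for n m by (simp_all add: w_def add.commute abs_minus_commute)
  have swap: "(\<Sum>n\<in>{1..N}. \<Sum>m\<in>{1..N} - {n}. f n m) = (\<Sum>n\<in>{1..N}. \<Sum>m\<in>{1..N} - {n}. f m n)" for f :: "nat \<Rightarrow> nat \<Rightarrow> real"
  proof -
    have "(\<Sum>n\<in>{1..N}. \<Sum>m\<in>{1..N} - {n}. f n m) = (\<Sum>n\<in>{1..N}. \<Sum>m\<in>{1..N}. if n = m then 0 else f n m)" for f :: "nat \<Rightarrow> nat \<Rightarrow> real"
      by (intro sum.cong refl sum.mono_neutral_cong_left) auto
    note A = this
    show ?thesis unfolding A by (rule trans[OF sum.swap]) (intro sum.cong refl, auto)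
  qed
  have "(\<Sum>n\<in>{1..N}. \<Sum>m\<in>{1..N} - {n}. rep_count n * rep_count m * w n m)
    \<le> (\<Sum>n\<in>{1..N}. \<Sum>m\<in>{1..N} - {n}. ((rep_count n)\<^sup>2 * w n m + (rep_count m)\<^sup>2 * w n m) / 2)"
  proof (intro sum_mono)
    fix n m
    have "rep_count n * rep_count m \<le> ((rep_count n)\<^sup>2 + (rep_count m)\<^sup>2) / 2" using sum_squares_bound[of "rep_count n" "rep_count m"] by simp
    from mult_right_mono[OF this w(1)]
    show "rep_count n * rep_count m * w n m \<le> ((rep_count n)\<^sup>2 * w n m + (rep_count m)\<^sup>2 * w n m) / 2"
      by (simp add: field_simps)
  qed
  also have "\<dots> = (\<Sum>n\<in>{1..N}. \<Sum>m\<in>{1..N} - {n}. (rep_count n)\<^sup>2 * w n m)"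
  proof -
    have "(\<Sum>n\<in>{1..N}. \<Sum>m\<in>{1..N} - {n}. (rep_count m)\<^sup>2 * w n m) = (\<Sum>n\<in>{1..N}. \<Sum>m\<in>{1..N} - {n}. (rep_count n)\<^sup>2 * w n m)"
      by (subst swap) (simp add: w(2))
    then show ?thesis by (simp add: sum_divide_distrib[symmetric] sum.distrib)
  qed
  also have "\<dots> \<le> (\<Sum>n\<in>{1..N}. (rep_count n)\<^sup>2 * exp (- (t / 2) * real n) * (2 * ln (1 + 1 / (t / 2))))"
  proof (rule sum_mono)
    fix n assume n: "n \<in> {1..N}"
    define e where "e k = exp (- (t / 2) * real k) / real k" for k
    have e: "e k \<ge> 0" for k by (simp add: e_def)
    have "(\<Sum>m\<in>{1..N} - {n}. w n m) \<le> (\<Sum>m\<in>{1..N} - {n}. exp (- (t / 2) * real n) * e (if m < n then n - m else m - n))"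
    proof (rule sum_mono)
      fix m assume m: "m \<in> {1..N} - {n}"
      have abs: "\<bar>real n - real m\<bar> = real (if m < n then n - m else m - n)" by auto
      \<comment> \<open>By n + |n - m| \<le> 2(n + m), half of the decay rate is available both for
        the sum over n and for the sum over the difference.\<close>
      have "t * (real n + \<bar>real n - real m\<bar>) \<le> t * (2 * real (n + m))"
        using t by (intro mult_left_mono) auto
      then have "exp (- t * real (n + m)) \<le> exp (- (t / 2) * real n + - (t / 2) * \<bar>real n - real m\<bar>)"
        by (simp add: algebra_simps)
      also have "\<dots> = exp (- (t / 2) * real n) * exp (- (t / 2) * \<bar>real n - real m\<bar>)" by (rule exp_add)
      finally show "w n m \<le> exp (- (t / 2) * real n) * e (if m < n then n - m else m - n)"
        unfolding w_def e_def abs[symmetric] by (simp add: divide_right_mono)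
    qed
    also have "\<dots> = exp (- (t / 2) * real n) * (\<Sum>m\<in>{1..<n} \<union> {n<..N}. e (if m < n then n - m else m - n))"
    proof -
      have "{1..N} - {n} = {1..<n} \<union> {n<..N}" using n by auto
      then show ?thesis by (simp only: sum_distrib_left)
    qed
    also have "(\<Sum>m\<in>{1..<n} \<union> {n<..N}. e (if m < n then n - m else m - n)) = (\<Sum>m\<in>{1..<n}. e (n - m)) + (\<Sum>m\<in>{n<..N}. e (m - n))"
      by (subst sum.union_disjoint) (auto intro!: arg_cong2[where f = "(+)"] sum.cong)
    also have "(\<Sum>m\<in>{1..<n}. e (n - m)) = (\<Sum>k\<in>{1..<n}. e k)"
      by (rule sum.reindex_bij_witness[of _ "\<lambda>k. n - k" "\<lambda>k. n - k"]) auto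
    also have "\<dots> \<le> (\<Sum>k\<in>{1..N}. e k)" by (rule sum_mono2) (use n e in auto)
    also have "(\<Sum>m\<in>{n<..N}. e (m - n)) = (\<Sum>k\<in>{1..N - n}. e k)"
      by (rule sum.reindex_bij_witness[of _ "\<lambda>k. k + n" "\<lambda>k. k - n"]) auto
    also have "\<dots> \<le> (\<Sum>k\<in>{1..N}. e k)" by (rule sum_mono2) (use n e in auto)
    also have "(\<Sum>k\<in>{1..N}. e k) \<le> ln (1 + 1 / (t / 2))"
      unfolding e_def by (rule sum_exp_divide_le) (use t in auto)
    finally have "(\<Sum>m\<in>{1..N} - {n}. w n m) \<le> exp (- (t / 2) * real n) * (2 * ln (1 + 1 / (t / 2)))"
      by simp
    then show "(\<Sum>m\<in>{1..N} - {n}. (rep_count n)\<^sup>2 * w n m) \<le> (rep_count n)\<^sup>2 * exp (- (t / 2) * real n) * (2 * ln (1 + 1 / (t / 2)))"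
      unfolding sum_distrib_left[symmetric] mult.assoc by (intro mult_left_mono) auto
  qed
  also have "\<dots> = (\<Sum>n\<in>{1..N}. (rep_count n)\<^sup>2 * exp (- (t / 2) * real n)) * (2 * ln (1 + 1 / (t / 2)))"
    by (rule sum_distrib_right[symmetric])
  also have "\<dots> \<le> (5400 * log_plus (t / 2) / (t / 2)) * (2 * log_plus (t / 2))"
    using t log_plus_ge_1[of "t / 2"]
    by (intro mult_mono sum_rep_squared_exp_le) (auto simp: log_plus_def)
  also have "\<dots> = 21600 * (log_plus (t / 2))\<^sup>2 / t" by (simp add: power2_eq_square)
  finally show ?thesis by (simp add: w_def)
qed

section \<open>The mean square of the dual series\<close>

text \<open>Different multiples of two vectors of equal length cannot cancel; this keeps the
  derivative of the phase away from 0 for n \<noteq> m.\<close>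

lemma norm_linear_diff_ge:
  fixes u v :: complex and n m :: nat
  assumes "norm u = norm v"
  shows "\<bar>real n - real m\<bar> * norm v \<le> norm (of_nat n * u - of_nat m * v)"
proof -
  have "\<bar>norm (of_nat n * u) - norm (of_nat m * v)\<bar> \<le> norm (of_nat n * u - of_nat m * v)"
    by (rule norm_triangle_ineq3)
  then show ?thesis using assms by (simp add: norm_mult left_diff_distrib[symmetric] abs_mult)
qed

text \<open>With \<open>w = \<pi>\<^sup>2/(a + iy)\<close> the value at \<open>z = y\<close> is \<open>exp(-n w) \<cdot> cnj (exp(-m w))\<close>; it is extended holomorphically in \<open>z\<close>.\<close>

definition phase :: "real \<Rightarrow> nat \<Rightarrow> nat \<Rightarrow> complex \<Rightarrow> complex" where
  "phase a n m z = exp (- (of_real (pi\<^sup>2) * (of_nat n / (of_real a + \<i> * z) + of_nat m / (of_real a - \<i> * z))))"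

lemma norm_phase:
  assumes "a > 0"
  shows "norm (phase a n m (of_real y)) = exp (- (pi\<^sup>2 * a / (a\<^sup>2 + y\<^sup>2)) * real (n + m))"
proof -
  have "Re (of_nat n / (of_real a + \<i> * of_real y)) = real n * a / (a\<^sup>2 + y\<^sup>2)" 
    "Re (of_nat m / (of_real a - \<i> * of_real y)) = real m * a / (a\<^sup>2 + y\<^sup>2)" by (simp_all add: Re_divide)
  moreover have "Re (- (of_real c * (u + v))) = - (c * (Re u + Re v))" for c u v by simp
  ultimately show ?thesis unfolding phase_def norm_exp_eq_Re
    by (simp only:) (simp add: add_divide_distrib algebra_simps)
qed

text \<open>The logarithmic derivative of \<open>phase\<close> is i \<pi>^2 D/(ST)^2. The amplitude
  A = ST/(i \<pi>^2 D) is chosen so that its product with this is 1/(ST), which on the real axis is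
  the wanted factor 1/(a^2 + y^2). The remaining terms are those of w'A + wA'.\<close>

lemma phase_antiderivative:
  fixes a H y :: real and n m :: nat
  assumes a: "a > 0" and H: "H > 0" and nm: "n \<noteq> m"
  defines "S \<equiv> \<lambda>z. of_real a + \<i> * z" and "T \<equiv> \<lambda>z. of_real a - \<i> * z"
  defines "D \<equiv> \<lambda>z::complex. of_nat n * (T z)\<^sup>2 - of_nat m * (S z)\<^sup>2"
  defines "w \<equiv> \<lambda>z::complex. 1 / (of_real H ^ 2 + z\<^sup>2)"
  defines "z \<equiv> complex_of_real y"
  shows "((\<lambda>z. w z * (S z * T z / (\<i> * of_real (pi\<^sup>2) * D z)) * phase a n m z) has_field_derivative
    w z / (S z * T z) * phase a n m z
     + ((- 2 * z * (w z)\<^sup>2) * (S z * T z / (\<i> * of_real (pi\<^sup>2) * D z))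
        + w z * (2 * of_real a * (of_nat n * (T z)\<^sup>2 + of_nat m * (S z)\<^sup>2) / (of_real (pi\<^sup>2) * (D z)\<^sup>2))) * phase a n m z) (at z)"
    and "norm (S z) ^ 2 = a\<^sup>2 + y\<^sup>2" "norm (T z) ^ 2 = a\<^sup>2 + y\<^sup>2" "S z * T z = of_real (a\<^sup>2 + y\<^sup>2)"
    and "norm (D z) \<ge> \<bar>real n - real m\<bar> * (a\<^sup>2 + y\<^sup>2)"
proof -
  show nS: "norm (S z) ^ 2 = a\<^sup>2 + y\<^sup>2" and nT: "norm (T z) ^ 2 = a\<^sup>2 + y\<^sup>2" and ST: "S z * T z = of_real (a\<^sup>2 + y\<^sup>2)"
    unfolding cmod_power2 by (simp_all add: S_def T_def z_def complex_eq_iff) (simp_all add: power2_eq_square)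
  show nD: "norm (D z) \<ge> \<bar>real n - real m\<bar> * (a\<^sup>2 + y\<^sup>2)"
    using norm_linear_diff_ge[of "(T z)\<^sup>2" "(S z)\<^sup>2" n m] nS nT by (simp add: D_def norm_power)
  have q: "a\<^sup>2 + y\<^sup>2 > 0" using a by (simp add: add_pos_nonneg)
  have S0: "S z \<noteq> 0" and T0: "T z \<noteq> 0" using nS nT q by auto
  have D0: "D z \<noteq> 0"
  proof
    assume "D z = 0"
    then have "\<bar>real n - real m\<bar> * (a\<^sup>2 + y\<^sup>2) \<le> 0" using nD by simp
    then show False using q nm by (simp add: mult_le_0_iff)
  qed
  have w0: "of_real H ^ 2 + z\<^sup>2 \<noteq> 0"
  proof -
    have "of_real H ^ 2 + z\<^sup>2 = of_real (H\<^sup>2 + y\<^sup>2)" by (simp add: z_def)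
    moreover have "H\<^sup>2 + y\<^sup>2 > 0" using H by (simp add: add_pos_nonneg)
    ultimately show ?thesis by (metis less_irrefl of_real_eq_0_iff)
  qed
  have dS: "(S has_field_derivative \<i>) (at z)" unfolding S_def by (auto intro!: derivative_eq_intros)
  have dT: "(T has_field_derivative - \<i>) (at z)" unfolding T_def by (auto intro!: derivative_eq_intros)
  have dw: "(w has_field_derivative - 2 * z * (w z)\<^sup>2) (at z)"
    unfolding w_def using w0 by (auto intro!: derivative_eq_intros simp: field_simps power2_eq_square)
  have dD: "(D has_field_derivative - 2 * \<i> * (of_nat n * T z + of_nat m * S z)) (at z)"
    unfolding D_def by (rule derivative_eq_intros dS dT refl)+ (simp add: algebra_simps)
  have dA: "((\<lambda>z. S z * T z / (\<i> * of_real (pi\<^sup>2) * D z)) has_field_derivative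
      2 * of_real a * (of_nat n * (T z)\<^sup>2 + of_nat m * (S z)\<^sup>2) / (of_real (pi\<^sup>2) * (D z)\<^sup>2)) (at z)"
  proof -
    have d: "((\<lambda>z. S z * T z / (\<i> * of_real (pi\<^sup>2) * D z)) has_field_derivative
      ((S z * - \<i> + \<i> * T z) * (\<i> * of_real (pi\<^sup>2) * D z) - S z * T z * (\<i> * of_real (pi\<^sup>2) * (- 2 * \<i> * (of_nat n * T z + of_nat m * S z))))
        / ((\<i> * of_real (pi\<^sup>2) * D z) * (\<i> * of_real (pi\<^sup>2) * D z))) (at z)"
      by (rule derivative_eq_intros dS dT dD refl)+ (use D0 in \<open>simp_all add: algebra_simps\<close>)
    \<comment> \<open>The numerator has the factor S + T = 2a; through it A' becomes comparable to n
      + m times the decay rate of \<open>phase\<close>.\<close>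
    have num: "(S z * - \<i> + \<i> * T z) * (\<i> * of_real (pi\<^sup>2) * D z) - S z * T z * (\<i> * of_real (pi\<^sup>2) * (- 2 * \<i> * (of_nat n * T z + of_nat m * S z)))
      = - (of_real (pi\<^sup>2) * ((S z + T z) * (of_nat n * (T z)\<^sup>2 + of_nat m * (S z)\<^sup>2)))"
    proof -
      have ii: "\<i> * (\<i> * x) = - x" for x by (simp flip: mult.assoc)
      show ?thesis unfolding D_def by (simp add: algebra_simps power2_eq_square power3_eq_cube ii)
    qed
    have sum: "S z + T z = 2 * of_real a" by (simp add: S_def T_def)
    have frac: "- (P * (2 * of_real a * E)) / ((\<i> * P * d) * (\<i> * P * d)) = 2 * of_real a * E / (P * d\<^sup>2)"
      if "P \<noteq> 0" "d \<noteq> 0" for P E d :: complex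
      using that by (simp add: field_simps power2_eq_square)
    show ?thesis
      using d unfolding num sum by (rule DERIV_cong) (rule frac, use D0 in auto)
  qed
  have dP: "(phase a n m has_field_derivative
      (\<i> * of_real (pi\<^sup>2) * D z / (S z * T z)\<^sup>2) * phase a n m z) (at z)"
  proof -
    have dn: "((\<lambda>z. of_nat n / S z) has_field_derivative - of_nat n * \<i> / (S z)\<^sup>2) (at z)"
      by (rule DERIV_cong[OF DERIV_divide[OF DERIV_const dS S0]]) (simp add: power2_eq_square)
    have dm: "((\<lambda>z. of_nat m / T z) has_field_derivative of_nat m * \<i> / (T z)\<^sup>2) (at z)"
      by (rule DERIV_cong[OF DERIV_divide[OF DERIV_const dT T0]]) (simp add: power2_eq_square)
    have "((\<lambda>z. exp (- (of_real (pi\<^sup>2) * (of_nat n / S z + of_nat m / T z)))) has_field_derivative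
      exp (- (of_real (pi\<^sup>2) * (of_nat n / S z + of_nat m / T z))) *
        (- (of_real (pi\<^sup>2) * (- of_nat n * \<i> / (S z)\<^sup>2 + of_nat m * \<i> / (T z)\<^sup>2)))) (at z)"
      by (rule DERIV_cong, (rule derivative_intros dn dm)+) (simp add: mult_ac)
    moreover have "- (of_real (pi\<^sup>2) * (- of_nat n * \<i> / (S z)\<^sup>2 + of_nat m * \<i> / (T z)\<^sup>2)) = \<i> * of_real (pi\<^sup>2) * D z / (S z * T z)\<^sup>2"
      using S0 T0 unfolding D_def by (simp add: field_simps power_mult_distrib)
    moreover have "phase a n m = (\<lambda>z. exp (- (of_real (pi\<^sup>2) * (of_nat n / S z + of_nat m / T z))))"
      by (simp add: fun_eq_iff phase_def S_def T_def)
    ultimately show ?thesis by (simp only: mult.commute[of "exp _"])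
  qed
  show "((\<lambda>z. w z * (S z * T z / (\<i> * of_real (pi\<^sup>2) * D z)) * phase a n m z) has_field_derivative
    w z / (S z * T z) * phase a n m z
     + ((- 2 * z * (w z)\<^sup>2) * (S z * T z / (\<i> * of_real (pi\<^sup>2) * D z))
        + w z * (2 * of_real a * (of_nat n * (T z)\<^sup>2 + of_nat m * (S z)\<^sup>2) / (of_real (pi\<^sup>2) * (D z)\<^sup>2))) * phase a n m z) (at z)"
  proof (rule DERIV_cong[OF DERIV_mult[OF DERIV_mult[OF dw dA] dP]])
    let ?A = "S z * T z / (\<i> * of_real (pi\<^sup>2) * D z)"
    have "?A * (\<i> * of_real (pi\<^sup>2) * D z / (S z * T z)\<^sup>2) = 1 / (S z * T z)"
      using S0 T0 D0 by (simp add: power2_eq_square)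
    then have "?A * (\<i> * of_real (pi\<^sup>2) * D z / (S z * T z)\<^sup>2) * (w z * phase a n m z) = 1 / (S z * T z) * (w z * phase a n m z)"
      by (simp only:)
    then have "(\<i> * of_real (pi\<^sup>2) * D z / (S z * T z)\<^sup>2) * phase a n m z * (w z * ?A) = w z / (S z * T z) * phase a n m z"
      by (simp only: mult_ac times_divide_eq_left times_divide_eq_right mult_1_left)
    then show "(- 2 * z * (w z)\<^sup>2 * ?A + 2 * of_real a * (of_nat n * (T z)\<^sup>2 + of_nat m * (S z)\<^sup>2) / (of_real (pi\<^sup>2) * (D z)\<^sup>2) * w z) * phase a n m z +
       \<i> * of_real (pi\<^sup>2) * D z / (S z * T z)\<^sup>2 * phase a n m z * (w z * ?A) = 
       w z / (S z * T z) * phase a n m z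
     + ((- 2 * z * (w z)\<^sup>2) * ?A
        + w z * (2 * of_real a * (of_nat n * (T z)\<^sup>2 + of_nat m * (S z)\<^sup>2) / (of_real (pi\<^sup>2) * (D z)\<^sup>2))) * phase a n m z"
      by (simp only: mult.commute[of "w z" "_ / _"] add.commute)
  qed
qed

text \<open>Absorbs a linear factor into half of the exponential decay, which is why the exponents
  are halved in the off-diagonal bound.\<close>

lemma mult_exp_neg_half_le: "t * exp (- t) \<le> 2 * exp (- (t / 2))" for t :: real
proof -
  have "t \<le> 2 * exp (t / 2)" using exp_ge_add_one_self[of "t / 2"] by linarith
  then have "t * exp (- t) \<le> 2 * exp (t / 2) * exp (- t)" by (intro mult_right_mono) auto
  also have "\<dots> = 2 * exp (- (t / 2))" by (simp flip: exp_add)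
  finally show ?thesis .
qed

lemma continuous_on_phase:
  assumes "a > 0"
  shows "continuous_on A (\<lambda>y. phase a n m (of_real y))"
proof -
  have "of_real a + \<i> * of_real y \<noteq> 0" "of_real a - \<i> * of_real y \<noteq> 0" for y
    using assms by (auto simp: complex_eq_iff)
  then show ?thesis unfolding phase_def by (intro continuous_intros) auto
qed

text \<open>The first term bounds the boundary values at \<plusminus>\<pi>. Under the integral,
  2/sqrt(H^2 + y^2) comes from differentiating the weight 1/(H^2 + y^2), and 1 from differentiating
  the amplitude.\<close>

lemma off_diagonal_integral_le:
  fixes a H :: real and n m :: nat
  assumes a: "a > 0" and H: "H > 0" and nm: "n \<noteq> m"
  shows "norm (integral {-pi..pi} (\<lambda>y. of_real (1 / ((H\<^sup>2 + y\<^sup>2) * (a\<^sup>2 + y\<^sup>2))) * phase a n m (of_real y)))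
    \<le> (1 / (H\<^sup>2 + pi\<^sup>2) * exp (- (pi\<^sup>2 * a / (a\<^sup>2 + pi\<^sup>2) / 2) * real (n + m))
       + integral {-pi..pi} (\<lambda>y. (2 / sqrt (H\<^sup>2 + y\<^sup>2) + 1) / (H\<^sup>2 + y\<^sup>2) * exp (- (pi\<^sup>2 * a / (a\<^sup>2 + y\<^sup>2) / 2) * real (n + m))))
      / \<bar>real n - real m\<bar>"
proof -
  define S where "S z = of_real a + \<i> * z" for z
  define T where "T z = of_real a - \<i> * z" for z
  define D where "D z = of_nat n * (T z)\<^sup>2 - of_nat m * (S z)\<^sup>2" for z
  define w where "w z = 1 / (of_real H ^ 2 + z\<^sup>2)" for z :: complex
  define A where "A z = S z * T z / (\<i> * of_real (pi\<^sup>2) * D z)" for z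
  define A' where "A' z = 2 * of_real a * (of_nat n * (T z)\<^sup>2 + of_nat m * (S z)\<^sup>2) / (of_real (pi\<^sup>2) * (D z)\<^sup>2)" for z
  define f where "f y = of_real (1 / ((H\<^sup>2 + y\<^sup>2) * (a\<^sup>2 + y\<^sup>2))) * phase a n m (of_real y)" for y
  define g where "g y = ((- 2 * of_real y * (w (of_real y))\<^sup>2) * A (of_real y) + w (of_real y) * A' (of_real y)) * phase a n m (of_real y)" for y
  define F where "F y = w (of_real y) * A (of_real y) * phase a n m (of_real y)" for y :: real
  define d where "d = \<bar>real n - real m\<bar>"
  define W where "W y = 1 / (H\<^sup>2 + y\<^sup>2)" for y
  define sg where "sg y = pi\<^sup>2 * a / (a\<^sup>2 + y\<^sup>2)" for y
  define B where "B y = (2 / sqrt (H\<^sup>2 + y\<^sup>2) + 1) / (H\<^sup>2 + y\<^sup>2) * exp (- (sg y / 2) * real (n + m))" for y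
  have d: "d \<ge> 1" using nm by (simp add: d_def)
  have Hy: "H\<^sup>2 + y\<^sup>2 > 0" and ay: "a\<^sup>2 + y\<^sup>2 > 0" for y using H a by (simp_all add: add_pos_nonneg)
  have sg: "sg y > 0" for y using a ay by (simp add: sg_def)
  have wW: "w (of_real y) = of_real (W y)" for y by (simp add: w_def W_def)
  have W: "W y > 0" for y using Hy by (simp add: W_def)
  note P = phase_antiderivative[OF a H nm, folded S_def T_def, folded D_def, folded w_def]
  have nS: "norm (S (of_real y)) ^ 2 = a\<^sup>2 + y\<^sup>2" and nT: "norm (T (of_real y)) ^ 2 = a\<^sup>2 + y\<^sup>2"
    and ST: "S (of_real y) * T (of_real y) = of_real (a\<^sup>2 + y\<^sup>2)"
    and nD: "norm (D (of_real y)) \<ge> d * (a\<^sup>2 + y\<^sup>2)" for y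
    using P(2-5)[of y] by (simp_all add: d_def S_def T_def D_def)
  have nD0: "norm (D (of_real y)) > 0" for y
  proof -
    have "0 < d * (a\<^sup>2 + y\<^sup>2)" using d ay[of y] by simp
    then show ?thesis using nD[of y] by linarith
  qed
  have dF: "(F has_vector_derivative f y + g y) (at y within X)" for y X
  proof -
    have "((\<lambda>z. w z * A z * phase a n m z) has_field_derivative w (of_real y) / (S (of_real y) * T (of_real y)) * phase a n m (of_real y) +
       ((- 2 * of_real y * (w (of_real y))\<^sup>2) * A (of_real y) + w (of_real y) * A' (of_real y)) * phase a n m (of_real y)) (at (of_real y))"
      using P(1)[of y] unfolding A_def A'_def S_def T_def D_def w_def .
    from has_vector_derivative_real_field[OF this]
    show ?thesis by (simp add: F_def[abs_def] f_def g_def ST wW W_def)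
  qed
  have FTC: "((\<lambda>y. f y + g y) has_integral (F pi - F (- pi))) {-pi..pi}"
    by (rule fundamental_theorem_of_calculus[OF _ dF]) simp
  have fint: "f integrable_on {-pi..pi}"
    unfolding f_def using Hy ay
    by (intro integrable_continuous_real continuous_intros continuous_on_phase a) (metis less_irrefl mult_eq_0_iff)+
  have "(\<lambda>y. (f y + g y) - f y) integrable_on {-pi..pi}"
    using FTC fint by (intro integrable_diff) auto
  then have gint: "g integrable_on {-pi..pi}" by simp
  have "integral {-pi..pi} f + integral {-pi..pi} g = F pi - F (- pi)"
    using integral_unique[OF FTC] fint gint by (simp add: integral_add)
  then have "integral {-pi..pi} f = F pi - F (- pi) - integral {-pi..pi} g" by (simp add: algebra_simps)
  then have main: "norm (integral {-pi..pi} f) \<le> norm (F pi) + norm (F (- pi)) + norm (integral {-pi..pi} g)"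
    by (metis norm_triangle_ineq4 norm_triangle_le_diff order_trans add_right_mono)
  have nph: "norm (phase a n m (of_real y)) = exp (- sg y * real (n + m))" for y
    unfolding sg_def by (rule norm_phase[OF a])
  have pi2: "pi\<^sup>2 \<ge> 4" using pi_ge_two power_mono[of 2 pi 2] by simp
  have cancel: "x / (4 * (d * x)) = 1 / (4 * d)" if "x > 0" for x using that d by (simp add: field_simps)
  have nA: "norm (A (of_real y)) \<le> 1 / (4 * d)" for y
  proof -
    have "norm (A (of_real y)) = (a\<^sup>2 + y\<^sup>2) / (pi\<^sup>2 * norm (D (of_real y)))"
      unfolding A_def ST norm_divide norm_mult using ay[of y] by (simp del: of_real_add of_real_power)
    also have "\<dots> \<le> (a\<^sup>2 + y\<^sup>2) / (4 * (d * (a\<^sup>2 + y\<^sup>2)))"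
      using ay[of y] d pi2 nD[of y] by (intro divide_left_mono mult_mono mult_pos_pos) (use nD0[of y] in auto)
    also have "(a\<^sup>2 + y\<^sup>2) / (4 * (d * (a\<^sup>2 + y\<^sup>2))) = 1 / (4 * d)"
      using cancel[OF ay[of y]] .
    finally show ?thesis .
  qed
  have arrange: "2 * a * (M * x) / (p * (d * x)\<^sup>2) = M * (p * a / x) * (2 / p / p) / d\<^sup>2"
    if "x > 0" "p > 0" for x p M :: real
    using that d by (simp add: field_simps power2_eq_square)
  have nA': "norm (A' (of_real y)) \<le> real (n + m) * sg y / (8 * d)" for y
  proof -
    have "norm (of_nat n * (T (of_real y))\<^sup>2 + of_nat m * (S (of_real y))\<^sup>2) \<le> real (n + m) * (a\<^sup>2 + y\<^sup>2)"
      by (rule order_trans[OF norm_triangle_ineq]) (simp add: norm_mult norm_power nS nT algebra_simps)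
    note E = this
    have "norm (A' (of_real y)) \<le> 2 * a * (real (n + m) * (a\<^sup>2 + y\<^sup>2)) / (pi\<^sup>2 * (norm (D (of_real y)))\<^sup>2)"
    proof -
      have "norm (A' (of_real y)) = 2 * a * norm (of_nat n * (T (of_real y))\<^sup>2 + of_nat m * (S (of_real y))\<^sup>2) / (pi\<^sup>2 * (norm (D (of_real y)))\<^sup>2)"
        unfolding A'_def norm_divide norm_mult norm_power norm_of_real using a by simp
      also have "\<dots> \<le> 2 * a * (real (n + m) * (a\<^sup>2 + y\<^sup>2)) / (pi\<^sup>2 * (norm (D (of_real y)))\<^sup>2)"
        using E a by (intro divide_right_mono mult_left_mono) auto
      finally show ?thesis .
    qed
    also have "\<dots> \<le> 2 * a * (real (n + m) * (a\<^sup>2 + y\<^sup>2)) / (pi\<^sup>2 * (d * (a\<^sup>2 + y\<^sup>2))\<^sup>2)"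
      using a ay[of y] d nD[of y] by (intro divide_left_mono mult_mono mult_pos_pos power_mono zero_less_power) (use nD0[of y] in auto)
    also have "\<dots> = real (n + m) * sg y * (2 / pi\<^sup>2 / pi\<^sup>2) / d\<^sup>2"
      unfolding sg_def by (rule arrange) (use ay[of y] d in auto)
    \<comment> \<open>One of the two factors d is given up, to match the order of the bound for
      A.\<close>
    also have "\<dots> \<le> real (n + m) * sg y * (1 / 8) / d"
    proof (rule frac_le)
      have "2 / pi\<^sup>2 / pi\<^sup>2 \<le> 2 / 4 / 4" using pi2 by (intro frac_le) auto
      then show "real (n + m) * sg y * (2 / pi\<^sup>2 / pi\<^sup>2) \<le> real (n + m) * sg y * (1 / 8)"
        using sg[of y] by (intro mult_left_mono) auto
      show "d \<le> d\<^sup>2" using d by (simp add: power2_eq_square)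
    qed (use sg[of y] d in auto)
    finally show ?thesis by simp
  qed
  have nF: "norm (F y) \<le> W y * exp (- (sg y / 2) * real (n + m)) / (4 * d)" for y
  proof -
    have "norm (F y) = W y * norm (A (of_real y)) * exp (- sg y * real (n + m))"
      using W[of y] by (simp add: F_def norm_mult wW nph)
    also have "\<dots> \<le> W y * (1 / (4 * d)) * exp (- (sg y / 2) * real (n + m))"
      using W[of y] nA[of y] sg[of y] d by (intro mult_mono) (auto simp: mult_right_mono)
    finally show ?thesis by simp
  qed
  have ng: "norm (g y) \<le> B y / d" for y
  proof -
    define e where "e = exp (- (sg y / 2) * real (n + m))"
    have e: "exp (- sg y * real (n + m)) \<le> e" using sg[of y] by (simp add: e_def mult_right_mono)
    have "norm (g y) \<le> (norm (- 2 * of_real y * (w (of_real y))\<^sup>2 * A (of_real y)) + norm (w (of_real y) * A' (of_real y))) * norm (phase a n m (of_real y))"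
      unfolding g_def norm_mult[of "_ + _"] by (intro mult_right_mono norm_triangle_ineq) auto
    also have "\<dots> = 2 * \<bar>y\<bar> * (W y)\<^sup>2 * norm (A (of_real y)) * exp (- sg y * real (n + m)) + W y * norm (A' (of_real y)) * exp (- sg y * real (n + m))"
      using W[of y] by (simp add: nph wW norm_mult norm_power distrib_right)
    also have "2 * \<bar>y\<bar> * (W y)\<^sup>2 * norm (A (of_real y)) * exp (- sg y * real (n + m)) \<le> (2 / sqrt (H\<^sup>2 + y\<^sup>2)) * W y * (1 / d) * e"
    proof -
      have "\<bar>y\<bar> \<le> sqrt (H\<^sup>2 + y\<^sup>2)" by (rule real_le_rsqrt) simp
      then have "\<bar>y\<bar> * W y \<le> sqrt (H\<^sup>2 + y\<^sup>2) * W y" using W[of y] by (intro mult_right_mono) auto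
      also have "\<dots> = 1 / sqrt (H\<^sup>2 + y\<^sup>2)"
        using Hy[of y] sqrt_divide_self_eq[of "H\<^sup>2 + y\<^sup>2"] by (simp add: W_def inverse_eq_divide)
      finally have 1: "2 * \<bar>y\<bar> * (W y)\<^sup>2 \<le> (2 / sqrt (H\<^sup>2 + y\<^sup>2)) * W y"
        using mult_right_mono[of "\<bar>y\<bar> * W y" "1 / sqrt (H\<^sup>2 + y\<^sup>2)" "2 * W y"] W[of y]
        by (simp add: power2_eq_square mult_ac)
      have 2: "norm (A (of_real y)) \<le> 1 / d" using nA[of y] d by (simp add: field_simps)
      show ?thesis
        by (rule mult_mono[OF mult_mono[OF 1 2] e]) (use W[of y] Hy[of y] d in auto)
    qed
    also have "W y * norm (A' (of_real y)) * exp (- sg y * real (n + m)) \<le> W y * (1 / d) * e"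
    proof -
      have "norm (A' (of_real y)) * exp (- sg y * real (n + m)) \<le> (real (n + m) * sg y / (8 * d)) * exp (- sg y * real (n + m))"
        using nA'[of y] by (intro mult_right_mono) auto
      also have "\<dots> = (sg y * real (n + m)) * exp (- (sg y * real (n + m))) / (8 * d)" by simp
      also have "\<dots> \<le> 2 * exp (- (sg y * real (n + m) / 2)) / (8 * d)"
        using d by (intro divide_right_mono mult_exp_neg_half_le) auto
      also have "\<dots> \<le> 1 / d * e" using d by (simp add: e_def field_simps)
      finally show ?thesis unfolding mult.assoc using W[of y] by (intro mult_left_mono) auto
    qed
    also have "(2 / sqrt (H\<^sup>2 + y\<^sup>2)) * W y * (1 / d) * e + W y * (1 / d) * e = B y / d"
      unfolding B_def W_def e_def[symmetric] by (simp only: add_divide_distrib distrib_right) simp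
    finally show ?thesis by simp
  qed
  have Bint: "B integrable_on {-pi..pi}"
    unfolding B_def sg_def using Hy ay
    by (intro integrable_continuous_real continuous_intros) (metis less_irrefl real_sqrt_eq_zero_cancel_iff zero_neq_numeral)+
  have gB: "norm (integral {-pi..pi} g) \<le> integral {-pi..pi} B / d"
    using integral_norm_bound_integral[OF gint _ ng] integrable_on_cmult_right[OF Bint, of "1 / d"] by simp
  have "norm (F pi) + norm (F (- pi)) \<le> W pi * exp (- (sg pi / 2) * real (n + m)) / d"
  proof -
    have "W (- pi) = W pi" "sg (- pi) = sg pi" by (simp_all add: W_def sg_def)
    then have "norm (F pi) + norm (F (- pi)) \<le> 2 * (W pi * exp (- (sg pi / 2) * real (n + m)) / (4 * d))"
      using nF[of pi] nF[of "- pi"] by simp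
    also have "\<dots> \<le> W pi * exp (- (sg pi / 2) * real (n + m)) / d"
      using d W[of pi] by (simp add: field_simps)
    finally show ?thesis .
  qed
  then have "norm (integral {-pi..pi} f) \<le> (W pi * exp (- (sg pi / 2) * real (n + m)) + integral {-pi..pi} B) / d"
    using main gB unfolding add_divide_distrib by linarith
  then show ?thesis unfolding f_def B_def W_def sg_def d_def .
qed

text \<open>The antiderivatives are arctan(y/H)/H and arsinh(y/H); the second one grows
  logarithmically in 1/H.\<close>

lemma kernel_integral_le:
  fixes H :: real assumes H: "H > 0"
  shows "integral {-pi..pi} (\<lambda>y. 1 / (H\<^sup>2 + y\<^sup>2)) \<le> pi / H"
    and "integral {-pi..pi} (\<lambda>y. 1 / sqrt (H\<^sup>2 + y\<^sup>2)) \<le> 2 * ln (1 + 8 / H)"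
proof -
  have Hy: "H\<^sup>2 + y\<^sup>2 > 0" for y using H by (simp add: add_pos_nonneg)
  have "((\<lambda>y. 1 / (H\<^sup>2 + y\<^sup>2)) has_integral (arctan (pi / H) / H - arctan (- pi / H) / H)) {-pi..pi}"
  proof (rule fundamental_theorem_of_calculus)
    fix y :: real
    have "((\<lambda>y. arctan (y / H) / H) has_real_derivative (inverse (1 + (y / H)\<^sup>2) * (1 / H)) / H) (at y within {-pi..pi})"
      using H by (auto intro!: derivative_eq_intros)
    moreover have "(inverse (1 + (y / H)\<^sup>2) * (1 / H)) / H = 1 / (H\<^sup>2 + y\<^sup>2)"
    proof -
      have "1 + (y / H)\<^sup>2 = (H\<^sup>2 + y\<^sup>2) / H\<^sup>2" using H by (simp add: field_simps)
      then show ?thesis using H by (simp add: power2_eq_square)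
    qed
    ultimately show "((\<lambda>y. arctan (y / H) / H) has_vector_derivative 1 / (H\<^sup>2 + y\<^sup>2)) (at y within {-pi..pi})"
      by (simp add: has_real_derivative_iff_has_vector_derivative)
  qed simp
  moreover have "arctan (pi / H) / H - arctan (- pi / H) / H \<le> pi / H"
    using arctan_ubound[of "pi / H"] H by (simp add: arctan_minus field_simps)
  ultimately show "integral {-pi..pi} (\<lambda>y. 1 / (H\<^sup>2 + y\<^sup>2)) \<le> pi / H" by (simp add: integral_unique)
  have "((\<lambda>y. 1 / sqrt (H\<^sup>2 + y\<^sup>2)) has_integral (arsinh (pi / H) - arsinh (- pi / H))) {-pi..pi}"
  proof (rule fundamental_theorem_of_calculus)
    fix y :: real
    have "((\<lambda>y. arsinh (y / H)) has_real_derivative 1 / sqrt ((y / H)\<^sup>2 + 1) * (1 / H)) (at y within {-pi..pi})"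
      by (rule DERIV_chain2[OF arsinh_real_has_field_derivative]) (use H in \<open>auto intro!: derivative_eq_intros\<close>)
    moreover have "1 / sqrt ((y / H)\<^sup>2 + 1) * (1 / H) = 1 / sqrt (H\<^sup>2 + y\<^sup>2)"
    proof -
      have "(y / H)\<^sup>2 + 1 = (H\<^sup>2 + y\<^sup>2) / H\<^sup>2" using H by (simp add: field_simps)
      then show ?thesis using H by (simp add: real_sqrt_divide)
    qed
    ultimately show "((\<lambda>y. arsinh (y / H)) has_vector_derivative 1 / sqrt (H\<^sup>2 + y\<^sup>2)) (at y within {-pi..pi})"
      by (simp add: has_real_derivative_iff_has_vector_derivative)
  qed simp
  moreover have "arsinh (pi / H) \<le> ln (1 + 8 / H)"
  proof -
    have "sqrt ((pi / H)\<^sup>2 + 1) \<le> pi / H + 1"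
      by (rule real_le_lsqrt) (use H in \<open>auto simp: power2_sum\<close>)
    then have "pi / H + sqrt ((pi / H)\<^sup>2 + 1) \<le> 1 + 2 * pi / H" by simp
    also have "\<dots> \<le> 1 + 8 / H" using pi_less_4 H by (simp add: divide_right_mono)
    finally show ?thesis unfolding arsinh_real_def using H
      by (intro ln_mono) (auto intro!: add_pos_nonneg)
  qed
  moreover have "arsinh (- pi / H) = - arsinh (pi / H)" using arsinh_minus_real[of "pi / H"] by simp
  ultimately show "integral {-pi..pi} (\<lambda>y. 1 / sqrt (H\<^sup>2 + y\<^sup>2)) \<le> 2 * ln (1 + 8 / H)"
    by (simp add: integral_unique)
qed

section \<open>Diagonal and off-diagonal terms together\<close>

lemma log_plus_antimono: "0 < u \<Longrightarrow> u \<le> t \<Longrightarrow> log_plus t \<le> log_plus u"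
  unfolding log_plus_def by (auto intro!: ln_mono frac_le add_pos_nonneg)

lemma norm_sum_exp_squared:
  assumes a: "a > 0"
  shows "of_real ((norm (\<Sum>n\<in>X. of_real (c n) * exp (- of_nat n * (of_real (pi\<^sup>2) / (of_real a + \<i> * of_real y)))))\<^sup>2)
    = (\<Sum>n\<in>X. \<Sum>m\<in>X. of_real (c n * c m) * phase a n m (of_real y))"
proof -
  define w where "w = of_real (pi\<^sup>2) / (of_real a + \<i> * of_real y)"
  have cw: "cnj w = of_real (pi\<^sup>2) / (of_real a - \<i> * of_real y)" by (simp add: w_def)
  have ph: "exp (- of_nat n * w) * cnj (exp (- of_nat m * w)) = phase a n m (of_real y)" for n m
    unfolding phase_def exp_cnj exp_add[symmetric]
    by (rule arg_cong[where f = exp]) (simp add: w_def algebra_simps)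
  have "of_real ((norm (\<Sum>n\<in>X. of_real (c n) * exp (- of_nat n * w)))\<^sup>2)
    = (\<Sum>n\<in>X. of_real (c n) * exp (- of_nat n * w)) * cnj (\<Sum>m\<in>X. of_real (c m) * exp (- of_nat m * w))"
    by (rule complex_norm_square)
  also have "\<dots> = (\<Sum>n\<in>X. \<Sum>m\<in>X. of_real (c n * c m) * (exp (- of_nat n * w) * cnj (exp (- of_nat m * w))))"
    by (simp add: sum_product mult_ac cnj_sum)
  finally show ?thesis unfolding ph unfolding w_def .
qed

text \<open>Up to logarithms the weighted sums over n and m have size (a^2 + y^2)/a. On the diagonal
  this cancels the factor 1/(a^2 + y^2) and leaves the integral of 1/(H^2 + y^2), of order 1/H. Off
  the diagonal that factor has been spent on the integration by parts, and \<open>a \<le> H\<close>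
  lets 1/(H^2 + y^2) do the cancelling; the integral of \<open>V\<close> that remains is the source
  of the third logarithm.\<close>

lemma dual_mean_square_le:
  fixes a H :: real
  assumes a: "0 < a" "a \<le> H" "a \<le> 1"
  defines "L \<equiv> log_plus (a / 8)"
  shows "integral {-pi..pi} (\<lambda>y. 1 / ((H\<^sup>2 + y\<^sup>2) * (a\<^sup>2 + y\<^sup>2)) *
    (norm (\<Sum>n\<in>{1..N}. of_real (rep_count n) * exp (- of_nat n * (of_real (pi\<^sup>2) / (of_real a + \<i> * of_real y)))))\<^sup>2)
    \<le> 150000 * (L / (a * H) + L ^ 3 / a)"
proof -
  define W where "W y = 1 / (H\<^sup>2 + y\<^sup>2)" for y
  define Q where "Q y = 1 / ((H\<^sup>2 + y\<^sup>2) * (a\<^sup>2 + y\<^sup>2))" for y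
  define sg where "sg y = pi\<^sup>2 * a / (a\<^sup>2 + y\<^sup>2)" for y
  define V where "V y = 2 / sqrt (H\<^sup>2 + y\<^sup>2) + 1" for y
  define J where "J n m = integral {-pi..pi} (\<lambda>y. of_real (Q y) * phase a n m (of_real y))" for n m
  have H: "H > 0" using a by simp
  have Hy: "H\<^sup>2 + y\<^sup>2 > 0" and ay: "a\<^sup>2 + y\<^sup>2 > 0" for y using H a by (simp_all add: add_pos_nonneg)
  have QW: "Q y = W y / (a\<^sup>2 + y\<^sup>2)" for y by (simp add: Q_def W_def)
  have W: "W y > 0" "W y * (a\<^sup>2 + y\<^sup>2) \<le> 1" for y
  proof -
    show "W y > 0" using Hy by (simp add: W_def)
    have "a\<^sup>2 + y\<^sup>2 \<le> H\<^sup>2 + y\<^sup>2" using a by (simp add: power_mono)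
    then show "W y * (a\<^sup>2 + y\<^sup>2) \<le> 1" using Hy[of y] by (simp add: W_def)
  qed
  have Q: "Q y > 0" for y unfolding QW using W ay by simp
  have V: "V y \<ge> 0" for y by (simp add: V_def add_nonneg_nonneg Hy less_imp_le)
  have pi2: "pi\<^sup>2 \<ge> 4" using pi_ge_two power_mono[of 2 pi 2] by simp
  have sg: "sg y > 0" for y using a ay by (simp add: sg_def)
  \<comment> \<open>Explains the argument a/8 in \<open>L\<close>: the decay rate is at least a/2
    and is halved twice off the diagonal.\<close>
  have sg_ge: "sg y \<ge> a / 2" if "y \<in> {-pi..pi}" for y
  proof -
    have "\<bar>y\<bar>\<^sup>2 \<le> pi\<^sup>2" using that by (intro power_mono) auto
    moreover have "a\<^sup>2 \<le> 1" using a by (simp add: power_le_one)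
    ultimately have "a\<^sup>2 + y\<^sup>2 \<le> 2 * pi\<^sup>2" using pi2 by simp
    then have "pi\<^sup>2 * a / (2 * pi\<^sup>2) \<le> sg y" unfolding sg_def
      using a ay[of y] by (intro divide_left_mono) auto
    then show ?thesis by simp
  qed
  have L1: "L \<ge> 1" using a by (simp add: L_def log_plus_ge_1)
  have contQ: "continuous_on A Q" for A
    unfolding Q_def using Hy ay by (intro continuous_intros) (metis less_irrefl mult_eq_0_iff)
  have contV: "continuous_on A V" for A
    unfolding V_def using Hy by (intro continuous_intros) (metis less_irrefl real_sqrt_eq_zero_cancel_iff)
  have contW: "continuous_on A W" for A
    unfolding W_def using Hy by (intro continuous_intros) (metis less_irrefl)
  have contsg: "continuous_on A sg" for A
    unfolding sg_def using ay by (intro continuous_intros) (metis less_irrefl)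
  define I where "I = integral {-pi..pi} (\<lambda>y. Q y *
    (norm (\<Sum>n\<in>{1..N}. of_real (rep_count n) * exp (- of_nat n * (of_real (pi\<^sup>2) / (of_real a + \<i> * of_real y)))))\<^sup>2)"
  have "complex_of_real I = integral {-pi..pi} (\<lambda>y. of_real (Q y *
    (norm (\<Sum>n\<in>{1..N}. of_real (rep_count n) * exp (- of_nat n * (of_real (pi\<^sup>2) / (of_real a + \<i> * of_real y)))))\<^sup>2))"
  proof -
    have "of_real a + \<i> * of_real y \<noteq> 0" for y using a by (auto simp: complex_eq_iff)
    then show ?thesis unfolding I_def
      by (intro integral_unique[symmetric] has_integral_of_real integrable_integral integrable_continuous_real continuous_intros contQ) auto
  qed
  also have "\<dots> = integral {-pi..pi} (\<lambda>y. \<Sum>n\<in>{1..N}. \<Sum>m\<in>{1..N}. of_real (rep_count n * rep_count m) * (of_real (Q y) * phase a n m (of_real y)))"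
    unfolding of_real_mult[of "Q _"] norm_sum_exp_squared[OF a(1)] by (simp add: sum_distrib_left mult_ac)
  also have "\<dots> = (\<Sum>n\<in>{1..N}. \<Sum>m\<in>{1..N}. of_real (rep_count n * rep_count m) * J n m)"
    unfolding J_def integral_mult_right[symmetric]
    by (subst integral_sum integral_sum[OF finite_atLeastAtMost] | (intro sum.cong refl integrable_sum integrable_continuous_real continuous_intros continuous_on_phase contQ a; simp))+
  finally have "I \<le> norm (\<Sum>n\<in>{1..N}. \<Sum>m\<in>{1..N}. of_real (rep_count n * rep_count m) * J n m)"
    by (metis norm_of_real abs_ge_self)
  also have "\<dots> \<le> (\<Sum>n\<in>{1..N}. \<Sum>m\<in>{1..N}. rep_count n * rep_count m * norm (J n m))"
    by (intro sum_norm_le) (simp add: norm_mult rep_nonneg)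
  also have "\<dots> = (\<Sum>n\<in>{1..N}. (rep_count n)\<^sup>2 * norm (J n n) + (\<Sum>m\<in>{1..N} - {n}. rep_count n * rep_count m * norm (J n m)))"
    by (intro sum.cong refl) (subst sum.remove, auto simp: power2_eq_square)
  also have "\<dots> = (\<Sum>n\<in>{1..N}. (rep_count n)\<^sup>2 * norm (J n n)) + (\<Sum>n\<in>{1..N}. \<Sum>m\<in>{1..N} - {n}. rep_count n * rep_count m * norm (J n m))"
    by (rule sum.distrib)
  also have "(\<Sum>n\<in>{1..N}. (rep_count n)\<^sup>2 * norm (J n n)) \<le> 2700 * L / (a * H)"
  proof -
    have intd: "(\<lambda>y. Q y * exp (- sg y * real (n + n))) integrable_on {-pi..pi}" for n
      by (intro integrable_continuous_real continuous_intros contQ contsg)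
    have "norm (J n n) \<le> integral {-pi..pi} (\<lambda>y. Q y * exp (- sg y * real (n + n)))" for n
      unfolding J_def
    proof (rule integral_norm_bound_integral)
      show "(\<lambda>y. of_real (Q y) * phase a n n (of_real y)) integrable_on {-pi..pi}"
        by (intro integrable_continuous_real continuous_intros continuous_on_phase contQ a)
      show "norm (of_real (Q y) * phase a n n (of_real y)) \<le> Q y * exp (- sg y * real (n + n))" for y
        unfolding norm_mult norm_phase[OF a(1)] sg_def using Q[of y] by simp
    qed (rule intd)
    then have "(\<Sum>n\<in>{1..N}. (rep_count n)\<^sup>2 * norm (J n n)) \<le> (\<Sum>n\<in>{1..N}. (rep_count n)\<^sup>2 * integral {-pi..pi} (\<lambda>y. Q y * exp (- sg y * real (n + n))))"
      by (intro sum_mono mult_left_mono) auto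
    also have "\<dots> = integral {-pi..pi} (\<lambda>y. \<Sum>n\<in>{1..N}. (rep_count n)\<^sup>2 * (Q y * exp (- sg y * real (n + n))))"
      unfolding integral_mult_right[symmetric] by (intro integral_sum[symmetric] integrable_on_mult_right intd) simp
    also have "\<dots> \<le> integral {-pi..pi} (\<lambda>y. 675 * L / a * (1 / (H\<^sup>2 + y\<^sup>2)))"
    proof (rule integral_le)
      fix y assume y: "y \<in> {-pi..pi}"
      have "(\<Sum>n\<in>{1..N}. (rep_count n)\<^sup>2 * (Q y * exp (- sg y * real (n + n)))) = Q y * (\<Sum>n\<in>{1..N}. (rep_count n)\<^sup>2 * exp (- (2 * sg y) * real n))"
        by (simp add: sum_distrib_left mult_ac)
      also have "\<dots> \<le> Q y * (5400 * log_plus (2 * sg y) / (2 * sg y))"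
        using sg[of y] Q[of y] by (intro mult_left_mono sum_rep_squared_exp_le) auto
      also have "\<dots> \<le> Q y * (5400 * L / (8 * a / (a\<^sup>2 + y\<^sup>2)))"
      proof (intro mult_left_mono, rule frac_le)
        have "log_plus (2 * sg y) \<le> L" unfolding L_def
          using sg_ge[OF y] a by (intro log_plus_antimono) auto
        then show "5400 * log_plus (2 * sg y) \<le> 5400 * L" by simp
        have "2 * 4 * a / (a\<^sup>2 + y\<^sup>2) \<le> 2 * pi\<^sup>2 * a / (a\<^sup>2 + y\<^sup>2)"
          using pi2 a ay[of y] by (intro divide_right_mono mult_right_mono mult_left_mono) auto
        then show "8 * a / (a\<^sup>2 + y\<^sup>2) \<le> 2 * sg y" by (simp add: sg_def)
      qed (use a ay[of y] L1 Q[of y] in auto)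
      also have "\<dots> = 675 * L / a * (1 / (H\<^sup>2 + y\<^sup>2))"
        using ay[of y] by (simp add: QW W_def)
      finally show "(\<Sum>n\<in>{1..N}. (rep_count n)\<^sup>2 * (Q y * exp (- sg y * real (n + n)))) \<le> 675 * L / a * (1 / (H\<^sup>2 + y\<^sup>2))" .
    next
      show "(\<lambda>y. 675 * L / a * (1 / (H\<^sup>2 + y\<^sup>2))) integrable_on {-pi..pi}"
        using integrable_on_mult_right[OF integrable_continuous_real[OF contW], of "675 * L / a"] by (simp only: W_def)
    qed (intro integrable_sum integrable_on_mult_right intd, simp)
    also have "\<dots> = 675 * L / a * integral {-pi..pi} (\<lambda>y. 1 / (H\<^sup>2 + y\<^sup>2))"
      by (rule integral_mult_right)
    also have "\<dots> \<le> 675 * L / a * (pi / H)"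
      using a L1 by (intro mult_left_mono kernel_integral_le H) auto
    also have "\<dots> \<le> 675 * L / a * (4 / H)"
      using a L1 H pi_less_4 by (intro mult_left_mono divide_right_mono) auto
    finally show ?thesis by simp
  qed
  also have "(\<Sum>n\<in>{1..N}. \<Sum>m\<in>{1..N} - {n}. rep_count n * rep_count m * norm (J n m)) \<le> 140400 * L ^ 3 / a"
  proof -
    define X where "X t n m = rep_count n * rep_count m * exp (- t * real (n + m)) / \<bar>real n - real m\<bar>" for t n m
    have intX: "(\<lambda>y. V y * W y * X (sg y / 2) n m) integrable_on {-pi..pi}" if "n \<noteq> m" for n m
      unfolding X_def using that
      by (intro integrable_continuous_real continuous_intros contV contW contsg) auto
    have S: "(\<Sum>n\<in>{1..N}. \<Sum>m\<in>{1..N} - {n}. X (sg y / 2) n m) * W y \<le> 10800 * L\<^sup>2 / a" if y: "y \<in> {-pi..pi}" for y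
    proof -
      have "(\<Sum>n\<in>{1..N}. \<Sum>m\<in>{1..N} - {n}. X (sg y / 2) n m) \<le> 21600 * (log_plus (sg y / 2 / 2))\<^sup>2 / (sg y / 2)"
        unfolding X_def by (rule sum_rep_off_diagonal_le) (use sg[of y] in simp)
      also have "\<dots> \<le> 21600 * L\<^sup>2 / (2 * a / (a\<^sup>2 + y\<^sup>2))"
      proof (rule frac_le)
        have "log_plus (sg y / 2 / 2) \<le> L" unfolding L_def
          using sg_ge[OF y] a by (intro log_plus_antimono) auto
        moreover have "0 \<le> log_plus (sg y / 2 / 2)" using log_plus_ge_1[of "sg y / 2 / 2"] sg[of y] by simp
        ultimately show "21600 * (log_plus (sg y / 2 / 2))\<^sup>2 \<le> 21600 * L\<^sup>2" by (simp add: power_mono)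
        have "4 / 2 * a / (a\<^sup>2 + y\<^sup>2) \<le> pi\<^sup>2 / 2 * a / (a\<^sup>2 + y\<^sup>2)"
          using pi2 a ay[of y] by (intro divide_right_mono mult_right_mono) auto
        moreover have "pi\<^sup>2 / 2 * a / q = pi\<^sup>2 * a / q / 2" "4 / 2 * a / q = 2 * a / q" for q by simp_all
        ultimately show "2 * a / (a\<^sup>2 + y\<^sup>2) \<le> sg y / 2" by (simp only: sg_def)
      qed (use a ay[of y] in auto)
      also have "\<dots> = 10800 * L\<^sup>2 / a * (a\<^sup>2 + y\<^sup>2)" by simp
      finally have "(\<Sum>n\<in>{1..N}. \<Sum>m\<in>{1..N} - {n}. X (sg y / 2) n m) * W y \<le> 10800 * L\<^sup>2 / a * (a\<^sup>2 + y\<^sup>2) * W y"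
        using W(1)[of y] by (intro mult_right_mono) auto
      also have "\<dots> = 10800 * L\<^sup>2 / a * (W y * (a\<^sup>2 + y\<^sup>2))" by (simp only: mult_ac)
      also have "\<dots> \<le> 10800 * L\<^sup>2 / a" using W(2)[of y] a by (intro mult_left_le) auto
      finally show ?thesis .
    qed
    have J: "rep_count n * rep_count m * norm (J n m) \<le> W pi * X (sg pi / 2) n m + integral {-pi..pi} (\<lambda>y. V y * W y * X (sg y / 2) n m)"
      if nm: "m \<in> {1..N} - {n}" for n m
    proof -
      have "n \<noteq> m" using nm by auto
      have "rep_count n * rep_count m * norm (J n m) \<le> rep_count n * rep_count m * ((1 / (H\<^sup>2 + pi\<^sup>2) * exp (- (pi\<^sup>2 * a / (a\<^sup>2 + pi\<^sup>2) / 2) * real (n + m))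
       + integral {-pi..pi} (\<lambda>y. (2 / sqrt (H\<^sup>2 + y\<^sup>2) + 1) / (H\<^sup>2 + y\<^sup>2) * exp (- (pi\<^sup>2 * a / (a\<^sup>2 + y\<^sup>2) / 2) * real (n + m))))
        / \<bar>real n - real m\<bar>)"
        unfolding J_def Q_def using rep_nonneg
        by (intro mult_left_mono off_diagonal_integral_le a H \<open>n \<noteq> m\<close>) auto
      also have "\<dots> = W pi * X (sg pi / 2) n m + rep_count n * rep_count m / \<bar>real n - real m\<bar> * integral {-pi..pi} (\<lambda>y. (2 / sqrt (H\<^sup>2 + y\<^sup>2) + 1) / (H\<^sup>2 + y\<^sup>2) * exp (- (pi\<^sup>2 * a / (a\<^sup>2 + y\<^sup>2) / 2) * real (n + m)))"
        unfolding W_def X_def sg_def by (simp only: add_divide_distrib distrib_left times_divide_eq_left times_divide_eq_right mult_ac mult_1_left mult_1_right)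
      also have "rep_count n * rep_count m / \<bar>real n - real m\<bar> * integral {-pi..pi} (\<lambda>y. (2 / sqrt (H\<^sup>2 + y\<^sup>2) + 1) / (H\<^sup>2 + y\<^sup>2) * exp (- (pi\<^sup>2 * a / (a\<^sup>2 + y\<^sup>2) / 2) * real (n + m)))
        = integral {-pi..pi} (\<lambda>y. V y * W y * X (sg y / 2) n m)"
        unfolding integral_mult_right[symmetric] V_def W_def X_def sg_def
        by (rule arg_cong[where f = "integral _"]) (simp only: mult_ac times_divide_eq_left times_divide_eq_right divide_divide_eq_left mult_1_left)
      finally show ?thesis .
    qed
    have add_mult: "c + c * (8 + 4 * L) = c * (9 + 4 * L)" for c :: real by (simp add: algebra_simps)
    have intV: "integral {-pi..pi} V \<le> 8 + 4 * L"
    proof -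
      have contr: "(\<lambda>y. 1 / sqrt (H\<^sup>2 + y\<^sup>2)) integrable_on {-pi..pi}"
        using Hy by (intro integrable_continuous_real continuous_intros) (metis less_irrefl real_sqrt_eq_zero_cancel_iff)
      have "integral {-pi..pi} V = integral {-pi..pi} (\<lambda>y. 2 * (1 / sqrt (H\<^sup>2 + y\<^sup>2)) + 1)"
        by (simp add: V_def[abs_def])
      also have "\<dots> = 2 * integral {-pi..pi} (\<lambda>y. 1 / sqrt (H\<^sup>2 + y\<^sup>2)) + 2 * pi"
        using contr by (subst integral_add) (auto intro!: integrable_on_mult_right simp del: times_divide_eq_right)
      also have "\<dots> \<le> 2 * (2 * ln (1 + 8 / H)) + 2 * 4"
        using kernel_integral_le(2)[OF H] pi_less_4 by simp
      also have "ln (1 + 8 / H) \<le> ln (1 + 8 / a)"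
        using a by (intro ln_mono add_left_mono divide_left_mono) (auto intro!: add_pos_nonneg)
      also have "\<dots> \<le> L" by (simp add: L_def log_plus_def)
      finally show ?thesis by simp
    qed
    have "(\<Sum>n\<in>{1..N}. \<Sum>m\<in>{1..N} - {n}. rep_count n * rep_count m * norm (J n m)) \<le>
      (\<Sum>n\<in>{1..N}. \<Sum>m\<in>{1..N} - {n}. W pi * X (sg pi / 2) n m + integral {-pi..pi} (\<lambda>y. V y * W y * X (sg y / 2) n m))"
      by (intro sum_mono J)
    also have "\<dots> = (\<Sum>n\<in>{1..N}. \<Sum>m\<in>{1..N} - {n}. X (sg pi / 2) n m) * W pi + (\<Sum>n\<in>{1..N}. \<Sum>m\<in>{1..N} - {n}. integral {-pi..pi} (\<lambda>y. V y * W y * X (sg y / 2) n m))"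
      by (simp only: sum.distrib sum_distrib_left[symmetric] mult.commute)
    also have "(\<Sum>n\<in>{1..N}. \<Sum>m\<in>{1..N} - {n}. integral {-pi..pi} (\<lambda>y. V y * W y * X (sg y / 2) n m))
      = (\<Sum>n\<in>{1..N}. integral {-pi..pi} (\<lambda>y. \<Sum>m\<in>{1..N} - {n}. V y * W y * X (sg y / 2) n m))"
      by (intro sum.cong refl integral_sum[symmetric] intX) auto
    also have "\<dots> = integral {-pi..pi} (\<lambda>y. \<Sum>n\<in>{1..N}. \<Sum>m\<in>{1..N} - {n}. V y * W y * X (sg y / 2) n m)"
      by (intro integral_sum[symmetric] integrable_sum intX) auto
    also have "\<dots> \<le> integral {-pi..pi} (\<lambda>y. 10800 * L\<^sup>2 / a * V y)"
    proof (rule integral_le)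
      fix y assume y: "y \<in> {-pi..pi}"
      have "(\<Sum>n\<in>{1..N}. \<Sum>m\<in>{1..N} - {n}. V y * W y * X (sg y / 2) n m) = V y * ((\<Sum>n\<in>{1..N}. \<Sum>m\<in>{1..N} - {n}. X (sg y / 2) n m) * W y)"
        by (simp only: sum_distrib_left sum_distrib_right mult_ac)
      also have "\<dots> \<le> V y * (10800 * L\<^sup>2 / a)" by (intro mult_left_mono S y V)
      finally show "(\<Sum>n\<in>{1..N}. \<Sum>m\<in>{1..N} - {n}. V y * W y * X (sg y / 2) n m) \<le> 10800 * L\<^sup>2 / a * V y"
        by (simp only: mult.commute)
    next
      show "(\<lambda>y. 10800 * L\<^sup>2 / a * V y) integrable_on {-pi..pi}"
        by (intro integrable_on_mult_right integrable_continuous_real contV)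
    qed (intro integrable_sum intX, auto)
    also have "\<dots> = 10800 * L\<^sup>2 / a * integral {-pi..pi} V" by (rule integral_mult_right)
    also have "\<dots> \<le> 10800 * L\<^sup>2 / a * (8 + 4 * L)" using a by (intro mult_left_mono intV) auto
    finally have "(\<Sum>n\<in>{1..N}. \<Sum>m\<in>{1..N} - {n}. rep_count n * rep_count m * norm (J n m)) \<le> 10800 * L\<^sup>2 / a + 10800 * L\<^sup>2 / a * (8 + 4 * L)"
      using S[of pi] a by simp
    also have "\<dots> = 10800 * L\<^sup>2 / a * (9 + 4 * L)" by (rule add_mult)
    also have "\<dots> \<le> 10800 * L\<^sup>2 / a * (13 * L)" using L1 a by (intro mult_left_mono) auto
    finally show ?thesis by (simp add: power2_eq_square power3_eq_cube)
  qed
  also have "2700 * L / (a * H) + 140400 * L ^ 3 / a \<le> 150000 * (L / (a * H) + L ^ 3 / a)"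
    using a L1 by (simp add: field_simps)
  finally show ?thesis unfolding I_def Q_def by simp
qed

section \<open>The mean square of block sums\<close>

lemma sin_ge_half:
  assumes "0 \<le> t" "t \<le> pi / 2"
  shows "t / 2 \<le> sin t"
proof (cases "t \<le> pi / 3")
  case True
  show ?thesis
  proof (cases "t = 0")
    case False
    then have t: "0 < t" using assms by simp
    obtain z where z: "0 < z" "z < t" "sin t - sin 0 = (t - 0) * cos z"
      using MVT2[OF t, of sin cos] by (auto intro: DERIV_sin)
    have "cos (pi / 3) \<le> cos z" using z True by (intro cos_monotone_0_pi_le) auto
    then have "1 / 2 \<le> cos z" by (simp add: cos_60)
    then have "t * (1 / 2) \<le> t * cos z" using t by (intro mult_left_mono) auto
    then show ?thesis using z by simp
  qed simp
next
  case False
  have "sin (pi / 3) \<le> sin t" using False assms by (intro sin_monotone_2pi_le) auto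
  then have "sqrt 3 / 2 \<le> sin t" by (simp add: sin_60)
  moreover have "1.6 \<le> sqrt 3" by (rule real_le_rsqrt) (simp add: power2_eq_square)
  moreover have "t \<le> 1.6" using assms pi_approx by simp
  ultimately show ?thesis by simp
qed

lemma norm_one_minus_cis_ge:
  assumes "\<bar>y\<bar> \<le> pi"
  shows "\<bar>y\<bar> / 2 \<le> norm (1 - exp (\<i> * of_real y))"
proof -
  have "1 - cos y = 2 * (sin (\<bar>y\<bar> / 2))\<^sup>2"
    using cos_double_sin[of "\<bar>y\<bar> / 2"] cos_abs_real[of y] by simp
  moreover have "(norm (1 - exp (\<i> * of_real y)))\<^sup>2 = 2 * (1 - cos y)"
    unfolding cmod_power2 by (simp add: Re_exp Im_exp power2_eq_square algebra_simps)
  ultimately have "(norm (1 - exp (\<i> * of_real y)))\<^sup>2 = (2 * sin (\<bar>y\<bar> / 2))\<^sup>2" by (simp add: power_mult_distrib)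
  moreover have "\<bar>y\<bar> / 2 / 2 \<le> sin (\<bar>y\<bar> / 2)" using assms by (intro sin_ge_half) auto
  moreover have "sin (\<bar>y\<bar> / 2) \<ge> 0" using assms by (intro sin_ge_zero) auto
  ultimately have "norm (1 - exp (\<i> * of_real y)) = 2 * sin (\<bar>y\<bar> / 2)"
    using power2_eq_imp_eq[of "norm (1 - exp (\<i> * of_real y))" "2 * sin (\<bar>y\<bar> / 2)"] by simp
  then show ?thesis using \<open>\<bar>y\<bar> / 2 / 2 \<le> sin (\<bar>y\<bar> / 2)\<close> by simp
qed

text \<open>In this rectangle s = 0 is the only zero of 1 - e^(-s), and quantitatively |1 - e^(-s)|
  \<ge> |s|/4. The numerator 1 - e^(-s) - s is at most 3|s|^2 by Taylor, and \<pi> < 4 gives 4 * 3 *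
  4 = 48.\<close>

lemma pole_difference_bound:
  fixes s :: complex
  assumes "0 < Re s" "Re s \<le> 1" "\<bar>Im s\<bar> \<le> pi"
  shows "norm (of_real pi / s - of_real pi / (1 - exp (- s))) \<le> 48"
proof -
  define a where "a = Re s"
  define y where "y = Im s"
  have a: "0 < a" "a \<le> 1" and y: "\<bar>y\<bar> \<le> pi" using assms by (auto simp: a_def y_def)
  have s: "s = of_real a + \<i> * of_real y" by (simp add: a_def y_def complex_eq)
  have s0: "s \<noteq> 0" using assms by auto
  have e1: "exp (- a) \<ge> 1 / 3"
  proof -
    have "exp (-1) \<le> exp (- a)" using a by simp
    moreover have "exp (-1) \<ge> 1 / (3::real)" using exp_le by (simp add: exp_minus field_simps)
    ultimately show ?thesis by linarith
  qed
  have e2: "1 - exp (- a) \<ge> a / 2"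
  proof -
    have "exp (- a) \<le> 1 / (1 + a)" using a exp_ge_add_one_self[of a] by (simp add: exp_minus field_simps)
    moreover have "1 / (1 + a) \<le> 1 - a / 2"
    proof -
      have "1 \<le> (1 - a / 2) * (1 + a)" using mult_nonneg_nonneg[of a "1 - a"] a by (simp add: algebra_simps)
      then show ?thesis using a by (simp add: divide_le_eq)
    qed
    ultimately show ?thesis by linarith
  qed
  \<comment> \<open>For r = e^(-a), the identity |1 - r e^(iy)|^2 = (1 - r)^2 + r |1 - e^(iy)|^2
    separates the radial from the angular part; the sign of y does not matter.\<close>
  have sq: "(norm (1 - exp (- s)))\<^sup>2 = (1 - exp (- a))\<^sup>2 + exp (- a) * (norm (1 - exp (\<i> * of_real y)))\<^sup>2"
    unfolding cmod_power2
    by (simp add: a_def[symmetric] y_def[symmetric] Re_exp Im_exp power2_eq_square algebra_simps)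
      (use sin_cos_squared_add[of y] in \<open>algebra\<close>)
  have "(norm s / 4)\<^sup>2 \<le> (norm (1 - exp (- s)))\<^sup>2"
  proof -
    have "(norm s)\<^sup>2 = a\<^sup>2 + y\<^sup>2" by (simp add: cmod_power2 a_def y_def)
    then have "(norm s / 4)\<^sup>2 = a\<^sup>2 / 16 + y\<^sup>2 / 16" by (simp add: power_divide add_divide_distrib)
    also have "\<dots> \<le> (a / 2)\<^sup>2 + 1 / 3 * (\<bar>y\<bar> / 2)\<^sup>2"
    proof -
      have "(a / 2)\<^sup>2 + 1 / 3 * (\<bar>y\<bar> / 2)\<^sup>2 = a\<^sup>2 / 4 + y\<^sup>2 / 12" by (simp add: power_divide)
      moreover have "a\<^sup>2 \<ge> 0" "y\<^sup>2 \<ge> 0" by simp_all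
      ultimately show ?thesis by linarith
    qed
    also have "\<dots> \<le> (1 - exp (- a))\<^sup>2 + exp (- a) * (norm (1 - exp (\<i> * of_real y)))\<^sup>2"
      using e1 e2 a norm_one_minus_cis_ge[OF y] by (intro add_mono mult_mono power_mono) auto
    finally show ?thesis unfolding sq .
  qed
  then have low: "norm s / 4 \<le> norm (1 - exp (- s))" by (rule power2_le_imp_le) simp
  then have n0: "1 - exp (- s) \<noteq> 0" using s0 by auto
  have up: "norm (1 - exp (- s) - s) \<le> 3 * (norm s)\<^sup>2"
  proof -
    have "norm (exp (- s) - (\<Sum>k\<le>1. (- s) ^ k / fact k)) \<le> exp \<bar>Re (- s)\<bar> * norm (- s) ^ Suc 1 / fact 1"
      by (rule Taylor_exp)
    also have "exp \<bar>Re (- s)\<bar> \<le> 3" using a exp_le by (simp add: a_def[symmetric]) (metis exp_le_cancel_iff order_trans)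
    finally have "norm (exp (- s) - (1 - s)) \<le> 3 * (norm s)\<^sup>2" by (simp add: numeral_2_eq_2 mult_right_mono)
    moreover have "norm (1 - exp (- s) - s) = norm (exp (- s) - (1 - s))" by (metis diff_diff_eq diff_diff_eq2 norm_minus_commute diff_add_eq diff_add_eq_diff_diff_swap add.commute)
    ultimately show ?thesis by simp
  qed
  have "of_real pi / s - of_real pi / (1 - exp (- s)) = of_real pi * (1 - exp (- s) - s) / (s * (1 - exp (- s)))"
    using s0 n0 by (simp add: field_simps)
  then have "norm (of_real pi / s - of_real pi / (1 - exp (- s))) = pi * norm (1 - exp (- s) - s) / (norm s * norm (1 - exp (- s)))"
    by (simp add: norm_mult norm_divide)
  also have "\<dots> \<le> 4 * (3 * (norm s)\<^sup>2) / (norm s * (norm s / 4))"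
    using s0 low up pi_less_4 by (intro frac_le mult_mono) auto
  also have "\<dots> = 48" using s0 by (simp add: power2_eq_square)
  finally show ?thesis .
qed

text \<open>The kernel is at most h trivially and at most 4/|y| as a geometric sum; squared and
  added, the two bounds give 1 + 16 = 17.\<close>

lemma geometric_cis_kernel_bound:
  assumes y: "\<bar>y\<bar> \<le> pi" and h: "h > 0"
  shows "(norm (\<Sum>k<h. exp (\<i> * of_real y) ^ k))\<^sup>2 \<le> 17 / ((1 / real h)\<^sup>2 + y\<^sup>2)"
proof -
  define K where "K = norm (\<Sum>k<h. exp (\<i> * of_real y) ^ k)"
  have 1: "K \<le> real h"
    unfolding K_def by (rule order_trans[OF norm_sum]) (simp add: norm_power)
  have "(1 - exp (\<i> * of_real y)) * (\<Sum>k<h. exp (\<i> * of_real y) ^ k) = 1 - exp (\<i> * of_real y) ^ h"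
    by (rule one_diff_power_eq[symmetric])
  then have "norm (1 - exp (\<i> * of_real y)) * K = norm (1 - exp (\<i> * of_real y) ^ h)"
    unfolding K_def norm_mult[symmetric] by simp
  also have "\<dots> \<le> 2" by (rule order_trans[OF norm_triangle_ineq4]) (simp add: norm_power)
  finally have "\<bar>y\<bar> / 2 * K \<le> 2"
    using mult_right_mono[OF norm_one_minus_cis_ge[OF y], of K] by (simp add: K_def)
  then have "(\<bar>y\<bar> * K)\<^sup>2 \<le> 4\<^sup>2" by (intro power_mono) (auto simp: K_def)
  moreover have "(K / real h)\<^sup>2 \<le> 1\<^sup>2" using 1 h by (intro power_mono) (auto simp: K_def)
  ultimately have "K\<^sup>2 * ((1 / real h)\<^sup>2 + y\<^sup>2) \<le> 17"
    by (simp add: power_mult_distrib power_divide algebra_simps)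
  moreover have "(1 / real h)\<^sup>2 + y\<^sup>2 > 0" using h by (simp add: add_pos_nonneg)
  ultimately show ?thesis unfolding K_def[symmetric] by (simp add: pos_le_divide_eq)
qed

text \<open>Stated over a general field because it is used twice: at complex z for the value of the
  square of theta, at real z for absolute summability.\<close>

lemma rep_cauchy_product:
  fixes z :: "'a::{banach,real_normed_field}"
  shows "(\<Sum>i\<le>n. of_real (square_weight i) * z ^ i * (of_real (square_weight (n - i)) * z ^ (n - i))) = of_real (rep_count n) * z ^ n"
proof -
  have "of_real (square_weight i) * z ^ i * (of_real (square_weight (n - i)) * z ^ (n - i)) =
    of_real (square_weight i * square_weight (n - i)) * z ^ n" if "i \<le> n" for i
    using that power_add[of z i "n - i"] by (simp add: mult_ac)
  then have "(\<Sum>i\<le>n. of_real (square_weight i) * z ^ i * (of_real (square_weight (n - i)) * z ^ (n - i)))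
      = (\<Sum>i\<le>n. of_real (square_weight i * square_weight (n - i)) * z ^ n)"
    by (intro sum.cong refl) auto
  then show ?thesis unfolding rep_count_def of_real_sum sum_distrib_right .
qed

lemma theta_squared_sums:
  assumes "Re s > 0"
  shows "(\<lambda>n. of_real (rep_count n) * exp (- s) ^ n) sums (theta s)\<^sup>2"
    and "summable (\<lambda>n. norm (of_real (rep_count n) * exp (- s) ^ n))"
proof -
  show "(\<lambda>n. of_real (rep_count n) * exp (- s) ^ n) sums (theta s)\<^sup>2"
    using Cauchy_product_sums[OF summable_theta[OF assms] summable_theta[OF assms]]
    unfolding rep_cauchy_product theta_def power2_eq_square .
  have sw: "summable (\<lambda>n. norm (square_weight n * exp (- Re s) ^ n))"
    using summable_theta[OF assms] by (simp add: norm_mult norm_power abs_mult)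
  have "summable (\<lambda>n. rep_count n * exp (- Re s) ^ n)"
    using summable_Cauchy_product[OF sw sw] rep_cauchy_product[where z = "exp (- Re s)"] by simp
  then show "summable (\<lambda>n. norm (of_real (rep_count n) * exp (- s) ^ n))"
    by (simp add: norm_mult norm_power rep_nonneg)
qed

lemma rep_0: "rep_count 0 = 1" by (simp add: rep_count_def square_weight_def)

text \<open>The bound for finite sums does not depend on N, so it survives dominated convergence.
  Subtracting 1 removes the term n = 0.\<close>

lemma theta_dual_mean_square_le:
  fixes a H :: real
  assumes a: "0 < a" "a \<le> H" "a \<le> 1"
  defines "G \<equiv> \<lambda>y. (theta (of_real (pi\<^sup>2) / (of_real a + \<i> * of_real y)))\<^sup>2 - 1"
  shows "(\<lambda>y. 1 / ((H\<^sup>2 + y\<^sup>2) * (a\<^sup>2 + y\<^sup>2)) * (norm (G y))\<^sup>2) integrable_on {-pi..pi}"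
    and "integral {-pi..pi} (\<lambda>y. 1 / ((H\<^sup>2 + y\<^sup>2) * (a\<^sup>2 + y\<^sup>2)) * (norm (G y))\<^sup>2)
      \<le> 150000 * (log_plus (a / 8) / (a * H) + log_plus (a / 8) ^ 3 / a)"
proof -
  define w where "w y = of_real (pi\<^sup>2) / (of_real a + \<i> * of_real y)" for y
  define g where "g N y = (\<Sum>n\<in>{1..N}. of_real (rep_count n) * exp (- of_nat n * w y))" for N y
  define Q where "Q y = 1 / ((H\<^sup>2 + y\<^sup>2) * (a\<^sup>2 + y\<^sup>2))" for y
  define t where "t = pi\<^sup>2 * a / (a\<^sup>2 + pi\<^sup>2)"
  have H: "H > 0" using a by simp
  have Hy: "H\<^sup>2 + y\<^sup>2 > 0" and ay: "a\<^sup>2 + y\<^sup>2 > 0" for y using H a by (simp_all add: add_pos_nonneg)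
  have Q: "Q y \<ge> 0" for y using Hy ay by (simp add: Q_def less_imp_le)
  have contQ: "continuous_on A Q" for A
    unfolding Q_def using Hy ay by (intro continuous_intros) (metis less_irrefl mult_eq_0_iff)
  have t: "t > 0" using a ay[of pi] by (simp add: t_def)
  have nz: "of_real a + \<i> * of_real y \<noteq> 0" for y using a by (auto simp: complex_eq_iff)
  have contw: "continuous_on A w" for A unfolding w_def using nz by (intro continuous_intros) auto
  have Rew: "Re (w y) = pi\<^sup>2 * a / (a\<^sup>2 + y\<^sup>2)" for y by (simp add: w_def Re_divide flip: of_real_power)
  have Rew_pos: "Re (w y) > 0" for y unfolding Rew using a ay by simp
  have Rew_ge: "Re (w y) \<ge> t" if "y \<in> {-pi..pi}" for y
  proof -
    have "\<bar>y\<bar>\<^sup>2 \<le> pi\<^sup>2" using that by (intro power_mono) auto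
    then show ?thesis unfolding Rew t_def using a ay[of y] ay[of pi] by (intro divide_left_mono) auto
  qed
  have ex: "exp (- of_nat n * w y) = exp (- w y) ^ n" for n y by (simp add: exp_of_nat_mult[symmetric])
  have lim: "(\<lambda>N. g N y) \<longlonglongrightarrow> G y" for y
  proof -
    have "(\<lambda>N. (\<Sum>n<Suc N. of_real (rep_count n) * exp (- w y) ^ n) - 1) \<longlonglongrightarrow> (theta (w y))\<^sup>2 - 1"
      by (intro tendsto_intros LIMSEQ_Suc theta_squared_sums(1)[OF Rew_pos, unfolded sums_def])
    moreover have "(\<Sum>n<Suc N. of_real (rep_count n) * exp (- w y) ^ n) - 1 = g N y" for N
    proof -
      have "{..<Suc N} = insert 0 {1..N}" by auto
      then show ?thesis unfolding g_def ex by (simp add: rep_0)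
    qed
    ultimately show ?thesis by (simp add: G_def w_def)
  qed
  have sr: "summable (\<lambda>n. rep_count n * exp (- t) ^ n)"
    using theta_squared_sums(2)[of "of_real t"] t by (simp add: norm_mult norm_power rep_nonneg)
  \<comment> \<open>The majorant may depend on a in any way; it only has to be uniform in N and y.
    The rate \<open>t\<close> is the value of Re w at the ends \<plusminus>\<pi>, where it is
    smallest.\<close>
  define B where "B = (\<Sum>n. rep_count n * exp (- t) ^ n)"
  have gB: "norm (g N y) \<le> B" if y: "y \<in> {-pi..pi}" for N y
  proof -
    have "norm (g N y) \<le> (\<Sum>n\<in>{1..N}. rep_count n * exp (- t) ^ n)"
      unfolding g_def ex
    proof (rule sum_norm_le)
      fix n
      have "exp (- Re (w y)) ^ n \<le> exp (- t) ^ n" using Rew_ge[OF y] by (intro power_mono) auto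
      then show "norm (of_real (rep_count n) * exp (- w y) ^ n) \<le> rep_count n * exp (- t) ^ n"
        using rep_nonneg by (simp add: norm_mult norm_power mult_left_mono)
    qed
    also have "\<dots> \<le> B" unfolding B_def by (rule sum_le_suminf[OF sr]) (auto simp: rep_nonneg)
    finally show ?thesis .
  qed
  have int: "(\<lambda>y. Q y * (norm (g N y))\<^sup>2) integrable_on {-pi..pi}" for N
    unfolding g_def by (intro integrable_continuous_real continuous_intros contQ contw)
  have bound: "norm (Q y * (norm (g N y))\<^sup>2) \<le> Q y * B\<^sup>2" if "y \<in> {-pi..pi}" for N y
    using Q[of y] gB[OF that, of N] by (simp add: mult_left_mono power_mono)
  have Bint: "(\<lambda>y. Q y * B\<^sup>2) integrable_on {-pi..pi}"
    by (intro integrable_continuous_real continuous_intros contQ)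
  have conv: "(\<lambda>N. Q y * (norm (g N y))\<^sup>2) \<longlonglongrightarrow> Q y * (norm (G y))\<^sup>2" for y
    by (intro tendsto_intros lim)
  note dc = dominated_convergence[OF int Bint bound conv]
  show "(\<lambda>y. 1 / ((H\<^sup>2 + y\<^sup>2) * (a\<^sup>2 + y\<^sup>2)) * (norm (G y))\<^sup>2) integrable_on {-pi..pi}"
    using dc(1) unfolding Q_def .
  show "integral {-pi..pi} (\<lambda>y. 1 / ((H\<^sup>2 + y\<^sup>2) * (a\<^sup>2 + y\<^sup>2)) * (norm (G y))\<^sup>2)
      \<le> 150000 * (log_plus (a / 8) / (a * H) + log_plus (a / 8) ^ 3 / a)"
  proof -
    have "(\<lambda>N. integral {-pi..pi} (\<lambda>y. 1 / ((H\<^sup>2 + y\<^sup>2) * (a\<^sup>2 + y\<^sup>2)) * (norm (g N y))\<^sup>2))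
      \<longlonglongrightarrow> integral {-pi..pi} (\<lambda>y. 1 / ((H\<^sup>2 + y\<^sup>2) * (a\<^sup>2 + y\<^sup>2)) * (norm (G y))\<^sup>2)"
      using dc(2) unfolding Q_def .
    moreover have "integral {-pi..pi} (\<lambda>y. 1 / ((H\<^sup>2 + y\<^sup>2) * (a\<^sup>2 + y\<^sup>2)) * (norm (g N y))\<^sup>2)
      \<le> 150000 * (log_plus (a / 8) / (a * H) + log_plus (a / 8) ^ 3 / a)" for N
      unfolding g_def w_def by (rule dual_mean_square_le[OF a])
    ultimately show ?thesis by (intro LIMSEQ_le_const2) auto
  qed
qed

section \<open>Fourier coefficients and Bessel's inequality\<close>

lemma cis_integral:
  fixes k :: int
  shows "((\<lambda>y. exp (\<i> * of_int k * of_real y)) has_integral (if k = 0 then 2 * of_real pi else 0)) {-pi..pi}"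
proof (cases "k = 0")
  case True
  then show ?thesis using has_integral_const_real[of "1::complex" "-pi" pi] by (simp add: scaleR_conv_of_real)
next
  case False
  define F where "F y = exp (\<i> * of_int k * of_real y) / (\<i> * of_int k)" for y :: real
  have "((\<lambda>y. exp (\<i> * of_int k * of_real y)) has_integral (F pi - F (- pi))) {-pi..pi}"
  proof (rule fundamental_theorem_of_calculus)
    fix y :: real
    have "((\<lambda>z. exp (\<i> * of_int k * z) / (\<i> * of_int k)) has_field_derivative exp (\<i> * of_int k * of_real y)) (at (of_real y))"
      using False by (auto intro!: derivative_eq_intros)
    from has_vector_derivative_real_field[OF this]
    show "(F has_vector_derivative exp (\<i> * of_int k * of_real y)) (at y within {-pi..pi})"
      by (simp add: F_def[abs_def])
  qed simp
  moreover have "F pi = F (- pi)"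
  proof -
    have "exp (\<i> * of_int k * of_real pi) = exp (\<i> * of_int k * of_real (- pi) + of_int (2 * k) * of_real pi * \<i>)"
      by (rule arg_cong[where f = exp]) (simp add: algebra_simps)
    also have "\<dots> = exp (\<i> * of_int k * of_real (- pi))"
      by (rule exp_eq[THEN iffD2]) (auto intro!: exI[of _ k])
    finally show ?thesis by (simp add: F_def)
  qed
  ultimately show ?thesis using False by simp
qed

lemma cis_orthogonal:
  "((\<lambda>y. exp (- (\<i> * of_nat n * of_real y)) * exp (\<i> * of_nat m * of_real y)) has_integral
    (if n = m then 2 * of_real pi else 0)) {-pi..pi}"
proof -
  have "exp (- (\<i> * of_nat n * of_real y)) * exp (\<i> * of_nat m * of_real y) = exp (\<i> * of_int (int m - int n) * of_real y)" for y
    unfolding exp_add[symmetric] by (rule arg_cong[where f = exp]) (simp add: algebra_simps)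
  moreover have "(int m - int n = 0) = (n = m)" by auto
  ultimately show ?thesis using cis_integral[of "int m - int n"] by (simp only:)
qed

text \<open>Integrate |F - P|^2 \<ge> 0 for the trigonometric polynomial P with the prescribed
  coefficients: the cross term and the square of P have the same integral S.\<close>

lemma bessel_inequality:
  fixes F :: "real \<Rightarrow> complex" and b :: "nat \<Rightarrow> real"
  assumes F: "continuous_on {-pi..pi} F" and M: "finite M"
    and coeff: "\<And>m. m \<in> M \<Longrightarrow> integral {-pi..pi} (\<lambda>y. F y * exp (\<i> * of_nat m * of_real y)) = of_real (2 * pi * b m)"
  shows "2 * pi * (\<Sum>m\<in>M. (b m)\<^sup>2) \<le> integral {-pi..pi} (\<lambda>y. (norm (F y))\<^sup>2)"
proof -
  define P where "P y = (\<Sum>m\<in>M. of_real (b m) * exp (- (\<i> * of_nat m * of_real y)))" for y :: real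
  have cP: "cnj (P y) = (\<Sum>m\<in>M. of_real (b m) * exp (\<i> * of_nat m * of_real y))" for y
    by (simp add: P_def cnj_sum exp_cnj)
  have contP: "continuous_on {-pi..pi} P" unfolding P_def by (intro continuous_intros)
  have pair: "integral {-pi..pi} (\<lambda>y. f y * cnj (P y)) = of_real (2 * pi * (\<Sum>m\<in>M. (b m)\<^sup>2))"
    if f: "continuous_on {-pi..pi} f"
      and c: "\<And>m. m \<in> M \<Longrightarrow> integral {-pi..pi} (\<lambda>y. f y * exp (\<i> * of_nat m * of_real y)) = of_real (2 * pi * b m)" for f
  proof -
    have "integral {-pi..pi} (\<lambda>y. f y * cnj (P y)) = integral {-pi..pi} (\<lambda>y. \<Sum>m\<in>M. of_real (b m) * (f y * exp (\<i> * of_nat m * of_real y)))"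
      unfolding cP sum_distrib_left by (simp only: mult_ac)
    also have "\<dots> = (\<Sum>m\<in>M. integral {-pi..pi} (\<lambda>y. of_real (b m) * (f y * exp (\<i> * of_nat m * of_real y))))"
      by (intro integral_sum M integrable_continuous_real continuous_intros f)
    also have "\<dots> = (\<Sum>m\<in>M. of_real (b m) * of_real (2 * pi * b m))"
      by (intro sum.cong refl) (simp only: integral_mult_right c)
    finally show ?thesis by (simp add: sum_distrib_left power2_eq_square mult_ac)
  qed
  have coeffP: "integral {-pi..pi} (\<lambda>y. P y * exp (\<i> * of_nat m * of_real y)) = of_real (2 * pi * b m)" if m: "m \<in> M" for m
  proof -
    have "((\<lambda>y. \<Sum>n\<in>M. of_real (b n) * (exp (- (\<i> * of_nat n * of_real y)) * exp (\<i> * of_nat m * of_real y))) has_integral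
       (\<Sum>n\<in>M. of_real (b n) * (if n = m then 2 * of_real pi else 0))) {-pi..pi}"
      by (intro has_integral_sum M has_integral_mult_right cis_orthogonal)
    moreover have "(\<Sum>n\<in>M. of_real (b n) * (if n = m then 2 * of_real pi else 0)) = complex_of_real (2 * pi * b m)"
      using M m by (simp add: if_distrib cong: if_cong)
    ultimately show ?thesis unfolding P_def sum_distrib_right mult.assoc by (simp add: integral_unique)
  qed
  define S where "S = 2 * pi * (\<Sum>m\<in>M. (b m)\<^sup>2)"
  have FP: "integral {-pi..pi} (\<lambda>y. F y * cnj (P y)) = of_real S"
    unfolding S_def by (rule pair[OF F]) (rule coeff)
  have PP: "integral {-pi..pi} (\<lambda>y. P y * cnj (P y)) = of_real S"
    unfolding S_def by (rule pair[OF contP]) (rule coeffP)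
  have intFP: "(\<lambda>y. F y * cnj (P y)) integrable_on {-pi..pi}" "(\<lambda>y. P y * cnj (P y)) integrable_on {-pi..pi}"
    by (intro integrable_continuous_real continuous_intros F contP)+
  have "((\<lambda>y. 2 * Re (F y * cnj (P y)) - Re (P y * cnj (P y))) has_integral (2 * Re (of_real S) - Re (of_real S))) {-pi..pi}"
    using has_integral_Re[OF integrable_integral[OF intFP(1)]] has_integral_Re[OF integrable_integral[OF intFP(2)]]
    unfolding FP PP by (intro has_integral_diff has_integral_mult_right)
  then have "S = integral {-pi..pi} (\<lambda>y. 2 * Re (F y * cnj (P y)) - Re (P y * cnj (P y)))"
    by (simp add: integral_unique)
  also have "\<dots> \<le> integral {-pi..pi} (\<lambda>y. (norm (F y))\<^sup>2)"
  proof (rule integral_le)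
    show "(\<lambda>y. 2 * Re (F y * cnj (P y)) - Re (P y * cnj (P y))) integrable_on {-pi..pi}"
      by (intro integrable_continuous_real continuous_intros F contP)
    show "(\<lambda>y. (norm (F y))\<^sup>2) integrable_on {-pi..pi}"
      by (intro integrable_continuous_real continuous_intros F)
    fix y
    have "0 \<le> (norm (F y - P y))\<^sup>2" by simp
    also have "\<dots> = (norm (F y))\<^sup>2 - 2 * Re (F y * cnj (P y)) + Re (P y * cnj (P y))"
      unfolding cmod_power2 by (simp add: power2_eq_square algebra_simps)
    finally show "2 * Re (F y * cnj (P y)) - Re (P y * cnj (P y)) \<le> (norm (F y))\<^sup>2" by simp
  qed
  finally show ?thesis unfolding S_def .
qed

lemma fourier_coeff_of_series:
  fixes c :: "nat \<Rightarrow> real"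
  assumes c: "summable (\<lambda>n. \<bar>c n\<bar>)"
  defines "D \<equiv> \<lambda>y::real. \<Sum>n. of_real (c n) * exp (- (\<i> * of_nat n * of_real y))"
  shows "continuous_on {-pi..pi} D"
    and "integral {-pi..pi} (\<lambda>y. D y * exp (\<i> * of_nat m * of_real y)) = of_real (2 * pi * c m)"
proof -
  define d where "d n y = of_real (c n) * exp (- (\<i> * of_nat n * of_real y))" for n and y :: real
  have ul: "uniform_limit {-pi..pi} (\<lambda>N y. \<Sum>n<N. d n y) D sequentially"
    unfolding D_def d_def by (rule Weierstrass_m_test[OF _ c]) (simp add: norm_mult)
  have cont: "continuous_on {-pi..pi} (\<lambda>y. \<Sum>n<N. d n y)" for N
    unfolding d_def by (intro continuous_intros)
  show D: "continuous_on {-pi..pi} D"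
    by (rule uniform_limit_theorem[OF _ ul]) (use cont in auto)
  have "uniform_limit {-pi..pi} (\<lambda>N y. (\<Sum>n<N. d n y) * exp (\<i> * of_nat m * of_real y)) (\<lambda>y. D y * exp (\<i> * of_nat m * of_real y)) sequentially"
    by (rule uniform_lim_mult[OF ul uniform_limit_const])
      (auto intro!: compact_imp_bounded compact_continuous_image continuous_intros D)
  then have "(\<lambda>N. integral {-pi..pi} (\<lambda>y. (\<Sum>n<N. d n y) * exp (\<i> * of_nat m * of_real y))) \<longlonglongrightarrow> integral {-pi..pi} (\<lambda>y. D y * exp (\<i> * of_nat m * of_real y))"
    by (rule integral_uniform_limit) (intro continuous_intros cont)
  moreover have "integral {-pi..pi} (\<lambda>y. (\<Sum>n<N. d n y) * exp (\<i> * of_nat m * of_real y)) = (if m < N then of_real (2 * pi * c m) else 0)" for N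
  proof -
    have "((\<lambda>y. \<Sum>n<N. of_real (c n) * (exp (- (\<i> * of_nat n * of_real y)) * exp (\<i> * of_nat m * of_real y))) has_integral
       (\<Sum>n<N. of_real (c n) * (if n = m then 2 * of_real pi else 0))) {-pi..pi}"
      by (intro has_integral_sum has_integral_mult_right cis_orthogonal) simp
    moreover have "(\<Sum>n<N. of_real (c n) * (if n = m then 2 * of_real pi else 0)) = (if m < N then complex_of_real (2 * pi * c m) else 0)"
      by (simp add: if_distrib cong: if_cong)
    ultimately show ?thesis unfolding d_def sum_distrib_right mult.assoc by (simp add: integral_unique)
  qed
  ultimately have "(\<lambda>N. if m < N then of_real (2 * pi * c m) else 0) \<longlonglongrightarrow> integral {-pi..pi} (\<lambda>y. D y * exp (\<i> * of_nat m * of_real y))"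
    by (simp only:)
  moreover have "(\<lambda>N. if m < N then of_real (2 * pi * c m) else 0) \<longlonglongrightarrow> complex_of_real (2 * pi * c m)"
    by (rule tendsto_eventually) (use eventually_gt_at_top[of m] in eventually_elim, auto)
  ultimately show "integral {-pi..pi} (\<lambda>y. D y * exp (\<i> * of_nat m * of_real y)) = of_real (2 * pi * c m)"
    by (rule LIMSEQ_unique)
qed

text \<open>Multiplying D, whose Fourier coefficients are \<open>c n\<close>, by the kernel K adds
  these coefficients over windows of length h. Bessel's inequality then turns the sum over m into an
  integral of |DK|^2, in which H = 1/h is the width of K.\<close>

lemma block_sum_mean_square_le:
  fixes a :: real and h :: nat
  assumes a: "0 < a" "a \<le> 1 / real h" and h: "h \<ge> 1" and M: "finite M"
  shows "(\<Sum>m\<in>M. (\<Sum>k<h. (rep_count (m + k) - pi) * exp (- a * real (m + k)))\<^sup>2)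
    \<le> 10 ^ 8 * (log_plus (a / 8) * real h + log_plus (a / 8) ^ 3) / a"
proof -
  define H where "H = 1 / real h"
  define L where "L = log_plus (a / 8)"
  define c where "c n = (rep_count n - pi) * exp (- a * real n)" for n
  define D where "D y = (\<Sum>n. of_real (c n) * exp (- (\<i> * of_nat n * of_real y)))" for y :: real
  define K where "K y = (\<Sum>k<h. exp (\<i> * of_real y) ^ k)" for y :: real
  define s where "s y = of_real a + \<i> * of_real y" for y
  define G where "G y = (theta (of_real (pi\<^sup>2) / (of_real a + \<i> * of_real y)))\<^sup>2 - 1" for y
  define Q where "Q y = 1 / ((H\<^sup>2 + y\<^sup>2) * (a\<^sup>2 + y\<^sup>2))" for y
  have H: "H > 0" "a \<le> H" "a \<le> 1" using a h by (auto simp: H_def intro: order_trans)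
  have L1: "L \<ge> 1" using a by (simp add: L_def log_plus_ge_1)
  have Re_s: "Re (s y) = a" and Im_s: "Im (s y) = y" for y by (simp_all add: s_def)
  have sums1: "(\<lambda>n. of_real (rep_count n) * exp (- s y) ^ n) sums (theta (s y))\<^sup>2" for y
    by (rule theta_squared_sums) (simp add: Re_s a)
  have es: "norm (exp (- s y)) < 1" for y using a by (simp add: Re_s)
  have "(\<lambda>n. of_real (rep_count n) * exp (- s y) ^ n - of_real pi * exp (- s y) ^ n) sums ((theta (s y))\<^sup>2 - of_real pi * (1 / (1 - exp (- s y))))" for y
    by (intro sums_diff sums1 sums_mult geometric_sums es)
  moreover have "of_real (rep_count n) * exp (- s y) ^ n - of_real pi * exp (- s y) ^ n = of_real (c n) * exp (- (\<i> * of_nat n * of_real y))" for n y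
  proof -
    have "exp (- s y) ^ n = of_real (exp (- a * real n)) * exp (- (\<i> * of_nat n * of_real y))"
      unfolding exp_of_nat_mult[symmetric] exp_of_real[symmetric] exp_add[symmetric]
      by (rule arg_cong[where f = exp]) (simp add: s_def algebra_simps)
    then show ?thesis by (simp add: c_def left_diff_distrib)
  qed
  ultimately have Deq: "D y = (theta (s y))\<^sup>2 - of_real pi / (1 - exp (- s y))" for y
    unfolding D_def by (simp add: sums_iff)
  have csum: "summable (\<lambda>n. \<bar>c n\<bar>)"
  proof -
    have "summable (\<lambda>n. norm (of_real (rep_count n) * exp (- s 0) ^ n) + pi * exp (- a) ^ n)"
      using a by (intro summable_add summable_mult summable_geometric theta_squared_sums(2)) (auto simp: Re_s)
    then show ?thesis
    proof (rule summable_comparison_test')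
      fix n :: nat
      have "exp (- a * real n) = exp (- a) ^ n" by (simp add: exp_of_nat_mult[symmetric] mult.commute)
      then have "\<bar>c n\<bar> = \<bar>rep_count n - pi\<bar> * exp (- a) ^ n" by (simp add: c_def abs_mult)
      also have "\<dots> \<le> (rep_count n + pi) * exp (- a) ^ n" using rep_nonneg[of n] pi_ge_zero by (intro mult_right_mono) (linarith, simp)
      finally show "norm \<bar>c n\<bar> \<le> norm (of_real (rep_count n) * exp (- s 0) ^ n) + pi * exp (- a) ^ n"
        using rep_nonneg[of n] by (simp add: norm_mult norm_power Re_s distrib_right)
    qed
  qed
  note fD = fourier_coeff_of_series[OF csum, folded D_def]
  have K: "continuous_on A K" for A unfolding K_def by (intro continuous_intros)
  have coeff: "integral {-pi..pi} (\<lambda>y. D y * K y * exp (\<i> * of_nat m * of_real y)) = of_real (2 * pi * (\<Sum>k<h. c (m + k)))" for m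
  proof -
    have "D y * K y * exp (\<i> * of_nat m * of_real y) = (\<Sum>k<h. D y * exp (\<i> * of_nat (m + k) * of_real y))" for y
    proof -
      have "exp (\<i> * of_real y) ^ k * exp (\<i> * of_nat m * of_real y) = exp (\<i> * of_nat (m + k) * of_real y)" for k
        unfolding exp_of_nat_mult[symmetric] exp_add[symmetric]
        by (rule arg_cong[where f = exp]) (simp add: algebra_simps)
      then show ?thesis unfolding K_def by (simp only: sum_distrib_left sum_distrib_right mult.assoc)
    qed
    then have "integral {-pi..pi} (\<lambda>y. D y * K y * exp (\<i> * of_nat m * of_real y))
      = (\<Sum>k<h. integral {-pi..pi} (\<lambda>y. D y * exp (\<i> * of_nat (m + k) * of_real y)))"
      by (simp only:) (intro integral_sum integrable_continuous_real continuous_intros fD(1), simp)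
    also have "\<dots> = (\<Sum>k<h. of_real (2 * pi * c (m + k)))" by (simp only: fD(2))
    finally show ?thesis by (simp add: sum_distrib_left)
  qed
  define S where "S = (\<Sum>m\<in>M. (\<Sum>k<h. c (m + k))\<^sup>2)"
  have S0: "S \<ge> 0" unfolding S_def by (intro sum_nonneg) auto
  have "1 * S \<le> 2 * pi * S" using S0 pi_ge_two by (intro mult_right_mono) auto
  also have "\<dots> \<le> integral {-pi..pi} (\<lambda>y. (norm (D y * K y))\<^sup>2)"
    unfolding S_def by (rule bessel_inequality[OF _ M]) (intro continuous_intros fD K, rule coeff)
  \<comment> \<open>Here 544 = 17 * 32 and 78336 = 17 * 4608, with 17 from the kernel, 32 above
    2\<pi>^2, and 4608 = 2 * 48^2 from the pole error.\<close>
  also have "\<dots> \<le> integral {-pi..pi} (\<lambda>y. 544 * (Q y * (norm (G y))\<^sup>2) + 78336 * (1 / (H\<^sup>2 + y\<^sup>2)))"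
  proof (rule integral_le)
    show "(\<lambda>y. (norm (D y * K y))\<^sup>2) integrable_on {-pi..pi}"
      by (intro integrable_continuous_real continuous_intros fD K)
    show "(\<lambda>y. 544 * (Q y * (norm (G y))\<^sup>2) + 78336 * (1 / (H\<^sup>2 + y\<^sup>2))) integrable_on {-pi..pi}"
    proof (intro integrable_add integrable_on_mult_right)
      show "(\<lambda>y. Q y * (norm (G y))\<^sup>2) integrable_on {-pi..pi}"
        unfolding Q_def G_def by (rule theta_dual_mean_square_le(1)[OF a(1) H(2,3)])
      have "H\<^sup>2 + y\<^sup>2 \<noteq> 0" for y using H by (metis add_pos_nonneg less_irrefl zero_le_power2 zero_less_power)
      then show "(\<lambda>y. 1 / (H\<^sup>2 + y\<^sup>2)) integrable_on {-pi..pi}"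
        by (intro integrable_continuous_real continuous_intros) auto
    qed
    fix y assume y: "y \<in> {-pi..pi}"
    have s0: "s y \<noteq> 0" using a Re_s[of y] by auto
    have ns: "(norm (s y))\<^sup>2 = a\<^sup>2 + y\<^sup>2" unfolding cmod_power2 Re_s Im_s ..
    define E where "E = of_real pi / s y - of_real pi / (1 - exp (- s y))"
    have E: "norm E \<le> 48" unfolding E_def
      by (rule pole_difference_bound) (use a H y Re_s Im_s in auto)
    have "(theta (s y))\<^sup>2 = of_real pi / s y * (theta (of_real pi ^ 2 / s y))\<^sup>2"
      by (rule theta_transformation) (simp add: Re_s a)
    \<comment> \<open>The constant term of the dual series yields \<pi>/s, which nearly cancels
      against \<pi>/(1 - e^(-s)); the rest is \<open>E\<close>.\<close>
    then have "D y = of_real pi / s y * G y + E"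
      unfolding Deq E_def G_def s_def[symmetric] by (simp add: algebra_simps)
    then have "norm (D y) \<le> pi / norm (s y) * norm (G y) + 48"
      using norm_triangle_ineq[of "of_real pi / s y * G y" E] E by (simp add: norm_mult norm_divide)
    then have "(norm (D y))\<^sup>2 \<le> (pi / norm (s y) * norm (G y) + 48)\<^sup>2" by (intro power_mono) auto
    also have "\<dots> \<le> 2 * (pi / norm (s y) * norm (G y))\<^sup>2 + 2 * 48\<^sup>2"
      using sum_squares_bound[of "pi / norm (s y) * norm (G y)" 48] by (simp add: power2_sum)
    also have "\<dots> = 2 * pi\<^sup>2 / (a\<^sup>2 + y\<^sup>2) * (norm (G y))\<^sup>2 + 4608"
      by (simp add: power_mult_distrib power_divide ns)
    also have "\<dots> \<le> 32 / (a\<^sup>2 + y\<^sup>2) * (norm (G y))\<^sup>2 + 4608"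
    proof -
      have "pi\<^sup>2 \<le> 4\<^sup>2" using pi_less_4 by (intro power_mono) auto
      then show ?thesis using a by (intro add_right_mono mult_right_mono divide_right_mono) auto
    qed
    finally have D2: "(norm (D y))\<^sup>2 \<le> 32 / (a\<^sup>2 + y\<^sup>2) * (norm (G y))\<^sup>2 + 4608" .
    have arrange: "(32 / q * g + 4608) * (17 / r) = 544 * (1 / (r * q) * g) + 78336 * (1 / r)" for q r g :: real
      by (simp add: distrib_right mult_ac add_divide_distrib)
    have K2: "(norm (K y))\<^sup>2 \<le> 17 / (H\<^sup>2 + y\<^sup>2)"
      unfolding K_def H_def by (rule geometric_cis_kernel_bound) (use y h in auto)
    have "(norm (D y * K y))\<^sup>2 \<le> (32 / (a\<^sup>2 + y\<^sup>2) * (norm (G y))\<^sup>2 + 4608) * (17 / (H\<^sup>2 + y\<^sup>2))"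
      unfolding norm_mult power_mult_distrib by (intro mult_mono D2 K2) (auto intro: order_trans[OF _ D2])
    also have "\<dots> = 544 * (Q y * (norm (G y))\<^sup>2) + 78336 * (1 / (H\<^sup>2 + y\<^sup>2))"
      unfolding Q_def by (rule arrange)
    finally show "(norm (D y * K y))\<^sup>2 \<le> 544 * (Q y * (norm (G y))\<^sup>2) + 78336 * (1 / (H\<^sup>2 + y\<^sup>2))" .
  qed
  also have "\<dots> = 544 * integral {-pi..pi} (\<lambda>y. Q y * (norm (G y))\<^sup>2) + 78336 * integral {-pi..pi} (\<lambda>y. 1 / (H\<^sup>2 + y\<^sup>2))"
  proof -
    have 1: "(\<lambda>y. Q y * (norm (G y))\<^sup>2) integrable_on {-pi..pi}"
      unfolding Q_def G_def by (rule theta_dual_mean_square_le(1)[OF a(1) H(2,3)])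
    have "H\<^sup>2 + y\<^sup>2 \<noteq> 0" for y using H by (metis add_pos_nonneg less_irrefl zero_le_power2 zero_less_power)
    then have 2: "(\<lambda>y. 1 / (H\<^sup>2 + y\<^sup>2)) integrable_on {-pi..pi}"
      by (intro integrable_continuous_real continuous_intros) auto
    show ?thesis
      by (subst integral_add) (intro integrable_on_mult_right 1 2 | simp only: integral_mult_right)+
  qed
  also have "\<dots> \<le> 544 * (150000 * (L / (a * H) + L ^ 3 / a)) + 78336 * (pi / H)"
    unfolding Q_def G_def L_def
    by (intro add_mono mult_left_mono theta_dual_mean_square_le(2) kernel_integral_le(1) a H) auto
  also have "\<dots> \<le> 81600000 * (L / (a * H) + L ^ 3 / a) + 313344 * (L / (a * H))"
  proof -
    \<comment> \<open>The main term absorbs the error term, since a \<le> 1 \<le> L.\<close>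
    have "pi / H \<le> 4 * (L / (a * H))"
    proof -
      have "pi * a \<le> 4 * L" using pi_less_4 H L1 a by (intro mult_mono) (auto intro: order_trans)
      then have "pi * a / (a * H) \<le> 4 * L / (a * H)" using a H by (intro divide_right_mono) auto
      then show ?thesis using a by simp
    qed
    then show ?thesis by linarith
  qed
  also have "\<dots> \<le> 10 ^ 8 * (L / (a * H) + L ^ 3 / a)"
  proof -
    have *: "81600000 * (u + v) + 313344 * u \<le> 10 ^ 8 * (u + v)" if "u \<ge> 0" "v \<ge> 0" for u v :: real
      using that by simp
    show ?thesis by (rule *) (use a H L1 in auto)
  qed
  also have "\<dots> = 10 ^ 8 * (L * real h + L ^ 3) / a"
    using a h by (simp add: H_def field_simps)
  finally show ?thesis by (simp add: S_def c_def L_def)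
qed

section \<open>Moments of gaps\<close>

lemma rep_eq_0:
  assumes "n > 0" "n \<notin> two_squares"
  shows "rep_count n = 0"
  unfolding rep_count_def
proof (rule sum.neutral, rule ballI, rule ccontr)
  fix i assume i: "i \<in> {..n}" and nz: "square_weight i * square_weight (n - i) \<noteq> 0"
  have sq: "\<exists>k. j = k\<^sup>2" if "square_weight j \<noteq> 0" for j
    using that by (cases "j = 0") (auto simp: square_weight_def split: if_splits intro: exI[of _ 0])
  obtain k l where "i = k\<^sup>2" "n - i = l\<^sup>2" using nz sq[of i] sq[of "n - i"] by (metis mult_eq_0_iff)
  then have "n = k\<^sup>2 + l\<^sup>2" using i by simp
  then have "int n = (int k)\<^sup>2 + (int l)\<^sup>2" by simp
  then show False using assms unfolding two_squares_def by blast
qed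

section \<open>Total length of the long gaps\<close>

lemma s_seq_less_iff: "i \<ge> 1 \<Longrightarrow> j \<ge> 1 \<Longrightarrow> s_seq i < s_seq j \<longleftrightarrow> i < j"
  using strict_mono_on_less[OF s_seq_strict_mono] by simp

lemma between_not_two_squares:
  assumes "n \<ge> 1" "s_seq n < m" "m < s_seq (n + 1)"
  shows "m \<notin> two_squares"
proof
  assume "m \<in> two_squares"
  then obtain i where "i \<ge> 1" "m = s_seq i" using s_seq_range by (metis atLeast_iff imageE)
  then show False using assms s_seq_less_iff[of n i] s_seq_less_iff[of i "n + 1"] by simp
qed

definition gap :: "nat \<Rightarrow> real" where "gap n = real (s_seq (n + 1)) - real (s_seq n)"
definition gaps_upto :: "real \<Rightarrow> nat set" where "gaps_upto x = {n. 1 \<le> n \<and> real (s_seq (n + 1)) \<le> x}"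

lemma s_seq_gap: "n \<ge> 1 \<Longrightarrow> s_seq n < s_seq (n + 1)" by (simp add: s_seq_less_iff)

lemma gap_ge_1: "n \<ge> 1 \<Longrightarrow> gap n \<ge> 1"
  using s_seq_gap[of n] by (simp add: gap_def)

lemma finite_gaps_upto: "finite (gaps_upto x)"
  unfolding gaps_upto_def by (rule finite_s_seq_le)

lemma sum_gaps_le:
  assumes "x \<ge> 0"
  shows "(\<Sum>n\<in>gaps_upto x. gap n) \<le> x"
proof -
  have disj: "disjoint_family_on (\<lambda>n. {s_seq n..<s_seq (n + 1)}) (gaps_upto x)"
  proof -
    have "{s_seq n..<s_seq (n + 1)} \<inter> {s_seq m..<s_seq (m + 1)} = {}" if "1 \<le> n" "n < m" for n m
    proof -
      have "s_seq (n + 1) \<le> s_seq m"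
        using that s_seq_less_iff[of m "n + 1"] by simp
      then show ?thesis by auto
    qed
    then show ?thesis unfolding disjoint_family_on_def gaps_upto_def
      by (metis (no_types, lifting) Int_commute linorder_neqE_nat mem_Collect_eq)
  qed
  have "(\<Sum>n\<in>gaps_upto x. gap n) = (\<Sum>n\<in>gaps_upto x. real (card {s_seq n..<s_seq (n + 1)}))"
    by (intro sum.cong refl) (use s_seq_gap in \<open>auto simp: gap_def gaps_upto_def of_nat_diff less_imp_le\<close>)
  also have "\<dots> = real (card (\<Union>n\<in>gaps_upto x. {s_seq n..<s_seq (n + 1)}))"
    by (subst card_UN_disjoint) (use disj finite_gaps_upto in \<open>auto simp: disjoint_family_on_def\<close>)
  also have "card (\<Union>n\<in>gaps_upto x. {s_seq n..<s_seq (n + 1)}) \<le> card {..<nat \<lfloor>x\<rfloor>}"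
  proof (rule card_mono)
    show "(\<Union>n\<in>gaps_upto x. {s_seq n..<s_seq (n + 1)}) \<subseteq> {..<nat \<lfloor>x\<rfloor>}"
      by (auto simp: gaps_upto_def le_nat_floor intro: less_le_trans)
  qed simp
  also have "real (card {..<nat \<lfloor>x\<rfloor>}) \<le> x" using assms by simp
  finally show ?thesis by simp
qed

lemma log_bounds:
  fixes x :: real assumes x: "x \<ge> 2"
  shows "ln x \<ge> 1 / 2" "log_plus ((1 / x) / 8) \<le> 7 * ln x"
proof -
  have "ln x \<ge> ln 2" using x by simp
  moreover have "ln 2 \<ge> (1 / 2 :: real)" using ln2_ge_two_thirds by simp
  ultimately show l: "ln x \<ge> 1 / 2" by linarith
  \<comment> \<open>The 7 is 2 + 5: on one side 1 \<le> 2 ln x, on the other 1 + 8x \<le> x^5 for x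
    \<ge> 2.\<close>
  have "1 + 8 * x \<le> 16 * x" using x by simp
  also have "\<dots> \<le> x ^ 4 * x" using power_mono[of 2 x 4] x by (intro mult_right_mono) auto
  also have "\<dots> = x ^ 5" by (simp add: eval_nat_numeral)
  finally have "ln (1 + 8 * x) \<le> ln (x ^ 5)" using x by (intro ln_mono) auto
  also have "\<dots> = 5 * ln x" using x by (simp add: ln_realpow)
  finally show "log_plus ((1 / x) / 8) \<le> 7 * ln x" using l by (simp add: log_plus_def mult.commute)
qed

text \<open>Choose a = 1/x. A gap of length at least 2h contains so many windows of length h that
  their starting points make up at least half of its length, so counting starting points controls
  the total length.\<close>

lemma long_gaps_le:
  assumes x: "x \<ge> 2" and h: "1 \<le> h" "real h \<le> x"
  shows "(\<Sum>n\<in>{n \<in> gaps_upto x. gap n \<ge> 2 * real h}. gap n)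
    \<le> 2 * 10 ^ 8 * x * (7 * ln x / real h + 343 * (ln x) ^ 3 / (real h)\<^sup>2)"
proof -
  define S where "S = {n \<in> gaps_upto x. gap n \<ge> 2 * real h}"
  \<comment> \<open>The starting points m for which m, ..., m + h - 1 lie strictly between the two
    consecutive sums of two squares.\<close>
  define I where "I n = {s_seq n + 1..s_seq (n + 1) - h}" for n
  define M where "M = (\<Union>n\<in>S. I n)"
  define L where "L = log_plus ((1 / x) / 8)"
  have finS: "finite S" unfolding S_def using finite_gaps_upto by simp
  have S: "n \<ge> 1" "real (s_seq (n + 1)) \<le> x" "real (s_seq n) + 2 * real h \<le> real (s_seq (n + 1))" if "n \<in> S" for n
    using that by (auto simp: S_def gaps_upto_def gap_def)
  have cardI: "gap n \<le> 2 * real (card (I n))" if "n \<in> S" for n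
  proof -
    have "s_seq n + 2 * h \<le> s_seq (n + 1)" using S(3)[OF that] by linarith
    then show ?thesis by (simp add: I_def gap_def of_nat_diff)
  qed
  have disj: "I n \<inter> I m = {}" if "n \<in> S" "m \<in> S" "n < m" for n m
  proof -
    have "s_seq (n + 1) \<le> s_seq m" using S(1) that s_seq_less_iff[of m "n + 1"] by simp
    then show ?thesis by (auto simp: I_def)
  qed
  have cardM: "(\<Sum>n\<in>S. real (card (I n))) = real (card M)"
    unfolding M_def
  proof (subst card_UN_disjoint)
    show "\<forall>n\<in>S. \<forall>m\<in>S. n \<noteq> m \<longrightarrow> I n \<inter> I m = {}"
      using disj by (metis Int_commute linorder_neqE_nat)
  qed (auto simp: finS I_def)
  \<comment> \<open>All representation numbers in the window vanish, so only the mean \<pi> is left,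
    with a weight of at least 1/e \<ge> 1/3.\<close>
  have block: "(real h)\<^sup>2 \<le> (\<Sum>k<h. (rep_count (m + k) - pi) * exp (- (1 / x) * real (m + k)))\<^sup>2" if m: "m \<in> M" for m
  proof -
    obtain n where n: "n \<in> S" "m \<in> I n" using m by (auto simp: M_def)
    have "(\<Sum>k<h. pi * exp (- (1 / x) * real (m + k))) \<ge> (\<Sum>k<h. 1)"
    proof (rule sum_mono)
      fix k assume k: "k \<in> {..<h}"
      have "m + k < s_seq (n + 1)" using n k by (auto simp: I_def)
      then have "real (m + k) \<le> x" using S(2)[OF n(1)] by linarith
      then have "- 1 \<le> - (1 / x) * real (m + k)" using x by (simp add: field_simps)
      then have "exp (- 1) \<le> exp (- (1 / x) * real (m + k))" by simp
      moreover have "1 / 3 \<le> exp (- 1 :: real)" using exp_le by (simp add: exp_minus field_simps)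
      ultimately have "1 / 3 \<le> exp (- (1 / x) * real (m + k))" by (rule order_trans[rotated])
      then have "3 * (1 / 3) \<le> pi * exp (- (1 / x) * real (m + k))"
        using pi_gt3 by (intro mult_mono) linarith+
      then show "1 \<le> pi * exp (- (1 / x) * real (m + k))" by simp
    qed
    moreover have "(\<Sum>k<h. (rep_count (m + k) - pi) * exp (- (1 / x) * real (m + k))) = - (\<Sum>k<h. pi * exp (- (1 / x) * real (m + k)))"
      unfolding sum_negf[symmetric]
    proof (rule sum.cong[OF refl])
      fix k assume k: "k \<in> {..<h}"
      have "m + k < s_seq (n + 1)" "s_seq n < m + k" using n k by (auto simp: I_def)
      then have "rep_count (m + k) = 0" using between_not_two_squares[OF S(1)[OF n(1)]] by (intro rep_eq_0) auto
      then show "(rep_count (m + k) - pi) * exp (- (1 / x) * real (m + k)) = - (pi * exp (- (1 / x) * real (m + k)))" by simp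
    qed
    ultimately show ?thesis by (simp add: power_mono)
  qed
  have "real (card M) * (real h)\<^sup>2 \<le> (\<Sum>m\<in>M. (\<Sum>k<h. (rep_count (m + k) - pi) * exp (- (1 / x) * real (m + k)))\<^sup>2)"
    using sum_mono[of M "\<lambda>_. (real h)\<^sup>2", OF block] by simp
  also have "\<dots> \<le> 10 ^ 8 * (L * real h + L ^ 3) / (1 / x)"
    unfolding L_def
    by (rule block_sum_mean_square_le) (use x h finS in \<open>auto simp: M_def I_def frac_le\<close>)
  also have "\<dots> \<le> 10 ^ 8 * (7 * ln x * real h + (7 * ln x) ^ 3) / (1 / x)"
  proof -
    have "0 \<le> L" using log_plus_ge_1[of "(1 / x) / 8"] x by (simp add: L_def)
    moreover have "L \<le> 7 * ln x" unfolding L_def by (rule log_bounds[OF x])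
    ultimately show ?thesis using x
      by (intro divide_right_mono mult_left_mono add_mono mult_right_mono power_mono) auto
  qed
  finally have card: "real (card M) * (real h)\<^sup>2 \<le> 10 ^ 8 * x * (7 * ln x * real h + 343 * (ln x) ^ 3)"
    by (simp add: power_mult_distrib mult_ac)
  have "(\<Sum>n\<in>S. gap n) \<le> (\<Sum>n\<in>S. 2 * real (card (I n)))" by (intro sum_mono cardI)
  also have "\<dots> = 2 * real (card M)" by (simp add: sum_distrib_left[symmetric] cardM)
  also have "\<dots> \<le> 2 * (10 ^ 8 * x * (7 * ln x * real h + 343 * (ln x) ^ 3) / (real h)\<^sup>2)"
    using card h by (intro mult_left_mono) (auto simp: pos_le_divide_eq)
  also have "\<dots> = 2 * 10 ^ 8 * x * (7 * ln x / real h + 343 * (ln x) ^ 3 / (real h)\<^sup>2)"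
    using h by (simp add: field_simps power2_eq_square)
  finally show ?thesis unfolding S_def .
qed

section \<open>Summation over dyadic scales\<close>

text \<open>For h = 2^(j - 1) \<ge> M = (ln x)^(3/2) the cubic term is M^2/h^2 \<le> M/h, and ln x
  \<le> 2M handles the other one. The constant 10^12 is generous.\<close>

lemma dyadic_gaps_le:
  assumes x: "x \<ge> 2"
  shows "(\<Sum>n\<in>{n \<in> gaps_upto x. gap n \<ge> 2 ^ j}. gap n) \<le> x * min 1 (10 ^ 12 * ln x powr (3 / 2) / 2 ^ j)"
proof -
  define M where "M = ln x powr (3 / 2)"
  define T where "T = (\<Sum>n\<in>{n \<in> gaps_upto x. gap n \<ge> 2 ^ j}. gap n)"
  have l: "ln x \<ge> 1 / 2" by (rule log_bounds[OF x])
  have M2: "M\<^sup>2 = ln x ^ 3"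
  proof -
    have "M\<^sup>2 = ln x powr (3 / 2 + 3 / 2)" unfolding M_def powr_add power2_eq_square ..
    also have "\<dots> = ln x ^ 3" using l by simp
    finally show ?thesis .
  qed
  have M_ge: "ln x \<le> 2 * M"
  proof -
    have "(ln x)\<^sup>2 * 1 \<le> (ln x)\<^sup>2 * (4 * ln x)" using l by (intro mult_left_mono) auto
    also have "\<dots> = (2 * M)\<^sup>2" unfolding power_mult_distrib M2 by (simp add: power2_eq_square power3_eq_cube)
    finally show ?thesis using l by (intro power2_le_imp_le[of "ln x" "2 * M"]) (auto simp: M_def)
  qed
  have M0: "M \<ge> 1 / 4" using M_ge l by linarith
  have gap0: "gap n \<ge> 0" if "n \<in> gaps_upto x" for n
    using gap_ge_1[of n] that by (simp add: gaps_upto_def)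
  have Tx: "T \<le> x"
  proof -
    have "T \<le> (\<Sum>n\<in>gaps_upto x. gap n)"
      unfolding T_def by (rule sum_mono2[OF finite_gaps_upto]) (auto simp: gap0)
    then show ?thesis using sum_gaps_le[of x] x by linarith
  qed
  have "T \<le> x * (10 ^ 12 * M / 2 ^ j)"
  \<comment> \<open>At small scales, and for j = 0 where no halved h exists, the claimed bound is at
    least the trivial bound x.\<close>
  proof (cases "2 ^ j \<le> 2 * M \<or> j = 0")
    case True
    then have "1 \<le> 10 ^ 12 * M / 2 ^ j" using M0 by (auto simp: field_simps)
    then have "x * 1 \<le> x * (10 ^ 12 * M / 2 ^ j)" using x by (intro mult_left_mono) auto
    then show ?thesis using Tx by linarith
  next
    case False
    then obtain i where j: "j = Suc i" by (cases j) auto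
    define h where "h = (2::nat) ^ i"
    have h: "h \<ge> 1" "2 * real h = 2 ^ j" "M \<le> real h" using False by (auto simp: h_def j)
    show ?thesis
    proof (cases "real h \<le> x")
      case True
      have "T \<le> 2 * 10 ^ 8 * x * (7 * ln x / real h + 343 * (ln x) ^ 3 / (real h)\<^sup>2)"
        using long_gaps_le[OF x h(1) True] unfolding T_def h(2) .
      also have "\<dots> \<le> 2 * 10 ^ 8 * x * (14 * M / real h + 343 * M / real h)"
      proof (intro mult_left_mono add_mono)
        show "7 * ln x / real h \<le> 14 * M / real h" using M_ge h by (intro divide_right_mono) auto
        have "343 * (ln x) ^ 3 / (real h)\<^sup>2 = 343 * (M * (M / real h)) / real h"
          by (simp add: M2[symmetric] power2_eq_square)
        also have "\<dots> \<le> 343 * (M * 1) / real h"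
          using h M0 by (intro divide_right_mono mult_left_mono) auto
        finally show "343 * (ln x) ^ 3 / (real h)\<^sup>2 \<le> 343 * M / real h" by simp
      qed (use x in auto)
      also have "\<dots> = x * (714 * 10 ^ 8 * M / real h)" by (simp add: field_simps)
      also have "\<dots> \<le> x * (10 ^ 12 * M / (2 * real h))"
        using x M0 h by (intro mult_left_mono) (auto simp: field_simps)
      finally show ?thesis unfolding h(2) .
    next
      case False
      have "gap n < 2 ^ j" if "n \<in> gaps_upto x" for n
        using that False h(2) x by (auto simp: gaps_upto_def gap_def)
      then have "{n \<in> gaps_upto x. gap n \<ge> 2 ^ j} = {}" by force
      then have "T = 0" unfolding T_def by (simp only: sum.empty)
      then show ?thesis using x M0 by simp
    qed
  qed
  then have "T \<le> x * min 1 (10 ^ 12 * M / 2 ^ j)" using Tx by (simp add: min_def)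
  then show ?thesis unfolding T_def M_def .
qed

text \<open>A gap in [2^k, 2^(k + 1)) satisfies gap^(1 + r) \<le> gap * 2^((k + 1) r). Adding the
  nonnegative terms of the other scales replaces the shells by tails, which are what has been
  estimated.\<close>

lemma gap_moment_le_dyadic:
  assumes x: "x \<ge> 2" and r: "r > 0" and J: "x < 2 ^ Suc J"
  shows "(\<Sum>n\<in>gaps_upto x. gap n powr (1 + r))
    \<le> 2 powr r * (\<Sum>j\<le>J. (2 powr r) ^ j * (\<Sum>n\<in>{n \<in> gaps_upto x. gap n \<ge> 2 ^ j}. gap n))"
proof -
  define c where "c j = 2 powr r * (2 powr r) ^ j" for j :: nat
  have c: "c j = (2 ^ Suc j) powr r" "c j \<ge> 0" for j
    by (simp_all add: c_def powr_mult powr_power[symmetric] flip: powr_realpow) (simp add: powr_powr mult.commute)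
  have "(\<Sum>n\<in>gaps_upto x. gap n powr (1 + r)) \<le> (\<Sum>n\<in>gaps_upto x. \<Sum>j\<le>J. c j * (if gap n \<ge> 2 ^ j then gap n else 0))"
  proof (rule sum_mono)
    fix n assume n: "n \<in> gaps_upto x"
    have g: "1 \<le> gap n" "gap n \<le> x" using n gap_ge_1[of n] by (auto simp: gaps_upto_def gap_def)
    define k where "k = (LEAST k. gap n < 2 ^ Suc k)"
    have "gap n < 2 ^ Suc J" using g J by linarith
    then have k: "gap n < 2 ^ Suc k" "k \<le> J" unfolding k_def by (auto intro: LeastI Least_le)
    have lo: "2 ^ k \<le> gap n"
    proof (cases k)
      case (Suc i)
      then have "\<not> gap n < 2 ^ Suc i" using not_less_Least[of i "\<lambda>k. gap n < 2 ^ Suc k"] k_def by simp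
      then show ?thesis using Suc by simp
    qed (use g in simp)
    have "gap n powr (1 + r) = gap n * gap n powr r" using g by (simp add: powr_add)
    also have "\<dots> \<le> gap n * (2 ^ Suc k) powr r"
      using g k r by (intro mult_left_mono powr_mono2) auto
    also have "\<dots> = c k * (if gap n \<ge> 2 ^ k then gap n else 0)" using lo by (simp add: c)
    also have "\<dots> \<le> (\<Sum>j\<le>J. c j * (if gap n \<ge> 2 ^ j then gap n else 0))"
      using k g c(2) by (intro member_le_sum) auto
    finally show "gap n powr (1 + r) \<le> (\<Sum>j\<le>J. c j * (if gap n \<ge> 2 ^ j then gap n else 0))" .
  qed
  also have "\<dots> = (\<Sum>j\<le>J. c j * (\<Sum>n\<in>gaps_upto x. if gap n \<ge> 2 ^ j then gap n else 0))"
    by (subst sum.swap) (simp only: sum_distrib_left)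
  also have "\<dots> = (\<Sum>j\<le>J. c j * (\<Sum>n\<in>{n \<in> gaps_upto x. gap n \<ge> 2 ^ j}. gap n))"
    by (simp add: sum.inter_filter[OF finite_gaps_upto])
  finally show ?thesis by (simp add: c_def sum_distrib_left mult.assoc)
qed

text \<open>Below the scale M the terms grow geometrically with ratio 2^r, above it they decay with
  ratio 2^(r - 1), so for r < 1 both sides are governed by the crossover value M^r. For r = 1 there
  is no decay, and each of the J + 1 scales costs up to M.\<close>

lemma dyadic_sum_le:
  fixes M r :: real
  assumes M: "M \<ge> 1" and r: "0 < r"
  shows "r < 1 \<Longrightarrow> (\<Sum>j\<le>J. (2 powr r) ^ j * min 1 (M / 2 ^ j))
      \<le> (2 powr r / (2 powr r - 1) + 1 / (1 - 2 powr (r - 1))) * M powr r"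
    and "r = 1 \<Longrightarrow> (\<Sum>j\<le>J. (2 powr r) ^ j * min 1 (M / 2 ^ j)) \<le> (real J + 1) * M"
proof -
  assume r1: "r < 1"
  define q where "q = 2 powr r"
  define p where "p = 2 powr (r - 1)"
  have q: "q > 1" using r by (simp add: q_def)
  have p: "0 < p" "p < 1" using r1 powr_less_mono[of "r - 1" 0 2] by (simp_all add: p_def)
  have qp: "q / 2 = p" by (simp add: q_def p_def powr_diff)
  \<comment> \<open>The crossover index: M < 2^k \<le> 2M.\<close>
  define k where "k = (LEAST k. M < 2 ^ k)"
  have ex: "\<exists>k. M < 2 ^ k" using real_arch_pow[of 2 M] by simp
  have k: "M < 2 ^ k" unfolding k_def by (rule LeastI_ex[OF ex])
  have lo: "2 ^ j \<le> M" if "j < k" for j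
    using not_less_Least[of j "\<lambda>k. M < 2 ^ k"] that k_def by simp
  have k0: "k \<noteq> 0" using k M by (intro notI) simp
  have up: "2 ^ k \<le> 2 * M" using lo[of "k - 1"] k0 by (cases k) auto
  have pw: "(2 powr u) ^ k = (2 ^ k) powr u" for u :: real
    by (simp add: powr_power powr_powr mult.commute flip: powr_realpow)
  have "(\<Sum>j\<le>J. q ^ j * min 1 (M / 2 ^ j)) \<le> (\<Sum>j\<le>J. (if j < k then q ^ j else 0) + (if k \<le> j then M * p ^ j else 0))"
  proof (rule sum_mono)
    fix j
    have "q ^ j * min 1 (M / 2 ^ j) \<le> q ^ j * 1" using q by (intro mult_left_mono) auto
    moreover have "q ^ j * min 1 (M / 2 ^ j) \<le> q ^ j * (M / 2 ^ j)" using q by (intro mult_left_mono) auto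
    moreover have "q ^ j * (M / 2 ^ j) = M * p ^ j" unfolding qp[symmetric] by (simp add: power_divide)
    ultimately show "q ^ j * min 1 (M / 2 ^ j) \<le> (if j < k then q ^ j else 0) + (if k \<le> j then M * p ^ j else 0)"
      by (cases "j < k") auto
  qed
  also have "\<dots> = (\<Sum>j\<le>J. if j < k then q ^ j else 0) + (\<Sum>j\<le>J. if k \<le> j then M * p ^ j else 0)"
    by (rule sum.distrib)
  also have "(\<Sum>j\<le>J. if j < k then q ^ j else 0) = (\<Sum>j\<in>{j\<in>{..J}. j < k}. q ^ j)"
    by (simp only: sum.inter_filter[OF finite_atMost])
  also have "\<dots> \<le> (\<Sum>j<k. q ^ j)" using q by (intro sum_mono2) auto
  also have "\<dots> = (q ^ k - 1) / (q - 1)" using q by (simp add: geometric_sum)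
  also have "\<dots> \<le> q * M powr r / (q - 1)"
  proof (intro divide_right_mono)
    have "q ^ k \<le> (2 * M) powr r" unfolding q_def pw using up r by (intro powr_mono2) auto
    then show "q ^ k - 1 \<le> q * M powr r" using M by (simp add: powr_mult q_def)
  qed (use q in simp)
  also have "(\<Sum>j\<le>J. if k \<le> j then M * p ^ j else 0) = (\<Sum>j\<in>{j\<in>{..J}. k \<le> j}. M * p ^ j)"
    by (simp only: sum.inter_filter[OF finite_atMost])
  also have "\<dots> \<le> (\<Sum>j\<in>{k..<k + Suc J}. M * p ^ j)" using p M by (intro sum_mono2) auto
  also have "\<dots> = (\<Sum>j<Suc J. M * p ^ k * p ^ j)"
    by (rule sum.reindex_bij_witness[of _ "\<lambda>j. j + k" "\<lambda>j. j - k"]) (auto simp flip: power_add)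
  also have "\<dots> = M * p ^ k * ((1 - p ^ Suc J) / (1 - p))"
    using p by (simp only: sum_distrib_left[symmetric] sum_gp_strict) simp
  also have "\<dots> \<le> M * M powr (r - 1) * (1 / (1 - p))"
  proof (intro mult_mono divide_right_mono)
    show "p ^ k \<le> M powr (r - 1)" unfolding p_def pw using k M r1 by (intro powr_mono2') auto
  qed (use p M in \<open>auto simp: power_le_one simp del: power_Suc\<close>)
  also have "M * M powr (r - 1) = M powr r" using M by (simp add: powr_diff)
  finally show "(\<Sum>j\<le>J. (2 powr r) ^ j * min 1 (M / 2 ^ j))
      \<le> (2 powr r / (2 powr r - 1) + 1 / (1 - 2 powr (r - 1))) * M powr r"
    by (simp add: q_def p_def distrib_right)
next
  assume "r = 1"
  then have "(\<Sum>j\<le>J. (2 powr r) ^ j * min 1 (M / 2 ^ j)) \<le> (\<Sum>j\<le>J. M)"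
    by (intro sum_mono) (simp add: min_def field_simps)
  then show "(\<Sum>j\<le>J. (2 powr r) ^ j * min 1 (M / 2 ^ j)) \<le> (real J + 1) * M" by (simp add: mult.commute add.commute)
qed

theorem theorem4:
  fixes \<gamma> :: real
  assumes "1 < \<gamma>" and "\<gamma> \<le> 2"
  shows "\<exists>C::real. C > 0 \<and> (\<forall>x::real. x \<ge> 2 \<longrightarrow>
    (\<Sum>n\<in>{n. 1 \<le> n \<and> real (s_seq (n + 1)) \<le> x}.
        (real (s_seq (n + 1)) - real (s_seq n)) powr \<gamma>)
      \<le> C * x * (ln x powr (3 / 2 * (\<gamma> - 1))) * log_factor x \<gamma>)"
proof -
  define r where "r = \<gamma> - 1"
  have r: "0 < r" "r \<le> 1" using assms by (auto simp: r_def)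
  define A :: real where "A = 10 ^ 12"
  \<comment> \<open>The 4 for r = 1 comes from the number of scales, J + 1 \<le> 4 ln x; the factor
    ln x itself is supplied by \<open>log_factor\<close>.\<close>
  define B where "B = (if r < 1 then 2 powr r / (2 powr r - 1) + 1 / (1 - 2 powr (r - 1)) else 4)"
  have B: "B > 0"
  proof -
    have "2 powr r > 1" using r by simp
    moreover have "2 powr (r - 1) < 1" if "r < 1" using that powr_less_mono[of "r - 1" 0 2] by simp
    ultimately show ?thesis by (auto simp: B_def intro!: add_pos_pos divide_pos_pos)
  qed
  have "(\<Sum>n\<in>gaps_upto x. gap n powr (1 + r)) \<le> (2 powr r * B * A powr r) * x * (ln x powr (3 / 2 * r)) * log_factor x \<gamma>"
    if x: "x \<ge> 2" for x
  proof -
    define M where "M = A * ln x powr (3 / 2)"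
    define J where "J = nat \<lfloor>log 2 x\<rfloor>"
    have l: "ln x \<ge> 1 / 2" by (rule log_bounds[OF x])
    have log0: "log 2 x \<ge> 0" using x by simp
    have J: "x < 2 ^ Suc J" "real J + 1 \<le> 4 * ln x"
    proof -
      have "log 2 x < real (Suc J)" using log0 by (simp add: J_def) linarith
      then have "x < 2 powr real (Suc J)" using x by (simp add: log_less_iff)
      then show "x < 2 ^ Suc J" by (simp only: powr_realpow zero_less_numeral)
      have "real J \<le> log 2 x" using log0 by (simp add: J_def)
      also have "\<dots> \<le> 2 * ln x"
      proof -
        have "ln x / ln 2 \<le> ln x / (1 / 2)" using l ln2_ge_two_thirds by (intro divide_left_mono) auto
        then show ?thesis by (simp add: log_def)
      qed
      finally show "real J + 1 \<le> 4 * ln x" using l by linarith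
    qed
    \<comment> \<open>For x near 2 the power of ln x may be below 1, but it is at least 1/4, which
      the size of \<open>A\<close> compensates.\<close>
    have M: "M \<ge> 1"
    proof -
      have "(1 / 2) powr (3 / 2) \<le> ln x powr (3 / 2)" using l by (intro powr_mono2) auto
      moreover have "(1 / 2) powr 2 \<le> (1 / 2 :: real) powr (3 / 2)" by (intro powr_mono') auto
      ultimately have "1 / 4 \<le> ln x powr (3 / 2)" by (simp add: power2_eq_square)
      then show ?thesis by (simp add: M_def A_def)
    qed
    have sum: "(\<Sum>j\<le>J. (2 powr r) ^ j * min 1 (M / 2 ^ j)) \<le> B * M powr r * log_factor x \<gamma>"
    proof (cases "r < 1")
      case True
      then show ?thesis using dyadic_sum_le(1)[OF M r(1) True, of J] by (simp add: B_def log_factor_def r_def)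
    next
      case False
      then have r1: "r = 1" using r by simp
      have "(real J + 1) * M \<le> (4 * ln x) * M" using J M by (intro mult_right_mono) auto
      moreover have "B * M powr r * log_factor x \<gamma> = (4 * ln x) * M"
        using r1 M by (simp add: B_def log_factor_def r_def)
      ultimately show ?thesis using dyadic_sum_le(2)[OF M r(1) r1, of J] by linarith
    qed
    have "(\<Sum>n\<in>gaps_upto x. gap n powr (1 + r)) \<le> 2 powr r * (\<Sum>j\<le>J. (2 powr r) ^ j * (\<Sum>n\<in>{n \<in> gaps_upto x. gap n \<ge> 2 ^ j}. gap n))"
      by (rule gap_moment_le_dyadic[OF x r(1) J(1)])
    also have "\<dots> \<le> 2 powr r * (\<Sum>j\<le>J. (2 powr r) ^ j * (x * min 1 (M / 2 ^ j)))"
      unfolding M_def A_def by (intro mult_left_mono sum_mono dyadic_gaps_le x) auto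
    also have "\<dots> = 2 powr r * (x * (\<Sum>j\<le>J. (2 powr r) ^ j * min 1 (M / 2 ^ j)))"
      by (simp add: sum_distrib_left mult_ac)
    also have "\<dots> \<le> 2 powr r * (x * (B * M powr r * log_factor x \<gamma>))"
      using sum x by (intro mult_left_mono) auto
    also have "M powr r = A powr r * ln x powr (3 / 2 * r)"
      using l by (simp add: M_def A_def powr_mult powr_powr)
    finally show ?thesis by (simp add: mult_ac)
  qed
  moreover have "2 powr r * B * A powr r > 0" using B by (simp add: A_def)
  moreover have "1 + r = \<gamma>" by (simp add: r_def)
  ultimately show ?thesis unfolding gaps_upto_def gap_def r_def
    by (intro exI[of _ "2 powr (\<gamma> - 1) * B * A powr (\<gamma> - 1)"]) simp
qed

end
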